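(* Let $n\ge 1$ be an integer, $1<p<1+2/n$, $\lambda\in\mathbb{C}\setminus\{0\}$, $f\in L^2(\mathbb{R}^n)$ (complex-valued), and let $k$ be a real number with $n<k<2/(p-1)$. Write $\lambda_1=\operatorname{Re}\lambda$, $\lambda_2=\operatorname{Im}\lambda$, $f_1=\operatorname{Re}f$, $f_2=\operatorname{Im}f$. Suppose that at least one of the following two conditions holds: (i) $f_1\in L^1(\mathbb{R}^n)$ and $\lambda_2 f_1(x)\ge |x|^{-k}$ for $|x|>1$; (ii) $f_2\in L^1(\mathbb{R}^n)$ and $-\lambda_1 f_2(x)\ge |x|^{-k}$ for $|x|>1$. For $\varepsilon>0$ let $T_\varepsilon$ be the lifespan of the $L^2$-solution of $i\partial_t u+\Delta u=\lambda|u|^p$ with $u(0,x)=\varepsilon f(x)$. Then there exist $\varepsilon_0>0$ and a positive constant $C=C(k,p,\lambda)$ such that $$T_\varepsilon\le C\,\varepsilon^{1/\kappa}\qquad\text{for all }\varepsilon\in(0,\varepsilon_0),$$ where $\kappa=\dfrac{k}{2}-\dfrac{1}{p-1}$.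
   Context: Let $U(t)=\exp(it\Delta)$ be the free Schrödinger evolution group on $\mathbb{R}^n$. The Cauchy problem $i\partial_t u+\Delta u=\lambda|u|^p$, $u(0,\cdot)=\varepsilon f$, is understood through the integral equation $$u(t)=\varepsilon U(t)f-i\lambda\int_0^t U(t-s)|u(s)|^p\,ds .\qquad (\ast)$$ Put $\rho=p+1$ and define $r$ by $2/r=n/2-n/\rho$. An $L^2$-solution on $[0,T)$ is a function $u\in C([0,T);L^2)\cap L^r_t(0,T;L^\rho_x)$ satisfying $(\ast)$. The lifespan is $$T_\varepsilon=\sup\{T\in(0,\infty]:\ \text{there exists a unique solution } u \text{ of }(\ast)\text{ such that } u\in C([0,T);L^2)\cap L^r_t(0,T;L^\rho_x)\}.$$ *)

theory Defs
  imports "HOL-Analysis.Analysis"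
begin

text \<open>
  Elements of Lebesgue spaces on \<open>\<real>\<^sup>n\<close> (the type \<open>real ^ 'n\<close>, \<open>n = CARD('n)\<close>) are represented by
  Borel functions; every Lebesgue class has such a representative. No quotient is formed: equality
  of classes is written out as equality almost everywhere wherever it matters.
\<close>

definition in_Lp :: "real \<Rightarrow> (real ^ 'n \<Rightarrow> complex) \<Rightarrow> bool" where
  "in_Lp q g \<longleftrightarrow>
     g \<in> borel_measurable lborel \<and> integrable lborel (\<lambda>x. cmod (g x) powr q)"

text \<open>Meaningful only if \<open>in_Lp q g\<close>.\<close>

definition Lp_norm :: "real \<Rightarrow> (real ^ 'n \<Rightarrow> complex) \<Rightarrow> real" where
  "Lp_norm q g = (\<integral>x. cmod (g x) powr q \<partial>lborel) powr (1 / q)"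


subsection \<open>Schwartz functions and tempered distributions\<close>

definition partial_deriv :: "'n \<Rightarrow> (real ^ 'n \<Rightarrow> complex) \<Rightarrow> real ^ 'n \<Rightarrow> complex" where
  "partial_deriv i g x = frechet_derivative g (at x) (axis i 1)"

definition schwartz :: "(real ^ 'n \<Rightarrow> complex) \<Rightarrow> bool" where
  "schwartz \<phi> \<longleftrightarrow>
     (\<forall>is :: 'n list.
        (\<forall>x. foldr partial_deriv is \<phi> differentiable (at x)) \<and>
        (\<forall>N :: nat. \<exists>B. \<forall>x. (1 + norm x) ^ N * cmod (foldr partial_deriv is \<phi> x) \<le> B))"

text \<open>
  A tempered distribution is applied to Schwartz functions only; its values at other arguments are
  irrelevant, so that equality of distributions means equality at every Schwartz function.
\<close>

type_synonym 'n distr = "(real ^ 'n \<Rightarrow> complex) \<Rightarrow> complex"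

text \<open>The pairing is bilinear: there is no complex conjugation.\<close>

definition distr_of :: "(real ^ 'n \<Rightarrow> complex) \<Rightarrow> 'n distr" where
  "distr_of g \<phi> = (\<integral>x. g x * \<phi> x \<partial>lborel)"


subsection \<open>The free Schroedinger group\<close>

definition fourier :: "(real ^ 'n \<Rightarrow> complex) \<Rightarrow> real ^ 'n \<Rightarrow> complex" where
  "fourier \<phi> \<xi> = (\<integral>x. cis (- (x \<bullet> \<xi>)) * \<phi> x \<partial>lborel)"

text \<open>
  On Schwartz functions, \<open>U(t) = exp(it\<Delta>)\<close> is the Fourier multiplier with symbol
  \<open>exp(-it|\<xi>|\<^sup>2)\<close>; the integral below is the inverse Fourier transform.
\<close>

definition schroedinger_schwartz ::
    "real \<Rightarrow> (real ^ 'n \<Rightarrow> complex) \<Rightarrow> real ^ 'n \<Rightarrow> complex" where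
  "schroedinger_schwartz t \<phi> x =
     complex_of_real (1 / (2 * pi) ^ CARD('n)) *
       (\<integral>\<xi>. cis (x \<bullet> \<xi>) * (cis (- t * (norm \<xi>)\<^sup>2) * fourier \<phi> \<xi>) \<partial>lborel)"

text \<open>
  On tempered distributions, \<open>U(t)\<close> is defined by duality. The convolution kernel of \<open>U(t)\<close> is even,
  so \<open>U(t)\<close> is its own transpose for the bilinear pairing and no sign of \<open>t\<close> changes. This covers
  both \<open>L\<^sup>2\<close>, where it is the usual unitary group, and the space \<open>L\<^bsup>\<rho>/p\<^esup>\<close>, which contains \<open>|u(s)|\<^sup>p\<close>
  for almost every \<open>s\<close> but is not contained in \<open>L\<^sup>2\<close>.
\<close>

definition schroedinger :: "real \<Rightarrow> 'n::finite distr \<Rightarrow> 'n distr" where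
  "schroedinger t S \<phi> = S (schroedinger_schwartz t \<phi>)"


subsection \<open>Solutions and lifespan\<close>

definition time_ivl :: "ennreal \<Rightarrow> real set" where
  "time_ivl T = {t. 0 \<le> t \<and> ennreal t < T}"

definition continuous_in_L2 :: "ennreal \<Rightarrow> (real \<Rightarrow> real ^ 'n \<Rightarrow> complex) \<Rightarrow> bool" where
  "continuous_in_L2 T u \<longleftrightarrow>
     (\<forall>t\<in>time_ivl T. in_Lp 2 (u t)) \<and>
     (\<forall>t\<in>time_ivl T.
        ((\<lambda>s. Lp_norm 2 (\<lambda>x. u s x - u t x)) \<longlongrightarrow> 0) (at t within time_ivl T))"

text \<open>
  \<open>L\<^sup>r(0,T; L\<^sup>q)\<close> as a mixed-norm space. Joint measurability only selects a representative: every
  element of \<open>C([0,T); L\<^sup>2)\<close> has a jointly measurable one, with the prescribed class at each time.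
\<close>

definition in_LrLq ::
    "real \<Rightarrow> real \<Rightarrow> ennreal \<Rightarrow> (real \<Rightarrow> real ^ 'n \<Rightarrow> complex) \<Rightarrow> bool" where
  "in_LrLq r q T u \<longleftrightarrow>
     set_borel_measurable borel (time_ivl T \<times> UNIV) (\<lambda>(t, x). u t x) \<and>
     (AE t in lborel. t \<in> time_ivl T \<longrightarrow> in_Lp q (u t)) \<and>
     set_integrable lborel (time_ivl T) (\<lambda>t. Lp_norm q (u t) powr r)"

text \<open>The admissible exponent \<open>r\<close> given by \<open>2/r = n/2 - n/\<rho>\<close>.\<close>

definition adm_exponent :: "nat \<Rightarrow> real \<Rightarrow> real" where
  "adm_exponent n \<rho> = 2 / (real n / 2 - real n / \<rho>)"

text \<open>
  The Duhamel integral equation with initial value \<open>g\<close>, as an equation between tempered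
  distributions for every time \<open>t\<close>; the time integral is the weak integral of a
  distribution-valued function. The integrability clause says that this integral exists (which
  is automatic for \<open>u\<close> in the solution space below).
\<close>

definition duhamel_eq ::
    "real \<Rightarrow> complex \<Rightarrow> (real ^ 'n \<Rightarrow> complex) \<Rightarrow> ennreal \<Rightarrow>
       (real \<Rightarrow> real ^ 'n \<Rightarrow> complex) \<Rightarrow> bool" where
  "duhamel_eq p lam g T u \<longleftrightarrow>
     (\<forall>t\<in>time_ivl T. \<forall>\<phi>. schwartz \<phi> \<longrightarrow>
        set_integrable lborel {0..t}
          (\<lambda>s. schroedinger (t - s) (distr_of (\<lambda>x. complex_of_real (cmod (u s x) powr p))) \<phi>) \<and>
        distr_of (u t) \<phi> =
          schroedinger t (distr_of g) \<phi>
          - \<i> * lam *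
            (LBINT s:{0..t}.
               schroedinger (t - s) (distr_of (\<lambda>x. complex_of_real (cmod (u s x) powr p))) \<phi>))"

definition L2_solution ::
    "real \<Rightarrow> complex \<Rightarrow> (real ^ 'n \<Rightarrow> complex) \<Rightarrow> ennreal \<Rightarrow>
       (real \<Rightarrow> real ^ 'n \<Rightarrow> complex) \<Rightarrow> bool" where
  "L2_solution p lam g T u \<longleftrightarrow>
     continuous_in_L2 T u \<and>
     in_LrLq (adm_exponent CARD('n) (p + 1)) (p + 1) T u \<and>
     duhamel_eq p lam g T u"

definition unique_L2_solution ::
    "real \<Rightarrow> complex \<Rightarrow> (real ^ 'n \<Rightarrow> complex) \<Rightarrow> ennreal \<Rightarrow> bool" where
  "unique_L2_solution p lam g T \<longleftrightarrow>
     (\<exists>u. L2_solution p lam g T u) \<and>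
     (\<forall>u v. L2_solution p lam g T u \<longrightarrow> L2_solution p lam g T v \<longrightarrow>
        (\<forall>t\<in>time_ivl T. AE x in lborel. u t x = v t x))"

definition lifespan :: "real \<Rightarrow> complex \<Rightarrow> (real ^ 'n \<Rightarrow> complex) \<Rightarrow> ennreal" where
  "lifespan p lam g = Sup {T. 0 < T \<and> unique_L2_solution p lam g T}"

end

theory Submission
  imports Defs "HOL-Probability.Distributions"
begin

text \<open>
  The proof is a test function argument. Testing the Duhamel formula for \<open>u\<close> on \<open>[0,\<tau>]\<close> against
  \<open>\<eta>(t) \<phi>(x)\<close> with \<open>\<eta> t = (1 - t/\<tau>)\<^sup>m\<close>, taking a real or imaginary part and absorbing the error by
  Young's inequality gives \<open>\<epsilon> \<integral> \<mu> F \<phi> \<le> C \<tau> powr (1 - p/(p - 1) + n/2)\<close>, where \<open>F\<close> is the real or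
  imaginary part of \<open>f\<close> and \<open>\<mu>\<close> the corresponding part of \<open>\<lambda>\<close>. On the left, the tail of \<open>f\<close>
  contributes at least \<open>c \<tau> powr ((n - k)/2)\<close>. Since the sign of \<open>F\<close> is not controlled on
  the unit ball, \<open>\<phi>\<close> has to vanish at the origin to high order.

  The choice \<open>\<phi> = s (1 - s)\<^sup>m\<close> with \<open>s = exp(-|x|\<^sup>2/\<tau>)\<close> satisfies this, is positive elsewhere, has
  \<open>|\<Delta>\<phi>|\<close> dominated by \<open>(1 + |x|\<^sup>2/\<tau>) s (1 - s) ^ (m - 2) / \<tau>\<close> up to a constant, and is a finite linear combination of
  Gaussians. Hence the weak form is needed for Gaussians only, whose evolution under \<open>U(t)\<close> is
  computed by hand; no general theory of the Fourier transform enters.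
\<close>

subsection \<open>Gaussian integrals on the line\<close>

text \<open>Multiplying the chosen part of the weak form by \<open>\<mu>\<close>, which is
  \<open>Im lam\<close> or \<open>- Re lam\<close>, turns the nonlinear term into
  \<open>- \<mu>\<^sup>2\<close> times the integral of \<open>|u|\<^sup>p \<eta> \<phi>\<close>,
  whatever the sign of \<open>\<mu>\<close>. Young's inequality is weighted so that the error costs
  exactly this amount; no norm of \<open>u\<close> survives. The widths \<open>\<tau>\<close> in
  time and \<open>sqrt \<tau>\<close> in space make \<open>\<eta>'\<close> and the Laplacian of
  \<open>\<phi>\<close> both of size \<open>1 / \<tau>\<close>. Comparing the two powers of
  \<open>\<tau>\<close> leaves \<open>\<epsilon> \<le> C \<tau> powr \<kappa>\<close>, and
  \<open>k < 2 / (p - 1)\<close> says that \<open>\<kappa> < 0\<close>, so \<open>\<tau>\<close> is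
  bounded. The exponent \<open>m\<close> serves two ends. Two derivatives cost two factors of each
  cutoff, and Young's inequality can afford this once \<open>m\<close> is at least
  \<open>2 p / (p - 1)\<close>. On the unit ball \<open>\<phi>\<close> is at most
  \<open>(1 / \<tau>) ^ m\<close>, so with \<open>m \<ge> k\<close> the uncontrolled mass of
  \<open>f\<close> there is beaten by the tail for large \<open>\<tau>\<close>. How large depends on
  the \<open>L\<^sup>1\<close> norm of the part of \<open>f\<close>; this dependence goes into
  \<open>\<epsilon>0\<close>, never into \<open>C\<close>.\<close>

lemma has_vector_derivative_lebesgue_integral:
  fixes f f' :: "real \<Rightarrow> 'a \<Rightarrow> 'b::{banach, second_countable_topology}"
  assumes int: "\<And>y. integrable M (f y)"
    and deriv: "\<And>y \<xi>. ((\<lambda>y. f y \<xi>) has_vector_derivative f' y \<xi>) (at y)"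
    and w: "integrable M w"
    and bound: "\<And>y \<xi>. norm (f' y \<xi>) \<le> w \<xi>"
    and meas: "f' x \<in> borel_measurable M"
  shows "((\<lambda>y. \<integral>\<xi>. f y \<xi> \<partial>M) has_vector_derivative (\<integral>\<xi>. f' x \<xi> \<partial>M)) (at x)"
proof -
  define Q where "Q y \<xi> = (f y \<xi> - f x \<xi>) /\<^sub>R (y - x)" for y \<xi>
  have Q_lim: "((\<lambda>y. Q y \<xi>) \<longlongrightarrow> f' x \<xi>) (at x)" for \<xi>
  proof -
    have "((\<lambda>y. norm (f y \<xi> - f x \<xi> - (y - x) *\<^sub>R f' x \<xi>) / norm (y - x)) \<longlongrightarrow> 0) (at x)"
      using deriv[of \<xi> x] unfolding has_vector_derivative_def has_derivative_iff_norm by blast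
    then have "((\<lambda>y. norm (Q y \<xi> - f' x \<xi>)) \<longlongrightarrow> 0) (at x)"
    proof (rule Lim_transform_eventually)
      show "\<forall>\<^sub>F y in at x. norm (f y \<xi> - f x \<xi> - (y - x) *\<^sub>R f' x \<xi>) / norm (y - x) = norm (Q y \<xi> - f' x \<xi>)"
        unfolding eventually_at_filter
      proof (intro always_eventually allI impI)
        fix y assume "y \<noteq> x" "y \<in> UNIV"
        then have "Q y \<xi> - f' x \<xi> = (f y \<xi> - f x \<xi> - (y - x) *\<^sub>R f' x \<xi>) /\<^sub>R (y - x)"
          by (simp add: Q_def scaleR_diff_right)
        then show "norm (f y \<xi> - f x \<xi> - (y - x) *\<^sub>R f' x \<xi>) / norm (y - x) = norm (Q y \<xi> - f' x \<xi>)"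
          by (simp add: divide_inverse mult.commute)
      qed
    qed
    then show ?thesis
      by (simp add: LIM_zero_iff tendsto_norm_zero_iff)
  qed
  \<comment> \<open>The mean value inequality carries the bound on the derivative over to the
    difference quotients, so \<open>w\<close> dominates them for every increment at once.\<close>
  have Q_bound: "norm (Q y \<xi>) \<le> w \<xi>" if "y \<noteq> x" for y \<xi>
  proof -
    have "norm (f y \<xi> - f x \<xi>) \<le> w \<xi> * norm (y - x)"
    proof (rule differentiable_bound[where f = "\<lambda>y. f y \<xi>" and f' = "\<lambda>y h. h *\<^sub>R f' y \<xi>" and S = UNIV])
      show "((\<lambda>y. f y \<xi>) has_derivative (\<lambda>h. h *\<^sub>R f' y \<xi>)) (at y within UNIV)" for y
        using deriv by (simp add: has_vector_derivative_def)
      show "onorm (\<lambda>h. h *\<^sub>R f' y \<xi>) \<le> w \<xi>" for y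
        by (rule onorm_le) (use bound[of y \<xi>] in \<open>simp add: mult.commute[of _ "\<bar>_\<bar>"] mult_left_mono\<close>)
    qed auto
    then show ?thesis
      using that by (simp add: Q_def divide_simps)
  qed
  \<comment> \<open>Dominated convergence speaks of sequences; the limit at \<open>x\<close> is
    therefore tested along sequences that avoid \<open>x\<close>.\<close>
  have "((\<lambda>y. \<integral>\<xi>. Q y \<xi> \<partial>M) \<longlongrightarrow> (\<integral>\<xi>. f' x \<xi> \<partial>M)) (at x)"
    unfolding tendsto_at_iff_sequentially comp_def
  proof (intro allI impI)
    fix X assume X: "\<forall>i. X i \<in> UNIV - {x}" "X \<longlonglongrightarrow> x"
    show "(\<lambda>n. \<integral>\<xi>. Q (X n) \<xi> \<partial>M) \<longlonglongrightarrow> (\<integral>\<xi>. f' x \<xi> \<partial>M)"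
    proof (rule integral_dominated_convergence[OF meas _ w])
      show "Q (X n) \<in> borel_measurable M" for n
        using borel_measurable_integrable[OF int] unfolding Q_def by simp
      show "AE \<xi> in M. (\<lambda>n. Q (X n) \<xi>) \<longlonglongrightarrow> f' x \<xi>"
        using Q_lim[unfolded tendsto_at_iff_sequentially comp_def] X by blast
      show "AE \<xi> in M. norm (Q (X n) \<xi>) \<le> w \<xi>" for n
        using Q_bound X by auto
    qed
  qed
  moreover have "(\<integral>\<xi>. Q y \<xi> \<partial>M) = ((\<integral>\<xi>. f y \<xi> \<partial>M) - (\<integral>\<xi>. f x \<xi> \<partial>M)) /\<^sub>R (y - x)" for y
    unfolding Q_def using int by simp
  ultimately have lim: "((\<lambda>y. ((\<integral>\<xi>. f y \<xi> \<partial>M) - (\<integral>\<xi>. f x \<xi> \<partial>M)) /\<^sub>R (y - x)) \<longlongrightarrow> (\<integral>\<xi>. f' x \<xi> \<partial>M)) (at x)"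
    by simp
  show ?thesis
    unfolding has_vector_derivative_def has_derivative_iff_norm
  proof (intro conjI bounded_linear_scaleR_left)
    have "((\<lambda>y. norm (((\<integral>\<xi>. f y \<xi> \<partial>M) - (\<integral>\<xi>. f x \<xi> \<partial>M)) /\<^sub>R (y - x) - (\<integral>\<xi>. f' x \<xi> \<partial>M))) \<longlongrightarrow> 0) (at x)"
      using lim by (simp add: LIM_zero_iff tendsto_norm_zero_iff)
    then show "((\<lambda>y. norm ((\<integral>\<xi>. f y \<xi> \<partial>M) - (\<integral>\<xi>. f x \<xi> \<partial>M) - (y - x) *\<^sub>R (\<integral>\<xi>. f' x \<xi> \<partial>M)) / norm (y - x)) \<longlongrightarrow> 0) (at x)"
    proof (rule Lim_transform_eventually)
      show "\<forall>\<^sub>F y in at x. norm (((\<integral>\<xi>. f y \<xi> \<partial>M) - (\<integral>\<xi>. f x \<xi> \<partial>M)) /\<^sub>R (y - x) - (\<integral>\<xi>. f' x \<xi> \<partial>M)) =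
         norm ((\<integral>\<xi>. f y \<xi> \<partial>M) - (\<integral>\<xi>. f x \<xi> \<partial>M) - (y - x) *\<^sub>R (\<integral>\<xi>. f' x \<xi> \<partial>M)) / norm (y - x)"
        unfolding eventually_at_filter
      proof (intro always_eventually allI impI)
        fix y assume "y \<noteq> x" "y \<in> UNIV"
        then have "((\<integral>\<xi>. f y \<xi> \<partial>M) - (\<integral>\<xi>. f x \<xi> \<partial>M)) /\<^sub>R (y - x) - (\<integral>\<xi>. f' x \<xi> \<partial>M) =
           ((\<integral>\<xi>. f y \<xi> \<partial>M) - (\<integral>\<xi>. f x \<xi> \<partial>M) - (y - x) *\<^sub>R (\<integral>\<xi>. f' x \<xi> \<partial>M)) /\<^sub>R (y - x)"
          by (simp add: scaleR_diff_right)
        then show "norm (((\<integral>\<xi>. f y \<xi> \<partial>M) - (\<integral>\<xi>. f x \<xi> \<partial>M)) /\<^sub>R (y - x) - (\<integral>\<xi>. f' x \<xi> \<partial>M)) =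
         norm ((\<integral>\<xi>. f y \<xi> \<partial>M) - (\<integral>\<xi>. f x \<xi> \<partial>M) - (y - x) *\<^sub>R (\<integral>\<xi>. f' x \<xi> \<partial>M)) / norm (y - x)"
          by (simp add: divide_inverse mult.commute)
      qed
    qed
  qed
qed

text \<open>Both facts are read off the normal distribution with mean 0 and variance
  \<open>1 / (2 * a)\<close>: its moments are integrable and its total mass is 1.\<close>

lemma
  fixes a :: real
  assumes "a > 0"
  shows integrable_power_gaussian: "integrable lborel (\<lambda>\<xi>::real. \<xi> ^ k * exp (- (a * \<xi>\<^sup>2)))"
    and integral_gaussian: "(\<integral>\<xi>. exp (- (a * \<xi>\<^sup>2)) \<partial>lborel) = sqrt (pi / a)"
proof -
  define \<sigma> where "\<sigma> = 1 / sqrt (2 * a)"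
  have \<sigma>: "\<sigma> > 0" "\<sigma>\<^sup>2 = 1 / (2 * a)"
    using assms by (auto simp: \<sigma>_def power_divide)
  have eq: "normal_density 0 \<sigma> \<xi> = sqrt (a / pi) * exp (- (a * \<xi>\<^sup>2))" for \<xi>
    using assms by (simp add: normal_density_def \<sigma>(2) real_sqrt_divide)
  have "integrable lborel (\<lambda>\<xi>. normal_density 0 \<sigma> \<xi> * (\<xi> - 0) ^ k)"
    by (rule integrable_normal_moment[OF \<sigma>(1)])
  then have "integrable lborel (\<lambda>\<xi>. sqrt (a / pi) * (\<xi> ^ k * exp (- (a * \<xi>\<^sup>2))))"
    by (simp add: eq mult_ac)
  then show "integrable lborel (\<lambda>\<xi>::real. \<xi> ^ k * exp (- (a * \<xi>\<^sup>2)))"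
    using assms by simp
  have "(\<integral>\<xi>. normal_density 0 \<sigma> \<xi> \<partial>lborel) = 1"
    using \<sigma>(1) by (rule integral_normal_density)
  then have "sqrt (a / pi) * (\<integral>\<xi>. exp (- (a * \<xi>\<^sup>2)) \<partial>lborel) = 1"
    by (simp add: eq)
  then show "(\<integral>\<xi>. exp (- (a * \<xi>\<^sup>2)) \<partial>lborel) = sqrt (pi / a)"
    using assms by (simp add: real_sqrt_divide field_simps)
qed

text \<open>A complex \<open>z\<close> lets one computation serve twice: real \<open>z\<close> gives
  the Fourier transform of a Gaussian, and an imaginary part equal to the time gives its evolution
  under \<open>U(t)\<close>.\<close>

definition osc_gauss :: "complex \<Rightarrow> real \<Rightarrow> real \<Rightarrow> complex" where
  "osc_gauss z x \<xi> = exp (\<i> * x * \<xi> - z * \<xi>\<^sup>2)"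

lemma norm_osc_gauss: "cmod (osc_gauss z x \<xi>) = exp (- (Re z * \<xi>\<^sup>2))"
  by (simp add: osc_gauss_def power2_eq_square)

lemma continuous_osc_gauss: "continuous_on UNIV (osc_gauss z x)"
  unfolding osc_gauss_def by (intro continuous_intros)

lemma measurable_osc_gauss [measurable]: "osc_gauss z x \<in> borel_measurable borel"
  by (rule borel_measurable_continuous_onI[OF continuous_osc_gauss])

lemma integrable_osc_gauss:
  assumes "Re z > 0"
  shows "integrable lborel (\<lambda>\<xi>. \<xi> ^ k * osc_gauss z x \<xi>)"
  using integrable_power_gaussian[OF assms, of k]
  by (rule Bochner_Integration.integrable_bound) (auto simp: norm_mult norm_osc_gauss norm_power abs_mult power_abs)

lemma vector_derivative_osc_gauss:
  "(osc_gauss z x has_vector_derivative (\<i> * x - 2 * z * \<xi>) * osc_gauss z x \<xi>) (at \<xi>)"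
proof -
  \<comment> \<open>The function is entire in a complex variable \<open>w\<close>; its complex
    derivative at a real point is the derivative along the real line. The same device recurs for
    derivatives in the parameters.\<close>
  have "((\<lambda>w. exp (\<i> * x * w - z * w\<^sup>2)) has_field_derivative (\<i> * x - 2 * z * \<xi>) * osc_gauss z x \<xi>) (at (of_real \<xi>))"
    unfolding osc_gauss_def by (auto intro!: derivative_eq_intros)
  from has_vector_derivative_real_field[OF this] show ?thesis
    by (simp add: osc_gauss_def[abs_def] of_real_power)
qed

lemma gaussian_at_top: "a > 0 \<Longrightarrow> ((\<lambda>\<xi>::real. \<xi> ^ k * exp (- (a * \<xi>\<^sup>2))) \<longlongrightarrow> 0) at_top"
proof -
  assume a: "a > 0"
  have "((\<lambda>y::real. y ^ k / exp y) \<longlongrightarrow> 0) at_top"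
    by (rule tendsto_power_div_exp_0)
  moreover have "filterlim (\<lambda>\<xi>::real. a * \<xi>\<^sup>2) at_top at_top"
    using a by (intro filterlim_tendsto_pos_mult_at_top[OF tendsto_const] filterlim_pow_at_top filterlim_ident) auto
  ultimately have "((\<lambda>\<xi>::real. (a * \<xi>\<^sup>2) ^ k / exp (a * \<xi>\<^sup>2)) \<longlongrightarrow> 0) at_top"
    by (rule filterlim_compose)
  then have lim: "((\<lambda>\<xi>::real. inverse (a ^ k) * ((a * \<xi>\<^sup>2) ^ k / exp (a * \<xi>\<^sup>2))) \<longlongrightarrow> 0) at_top"
    by (rule tendsto_mult_right_zero)
  show ?thesis
  proof (rule tendsto_sandwich[OF _ _ tendsto_const lim])
    show "\<forall>\<^sub>F \<xi>::real in at_top. 0 \<le> \<xi> ^ k * exp (- (a * \<xi>\<^sup>2))"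
      using eventually_ge_at_top[of 0] by eventually_elim simp
    show "\<forall>\<^sub>F \<xi>::real in at_top. \<xi> ^ k * exp (- (a * \<xi>\<^sup>2)) \<le> inverse (a ^ k) * ((a * \<xi>\<^sup>2) ^ k / exp (a * \<xi>\<^sup>2))"
      using eventually_ge_at_top[of 1]
    proof eventually_elim
      case (elim \<xi>)
      have "\<xi> ^ k \<le> (\<xi>\<^sup>2) ^ k"
        using elim by (intro power_mono) (auto simp: power2_eq_square)
      then show ?case
        using a by (simp add: exp_minus power_mult_distrib field_simps)
    qed
  qed
qed

lemma gaussian_at_bot: "a > 0 \<Longrightarrow> ((\<lambda>\<xi>::real. \<xi> ^ k * exp (- (a * \<xi>\<^sup>2))) \<longlongrightarrow> 0) at_bot"
proof -
  assume "a > 0"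
  from tendsto_mult_left[OF gaussian_at_top[OF this, of k], of "(-1)^k"]
  have "((\<lambda>\<xi>::real. (- \<xi>) ^ k * exp (- (a * (- \<xi>)\<^sup>2))) \<longlongrightarrow> 0) at_top"
    by (simp add: power_minus[of "_::real" k, symmetric] mult.assoc[symmetric] flip: power_mult_distrib)
  then show ?thesis
    by (simp only: filterlim_at_bot_mirror)
qed

lemma integral_derivative_eq_0:
  fixes F f :: "real \<Rightarrow> complex"
  assumes "\<And>x. (F has_vector_derivative f x) (at x)" "continuous_on UNIV f" "integrable lborel f"
    and "(F \<longlongrightarrow> 0) at_top" "(F \<longlongrightarrow> 0) at_bot"
  shows "(\<integral>x. f x \<partial>lborel) = 0"
proof -
  have "(LBINT x=-\<infinity>..\<infinity>. f x) = 0 - 0"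
  proof (rule interval_integral_FTC_integrable)
    show "isCont f x" for x
      using assms(2) by (simp add: continuous_on_eq_continuous_at)
    show "set_integrable lborel (einterval (- \<infinity>) \<infinity>) f"
      using assms(3) by (simp add: set_integrable_def)
    show "((F \<circ> real_of_ereal) \<longlongrightarrow> 0) (at_right (- \<infinity>))"
      using assms(5) by (simp add: ereal_tendsto_simps)
    show "((F \<circ> real_of_ereal) \<longlongrightarrow> 0) (at_left \<infinity>)"
      using assms(4) by (simp add: ereal_tendsto_simps)
  qed (use assms in auto)
  then show ?thesis
    by (simp add: interval_lebesgue_integral_def set_lebesgue_integral_def)
qed

text \<open>The derivatives of \<open>osc_gauss z x\<close> and of
  \<open>\<xi> * osc_gauss z x \<xi>\<close> integrate to zero over the line. These are two linear
  relations between the moments of order 0, 1 and 2, solved for the last two.\<close>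

lemma
  fixes x :: real and z :: complex
  assumes "Re z > 0"
  shows osc_gauss_moment_1: "(\<integral>\<xi>. \<xi> * osc_gauss z x \<xi> \<partial>lborel) = \<i> * x / (2 * z) * (\<integral>\<xi>. osc_gauss z x \<xi> \<partial>lborel)"
    and osc_gauss_moment_2: "(\<integral>\<xi>. \<xi>\<^sup>2 * osc_gauss z x \<xi> \<partial>lborel) =
      (1 / (2 * z) - x\<^sup>2 / (4 * z\<^sup>2)) * (\<integral>\<xi>. osc_gauss z x \<xi> \<partial>lborel)"
proof -
  let ?E = "osc_gauss z x"
  have z: "z \<noteq> 0" using assms by auto
  have int: "integrable lborel ?E" "integrable lborel (\<lambda>\<xi>. \<xi> * ?E \<xi>)" "integrable lborel (\<lambda>\<xi>. \<xi>\<^sup>2 * ?E \<xi>)"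
    using integrable_osc_gauss[OF assms, of 0 x] integrable_osc_gauss[OF assms, of 1 x]
      integrable_osc_gauss[OF assms, of 2 x] by simp_all
  have lim: "((\<lambda>\<xi>. \<xi> ^ k * ?E \<xi>) \<longlongrightarrow> 0) at_top" "((\<lambda>\<xi>. \<xi> ^ k * ?E \<xi>) \<longlongrightarrow> 0) at_bot" for k
  proof -
    have "\<bar>\<xi> ^ k * exp (- (Re z * \<xi>\<^sup>2))\<bar> = norm (\<xi> ^ k * ?E \<xi>)" for \<xi>
      by (simp add: norm_mult norm_power norm_osc_gauss abs_mult power_abs)
    then show "((\<lambda>\<xi>. \<xi> ^ k * ?E \<xi>) \<longlongrightarrow> 0) at_top" "((\<lambda>\<xi>. \<xi> ^ k * ?E \<xi>) \<longlongrightarrow> 0) at_bot"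
      using gaussian_at_top[OF assms, of k, THEN tendsto_rabs_zero] gaussian_at_bot[OF assms, of k, THEN tendsto_rabs_zero]
      by (simp_all add: tendsto_norm_zero_iff)
  qed
  have "(\<integral>\<xi>. (\<i> * x - 2 * z * \<xi>) * ?E \<xi> \<partial>lborel) = 0"
  proof (rule integral_derivative_eq_0[of ?E])
    show "continuous_on UNIV (\<lambda>\<xi>. (\<i> * complex_of_real x - 2 * z * complex_of_real \<xi>) * ?E \<xi>)"
      by (intro continuous_intros continuous_osc_gauss)
    show "integrable lborel (\<lambda>\<xi>. (\<i> * complex_of_real x - 2 * z * complex_of_real \<xi>) * ?E \<xi>)"
      using int by (simp add: left_diff_distrib mult.assoc)
    show "(?E \<longlongrightarrow> 0) at_top" "(?E \<longlongrightarrow> 0) at_bot"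
      using lim[of 0] by simp_all
  qed (rule vector_derivative_osc_gauss)
  then have "\<i> * x * (\<integral>\<xi>. ?E \<xi> \<partial>lborel) - 2 * z * (\<integral>\<xi>. \<xi> * ?E \<xi> \<partial>lborel) = 0"
    using int by (simp add: left_diff_distrib mult.assoc)
  then show 1: "(\<integral>\<xi>. \<xi> * ?E \<xi> \<partial>lborel) = \<i> * x / (2 * z) * (\<integral>\<xi>. ?E \<xi> \<partial>lborel)"
    using z by (simp add: field_simps)
  have expand: "(\<lambda>\<xi>. ?E \<xi> + \<xi> * ((\<i> * x - 2 * z * \<xi>) * ?E \<xi>)) = (\<lambda>\<xi>. ?E \<xi> + \<i> * x * (\<xi> * ?E \<xi>) - 2 * z * (\<xi>\<^sup>2 * ?E \<xi>))"
    by (auto simp: algebra_simps power2_eq_square)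
  have "(\<integral>\<xi>. ?E \<xi> + \<xi> * ((\<i> * x - 2 * z * \<xi>) * ?E \<xi>) \<partial>lborel) = 0"
  proof (rule integral_derivative_eq_0[of "\<lambda>\<xi>. \<xi> * ?E \<xi>"])
    show "continuous_on UNIV (\<lambda>\<xi>. ?E \<xi> + \<xi> * ((\<i> * complex_of_real x - 2 * z * complex_of_real \<xi>) * ?E \<xi>))"
      by (intro continuous_intros continuous_osc_gauss)
    show "integrable lborel (\<lambda>\<xi>. ?E \<xi> + \<xi> * ((\<i> * complex_of_real x - 2 * z * complex_of_real \<xi>) * ?E \<xi>))"
      using int unfolding expand by (intro Bochner_Integration.integrable_add Bochner_Integration.integrable_diff integrable_mult_right)
    show "((\<lambda>\<xi>. \<xi> * ?E \<xi>) has_vector_derivative ?E \<xi> + \<xi> * ((\<i> * complex_of_real x - 2 * z * complex_of_real \<xi>) * ?E \<xi>)) (at \<xi>)" for \<xi>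
      using has_vector_derivative_mult[OF has_vector_derivative_of_real[OF DERIV_ident] vector_derivative_osc_gauss[of z x \<xi>]]
      by (simp add: add.commute)
    show "((\<lambda>\<xi>. \<xi> * ?E \<xi>) \<longlongrightarrow> 0) at_top" "((\<lambda>\<xi>. \<xi> * ?E \<xi>) \<longlongrightarrow> 0) at_bot"
      using lim[of 1] by simp_all
  qed
  then have "(\<integral>\<xi>. ?E \<xi> \<partial>lborel) + \<i> * x * (\<integral>\<xi>. \<xi> * ?E \<xi> \<partial>lborel) - 2 * z * (\<integral>\<xi>. \<xi>\<^sup>2 * ?E \<xi> \<partial>lborel) = 0"
    using int unfolding expand by simp
  then have "2 * z * (\<integral>\<xi>. \<xi>\<^sup>2 * ?E \<xi> \<partial>lborel) = (1 - x\<^sup>2 / (2 * z)) * (\<integral>\<xi>. ?E \<xi> \<partial>lborel)"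
    unfolding 1 using z by (simp add: field_simps power2_eq_square)
  then show "(\<integral>\<xi>. \<xi>\<^sup>2 * ?E \<xi> \<partial>lborel) = (1 / (2 * z) - x\<^sup>2 / (4 * z\<^sup>2)) * (\<integral>\<xi>. ?E \<xi> \<partial>lborel)"
    using z by (simp add: field_simps power2_eq_square)
qed

text \<open>
  The ODE \<open>J' = - x / (2 z) J\<close> in the real variable \<open>x\<close> avoids any choice of a complex square root: the
  value \<open>J 0\<close> stays unevaluated and is only ever needed for real \<open>z\<close> or up to a bound.
\<close>

lemma osc_gauss_integral:
  fixes x :: real and z :: complex
  assumes "Re z > 0"
  shows "(\<integral>\<xi>. osc_gauss z x \<xi> \<partial>lborel) = exp (- (x\<^sup>2 / (4 * z))) * (\<integral>\<xi>. osc_gauss z 0 \<xi> \<partial>lborel)"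
proof -
  define J where "J x = (\<integral>\<xi>. osc_gauss z x \<xi> \<partial>lborel)" for x
  have z: "z \<noteq> 0" using assms by auto
  have "(J has_vector_derivative (\<integral>\<xi>. \<i> * \<xi> * osc_gauss z x \<xi> \<partial>lborel)) (at x)" for x
    unfolding J_def
  proof (rule has_vector_derivative_lebesgue_integral)
    show "integrable lborel (osc_gauss z y)" for y
      using integrable_osc_gauss[OF assms, of 0 y] by simp
    show "((\<lambda>y. osc_gauss z y \<xi>) has_vector_derivative \<i> * \<xi> * osc_gauss z y \<xi>) (at y)" for y \<xi>
    proof -
      have "((\<lambda>w. exp (\<i> * w * \<xi> - z * \<xi>\<^sup>2)) has_field_derivative \<i> * \<xi> * osc_gauss z y \<xi>) (at (of_real y))"
        unfolding osc_gauss_def by (auto intro!: derivative_eq_intros)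
      from has_vector_derivative_real_field[OF this] show ?thesis
        by (simp add: osc_gauss_def[abs_def] of_real_power)
    qed
    show "integrable lborel (\<lambda>\<xi>. \<bar>\<xi> ^ 1 * exp (- (Re z * \<xi>\<^sup>2))\<bar>)"
      by (intro integrable_abs integrable_power_gaussian assms)
    show "norm (\<i> * \<xi> * osc_gauss z y \<xi>) \<le> \<bar>\<xi> ^ 1 * exp (- (Re z * \<xi>\<^sup>2))\<bar>" for y \<xi>
      by (simp add: norm_mult norm_osc_gauss abs_mult)
  qed auto
  moreover have "(\<integral>\<xi>. \<i> * \<xi> * osc_gauss z x \<xi> \<partial>lborel) = - (x / (2 * z)) * J x" for x
    using osc_gauss_moment_1[OF assms, of x] by (simp add: mult.assoc J_def)
  ultimately have J: "(J has_vector_derivative - (x / (2 * z)) * J x) (at x)" for x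
    by simp
  have e: "((\<lambda>x::real. exp (x\<^sup>2 / (4 * z))) has_vector_derivative (x / (2 * z)) * exp (x\<^sup>2 / (4 * z))) (at x)" for x
  proof -
    have "((\<lambda>w. exp (w\<^sup>2 / (4 * z))) has_field_derivative (x / (2 * z)) * exp (x\<^sup>2 / (4 * z))) (at (of_real x))"
      using z by (auto intro!: derivative_eq_intros)
    from has_vector_derivative_real_field[OF this] show ?thesis
      by (simp add: of_real_power)
  qed
  \<comment> \<open>The exponential is the integrating factor of the equation for \<open>J\<close>,
    so the product is constant and can be evaluated at 0.\<close>
  have "((\<lambda>x. exp (x\<^sup>2 / (4 * z)) * J x) has_vector_derivative 0) (at x within UNIV)" for x
    using has_vector_derivative_mult[OF e[of x] J[of x]] by (simp add: algebra_simps)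
  then obtain c where "\<And>x. exp (x\<^sup>2 / (4 * z)) * J x = c"
    using has_vector_derivative_zero_constant[of UNIV "\<lambda>x. exp (x\<^sup>2 / (4 * z)) * J x"] by auto
  from this[of x] this[of 0] have "exp (x\<^sup>2 / (4 * z)) * J x = J 0"
    by simp
  then have "J x = exp (- (x\<^sup>2 / (4 * z))) * J 0"
    by (simp add: exp_minus field_simps)
  then show ?thesis
    by (simp add: J_def)
qed

subsection \<open>Gaussian integrals in several variables\<close>

text \<open>Lebesgue measure on a Euclidean space is the image of a finite product of copies of the
  line under the coordinate map, so products of one-variable functions factor.\<close>

lemma
  fixes f :: "'a::euclidean_space \<Rightarrow> real \<Rightarrow> complex"
  assumes f: "\<And>b. b \<in> Basis \<Longrightarrow> integrable lborel (f b)"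
  shows integrable_prod_Basis: "integrable lborel (\<lambda>x::'a. \<Prod>b\<in>Basis. f b (x \<bullet> b))"
    and integral_prod_Basis: "(\<integral>x. (\<Prod>b\<in>Basis. f b (x \<bullet> b)) \<partial>(lborel :: 'a measure)) = (\<Prod>b\<in>Basis. \<integral>t. f b t \<partial>lborel)"
proof -
  interpret product_sigma_finite "\<lambda>_::'a. lborel :: real measure" ..
  have [measurable]: "f b \<in> borel_measurable borel" if "b \<in> Basis" for b
    using borel_measurable_integrable[OF f[OF that]] by simp
  let ?P = "\<lambda>x::'a. \<Prod>b\<in>Basis. f b (x \<bullet> b)" and ?s = "\<lambda>g. (\<Sum>b\<in>Basis. g b *\<^sub>R b) :: 'a"
  have [measurable]: "?P \<in> borel_measurable borel"
    by measurable
  have [measurable]: "?s \<in> borel_measurable (Pi\<^sub>M Basis (\<lambda>_. lborel))"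
    by measurable
  have eq: "?P (?s g) = (\<Prod>b\<in>Basis. f b (g b))" for g
    by (intro prod.cong) auto
  show "integrable lborel ?P"
    unfolding lborel_eq[where 'a='a]
    by (subst integrable_distr_eq) (auto simp: eq intro!: product_integrable_prod f)
  show "(\<integral>x. ?P x \<partial>(lborel :: 'a measure)) = (\<Prod>b\<in>Basis. \<integral>t. f b t \<partial>lborel)"
    unfolding lborel_eq[where 'a='a]
    by (subst integral_distr) (auto simp: eq intro!: product_integral_prod f)
qed

definition osc_gauss_n :: "complex \<Rightarrow> 'a::euclidean_space \<Rightarrow> 'a \<Rightarrow> complex" where
  "osc_gauss_n z x \<xi> = exp (\<i> * (x \<bullet> \<xi>) - z * (\<xi> \<bullet> \<xi>))"

lemma osc_gauss_n_prod: "osc_gauss_n z x \<xi> = (\<Prod>b\<in>Basis. osc_gauss z (x \<bullet> b) (\<xi> \<bullet> b))"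
proof -
  have "\<i> * (x \<bullet> \<xi>) - z * (\<xi> \<bullet> \<xi>) = (\<Sum>b\<in>Basis. \<i> * (x \<bullet> b) * (\<xi> \<bullet> b) - z * (\<xi> \<bullet> b)\<^sup>2)"
    by (simp add: euclidean_inner[of x \<xi>] euclidean_inner[of \<xi> \<xi>] sum_subtractf sum_distrib_left power2_eq_square mult.assoc)
  then show ?thesis
    by (simp add: osc_gauss_n_def osc_gauss_def exp_sum)
qed

lemma measurable_osc_gauss_n [measurable]: "osc_gauss_n z x \<in> borel_measurable borel"
  unfolding osc_gauss_n_def by (intro borel_measurable_continuous_onI continuous_intros)

lemma norm_osc_gauss_n: "cmod (osc_gauss_n z x \<xi>) = exp (- (Re z * (\<xi> \<bullet> \<xi>)))"
  by (simp add: osc_gauss_n_def)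

lemma
  fixes x :: "'a::euclidean_space" and z :: complex
  assumes z: "Re z > 0"
  shows integrable_osc_gauss_n: "integrable lborel (osc_gauss_n z x)"
    and osc_gauss_n_integral: "(\<integral>\<xi>. osc_gauss_n z x \<xi> \<partial>lborel) =
      exp (- ((x \<bullet> x) / (4 * z))) * (\<integral>\<xi>. osc_gauss_n z (0::'a) \<xi> \<partial>lborel)"
    and integrable_inner_osc_gauss_n: "integrable lborel (\<lambda>\<xi>. (\<xi> \<bullet> \<xi>) * osc_gauss_n z x \<xi>)"
    and osc_gauss_n_moment: "(\<integral>\<xi>. (\<xi> \<bullet> \<xi>) * osc_gauss_n z x \<xi> \<partial>lborel) =
      (DIM('a) / (2 * z) - (x \<bullet> x) / (4 * z\<^sup>2)) * (\<integral>\<xi>. osc_gauss_n z x \<xi> \<partial>lborel)"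
proof -
  have int1: "integrable lborel (osc_gauss z y)" for y
    using integrable_osc_gauss[OF z, of 0 y] by simp
  have int2: "integrable lborel (\<lambda>\<xi>. \<xi>\<^sup>2 * osc_gauss z y \<xi>)" for y
    using integrable_osc_gauss[OF z, of 2 y] by simp
  have J: "(\<integral>\<xi>. osc_gauss_n z y \<xi> \<partial>lborel) = (\<Prod>b\<in>Basis. \<integral>t. osc_gauss z (y \<bullet> b) t \<partial>lborel)" for y :: 'a
    unfolding osc_gauss_n_prod by (rule integral_prod_Basis[OF int1])
  show "integrable lborel (osc_gauss_n z x)"
    unfolding osc_gauss_n_prod by (rule integrable_prod_Basis[OF int1])
  have "(\<integral>\<xi>. osc_gauss_n z x \<xi> \<partial>lborel) =
    (\<Prod>b\<in>Basis. exp (- ((x \<bullet> b)\<^sup>2 / (4 * z))) * (\<integral>t. osc_gauss z 0 t \<partial>lborel))"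
    unfolding J by (intro prod.cong refl osc_gauss_integral[OF z])
  also have "\<dots> = exp (\<Sum>b\<in>Basis. - ((x \<bullet> b)\<^sup>2 / (4 * z))) * (\<integral>\<xi>. osc_gauss_n z (0::'a) \<xi> \<partial>lborel)"
    unfolding J by (simp add: prod.distrib exp_sum)
  also have "(\<Sum>b\<in>Basis. - (complex_of_real ((x \<bullet> b)\<^sup>2) / (4 * z))) = - ((x \<bullet> x) / (4 * z))"
    by (simp add: euclidean_inner[of x x] sum_negf sum_divide_distrib power2_eq_square)
  finally show "(\<integral>\<xi>. osc_gauss_n z x \<xi> \<partial>lborel) =
      exp (- ((x \<bullet> x) / (4 * z))) * (\<integral>\<xi>. osc_gauss_n z (0::'a) \<xi> \<partial>lborel)" .
  \<comment> \<open>\<open>\<xi> \<bullet> \<xi>\<close> is the sum over \<open>c\<close> of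
    \<open>(\<xi> \<bullet> c)\<^sup>2\<close>. In the summand for \<open>c\<close>, only the factor
    of coordinate \<open>c\<close> carries the square, so each summand is again a product over the
    coordinates.\<close>
  define f where "f c b t = (if b = c then t\<^sup>2 * osc_gauss z (x \<bullet> b) t else osc_gauss z (x \<bullet> b) t)" for c b :: 'a and t :: real
  have f: "integrable lborel (f c b)" for c b
    unfolding f_def using int1 int2 by (cases "b = c") auto
  have split: "(\<Prod>b\<in>Basis. h (b = c) b) = h True c * (\<Prod>b\<in>Basis - {c}. h False b)"
    if "c \<in> Basis" for c :: 'a and h :: "bool \<Rightarrow> 'a \<Rightarrow> complex"
  proof -
    have "(\<Prod>b\<in>Basis. h (b = c) b) = h True c * (\<Prod>b\<in>Basis - {c}. h (b = c) b)"
      using that by (subst prod.remove[of _ c]) auto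
    also have "(\<Prod>b\<in>Basis - {c}. h (b = c) b) = (\<Prod>b\<in>Basis - {c}. h False b)"
      by (intro prod.cong) auto
    finally show ?thesis .
  qed
  have eq: "(\<xi> \<bullet> \<xi>) * osc_gauss_n z x \<xi> = (\<Sum>c\<in>Basis. \<Prod>b\<in>Basis. f c b (\<xi> \<bullet> b))" for \<xi>
  proof -
    have "(\<Prod>b\<in>Basis. f c b (\<xi> \<bullet> b)) = (\<xi> \<bullet> c)\<^sup>2 * osc_gauss_n z x \<xi>" if "c \<in> Basis" for c
      using split[OF that, of "\<lambda>e b. if e then (\<xi> \<bullet> b)\<^sup>2 * osc_gauss z (x \<bullet> b) (\<xi> \<bullet> b) else osc_gauss z (x \<bullet> b) (\<xi> \<bullet> b)"]
        split[OF that, of "\<lambda>e b. osc_gauss z (x \<bullet> b) (\<xi> \<bullet> b)"]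
      unfolding osc_gauss_n_prod f_def by (simp add: mult.assoc)
    then show ?thesis
      by (simp add: euclidean_inner[of \<xi> \<xi>] sum_distrib_right power2_eq_square)
  qed
  show "integrable lborel (\<lambda>\<xi>. (\<xi> \<bullet> \<xi>) * osc_gauss_n z x \<xi>)"
    unfolding eq by (intro Bochner_Integration.integrable_sum integrable_prod_Basis f)
  have "(\<integral>\<xi>. (\<xi> \<bullet> \<xi>) * osc_gauss_n z x \<xi> \<partial>lborel) = (\<Sum>c\<in>Basis. \<Prod>b\<in>Basis. \<integral>t. f c b t \<partial>lborel)"
    unfolding eq by (subst Bochner_Integration.integral_sum) (auto intro!: integrable_prod_Basis integral_prod_Basis sum.cong f)
  also have "\<dots> = (\<Sum>c\<in>Basis. (1 / (2 * z) - (x \<bullet> c)\<^sup>2 / (4 * z\<^sup>2)) * (\<integral>\<xi>. osc_gauss_n z x \<xi> \<partial>lborel))"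
  proof (intro sum.cong refl)
    fix c :: 'a assume c: "c \<in> Basis"
    have "(\<Prod>b\<in>Basis. \<integral>t. f c b t \<partial>lborel) =
      (\<Prod>b\<in>Basis. if b = c then (1 / (2 * z) - (x \<bullet> b)\<^sup>2 / (4 * z\<^sup>2)) * (\<integral>t. osc_gauss z (x \<bullet> b) t \<partial>lborel)
         else (\<integral>t. osc_gauss z (x \<bullet> b) t \<partial>lborel))"
      unfolding f_def by (intro prod.cong refl) (simp add: osc_gauss_moment_2[OF z])
    then show "(\<Prod>b\<in>Basis. \<integral>t. f c b t \<partial>lborel) =
      (1 / (2 * z) - (x \<bullet> c)\<^sup>2 / (4 * z\<^sup>2)) * (\<integral>\<xi>. osc_gauss_n z x \<xi> \<partial>lborel)"
      using split[OF c, of "\<lambda>e b. if e then (1 / (2 * z) - (x \<bullet> b)\<^sup>2 / (4 * z\<^sup>2)) * (\<integral>t. osc_gauss z (x \<bullet> b) t \<partial>lborel)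
         else (\<integral>t. osc_gauss z (x \<bullet> b) t \<partial>lborel)"]
        split[OF c, of "\<lambda>e b. (\<integral>t. osc_gauss z (x \<bullet> b) t \<partial>lborel)"]
      unfolding J by (simp add: mult.assoc)
  qed
  also have "\<dots> = (\<Sum>c\<in>(Basis::'a set). 1 / (2 * z) - (x \<bullet> c)\<^sup>2 / (4 * z\<^sup>2)) * (\<integral>\<xi>. osc_gauss_n z x \<xi> \<partial>lborel)"
    by (rule sum_distrib_right[symmetric])
  also have "(\<Sum>c\<in>(Basis::'a set). 1 / (2 * z) - (x \<bullet> c)\<^sup>2 / (4 * z\<^sup>2)) = DIM('a) / (2 * z) - (x \<bullet> x) / (4 * z\<^sup>2)"
    by (simp add: euclidean_inner[of x x] sum_subtractf sum_divide_distrib power2_eq_square)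
  finally show "(\<integral>\<xi>. (\<xi> \<bullet> \<xi>) * osc_gauss_n z x \<xi> \<partial>lborel) =
      (DIM('a) / (2 * z) - (x \<bullet> x) / (4 * z\<^sup>2)) * (\<integral>\<xi>. osc_gauss_n z x \<xi> \<partial>lborel)" .
qed

lemma
  fixes a :: real
  assumes a: "a > 0"
  shows integrable_gaussian_n: "integrable lborel (\<lambda>x::'a::euclidean_space. exp (- (a * (x \<bullet> x))))"
    and integrable_inner_gaussian_n: "integrable lborel (\<lambda>x::'a. (x \<bullet> x) * exp (- (a * (x \<bullet> x))))"
    and integral_gaussian_n: "(\<integral>x. exp (- (a * (x \<bullet> x))) \<partial>(lborel::'a measure)) = sqrt (pi / a) ^ DIM('a)"
proof -
  have eq: "osc_gauss_n (of_real a) 0 \<xi> = of_real (exp (- (a * (\<xi> \<bullet> \<xi>))))" for \<xi> :: 'a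
    by (simp add: osc_gauss_n_def exp_of_real[symmetric])
  have eq1: "osc_gauss (of_real a) 0 \<xi> = of_real (exp (- (a * \<xi>\<^sup>2)))" for \<xi>
    by (simp add: osc_gauss_def exp_of_real[symmetric])
  have z: "Re (of_real a) > 0" using a by simp
  show "integrable lborel (\<lambda>x::'a. exp (- (a * (x \<bullet> x))))"
    using integrable_osc_gauss_n[OF z, of "0::'a"] unfolding ext[of "osc_gauss_n (of_real a) (0::'a)", OF eq]
    by (simp only: complex_of_real_integrable_eq)
  show "integrable lborel (\<lambda>x::'a. (x \<bullet> x) * exp (- (a * (x \<bullet> x))))"
    using integrable_inner_osc_gauss_n[OF z, of "0::'a"]
    by (simp add: eq complex_of_real_integrable_eq flip: of_real_mult)
  have "complex_of_real (\<integral>x. exp (- (a * (x \<bullet> x))) \<partial>(lborel::'a measure)) = (\<integral>\<xi>. osc_gauss_n (of_real a) 0 \<xi> \<partial>(lborel::'a measure))"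
    by (simp add: eq)
  also have "\<dots> = (\<Prod>b\<in>(Basis::'a set). \<integral>t. osc_gauss (of_real a) 0 t \<partial>lborel)"
    unfolding osc_gauss_n_prod using integrable_osc_gauss[OF z, of 0]
    by (subst integral_prod_Basis) auto
  also have "\<dots> = complex_of_real (sqrt (pi / a) ^ DIM('a))"
    by (simp add: eq1 integral_gaussian[OF a])
  finally show "(\<integral>x. exp (- (a * (x \<bullet> x))) \<partial>(lborel::'a measure)) = sqrt (pi / a) ^ DIM('a)"
    by (simp only: of_real_eq_iff)
qed

text \<open>The bound sees only \<open>Re z\<close>. With \<open>Im z\<close> in the role of time it
  is uniform in time; the decay in time is given away, as a dominating function on a bounded
  interval is all that is wanted.\<close>

lemma norm_osc_gauss_n_integral_le:
  assumes "Re z > 0"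
  shows "cmod (\<integral>\<xi>. osc_gauss_n z (0::'a::euclidean_space) \<xi> \<partial>lborel) \<le> sqrt (pi / Re z) ^ DIM('a)"
proof -
  have "cmod (\<integral>\<xi>. osc_gauss_n z (0::'a) \<xi> \<partial>lborel) \<le> (\<integral>\<xi>. cmod (osc_gauss_n z (0::'a) \<xi>) \<partial>lborel)"
    by (rule integral_norm_bound)
  then show ?thesis
    by (simp add: norm_osc_gauss_n integral_gaussian_n[OF assms])
qed

subsection \<open>Gaussians as Schwartz functions\<close>

text \<open>The derivative \<open>D\<close> is quantified together with its value at
  \<open>v\<close>, so that the induction carries differentiability along with the value of the
  directional derivative.\<close>

lemma real_polynomial_function_dir_deriv:
  fixes p :: "'a::real_normed_vector \<Rightarrow> real"
  assumes "real_polynomial_function p"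
  shows "\<exists>q. real_polynomial_function q \<and> (\<forall>x. \<exists>D. (p has_derivative D) (at x) \<and> D v = q x)"
  using assms
proof induction
  case (linear f)
  then have "(f has_derivative f) (at x)" for x
    by (rule bounded_linear_imp_has_derivative)
  then show ?case
    by (intro exI[of _ "\<lambda>_. f v"]) auto
next
  case (const c)
  show ?case
    by (intro exI[of _ "\<lambda>_. 0"]) (auto intro!: exI[of _ "\<lambda>_. 0"])
next
  case (add f g)
  then obtain f' g' where *: "real_polynomial_function f'" "real_polynomial_function g'"
    "\<And>x. \<exists>D. (f has_derivative D) (at x) \<and> D v = f' x" "\<And>x. \<exists>D. (g has_derivative D) (at x) \<and> D v = g' x"
    by blast
  have "\<exists>D. ((\<lambda>x. f x + g x) has_derivative D) (at x) \<and> D v = f' x + g' x" for x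
  proof -
    obtain D E where "(f has_derivative D) (at x)" "D v = f' x" "(g has_derivative E) (at x)" "E v = g' x"
      using *(3)[of x] *(4)[of x] by blast
    then show ?thesis
      by (intro exI[of _ "\<lambda>h. D h + E h"]) (auto intro: has_derivative_add)
  qed
  then show ?case
    using *(1,2) by (intro exI[of _ "\<lambda>x. f' x + g' x"]) blast
next
  case (mult f g)
  then obtain f' g' where *: "real_polynomial_function f'" "real_polynomial_function g'"
    "\<And>x. \<exists>D. (f has_derivative D) (at x) \<and> D v = f' x" "\<And>x. \<exists>D. (g has_derivative D) (at x) \<and> D v = g' x"
    by blast
  have "\<exists>D. ((\<lambda>x. f x * g x) has_derivative D) (at x) \<and> D v = f x * g' x + f' x * g x" for x
  proof -
    obtain D E where "(f has_derivative D) (at x)" "D v = f' x" "(g has_derivative E) (at x)" "E v = g' x"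
      using *(3)[of x] *(4)[of x] by blast
    then show ?thesis
      by (intro exI[of _ "\<lambda>h. f x * E h + D h * g x"]) (auto intro: has_derivative_mult)
  qed
  then show ?case
    using *(1,2) mult.hyps by (intro exI[of _ "\<lambda>x. f x * g' x + f' x * g x"]) (simp add: real_polynomial_function.intros(3,4))
qed

lemma real_polynomial_function_growth:
  assumes "real_polynomial_function p"
  shows "\<exists>C m. C \<ge> 0 \<and> (\<forall>x. \<bar>p x\<bar> \<le> C * (1 + norm x) ^ m)"
  using assms
proof induction
  case (linear f)
  then obtain K where K: "K \<ge> 0" "\<And>x. norm (f x) \<le> norm x * K"
    using bounded_linear.nonneg_bounded by blast
  have "\<bar>f x\<bar> \<le> K * (1 + norm x) ^ 1" for x
    using K(1) K(2)[of x] by (simp add: algebra_simps)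
  then show ?case using K(1) by blast
next
  case (const c)
  show ?case by (intro exI[of _ "\<bar>c\<bar>"] exI[of _ 0]) auto
next
  case (add f g)
  then obtain C m D k where *: "C \<ge> 0" "D \<ge> 0" "\<And>x. \<bar>f x\<bar> \<le> C * (1 + norm x) ^ m" "\<And>x. \<bar>g x\<bar> \<le> D * (1 + norm x) ^ k"
    by blast
  have "\<bar>f x + g x\<bar> \<le> (C + D) * (1 + norm x) ^ (m + k)" for x
  proof -
    have "\<bar>f x + g x\<bar> \<le> C * (1 + norm x) ^ m + D * (1 + norm x) ^ k"
      using *(3,4)[of x] by linarith
    also have "\<dots> \<le> C * (1 + norm x) ^ (m + k) + D * (1 + norm x) ^ (m + k)"
      using * by (intro add_mono mult_left_mono power_increasing) auto
    finally show ?thesis by (simp add: algebra_simps)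
  qed
  then show ?case using * by (intro exI[of _ "C + D"] exI[of _ "m + k"]) auto
next
  case (mult f g)
  then obtain C m D k where *: "C \<ge> 0" "D \<ge> 0" "\<And>x. \<bar>f x\<bar> \<le> C * (1 + norm x) ^ m" "\<And>x. \<bar>g x\<bar> \<le> D * (1 + norm x) ^ k"
    by blast
  have "\<bar>f x * g x\<bar> \<le> (C * D) * (1 + norm x) ^ (m + k)" for x
  proof -
    have "\<bar>f x * g x\<bar> \<le> (C * (1 + norm x) ^ m) * (D * (1 + norm x) ^ k)"
      unfolding abs_mult using * by (intro mult_mono) auto
    then show ?thesis by (simp add: power_add mult_ac)
  qed
  then show ?case using * by (intro exI[of _ "C * D"] exI[of _ "m + k"]) auto
qed

text \<open>By \<open>1 + y \<le> exp y\<close> the product is at most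
  \<open>exp (m * y - a * y\<^sup>2)\<close>, and completing the square bounds the exponent.\<close>

lemma power_gaussian_bounded:
  assumes "a > 0"
  shows "\<exists>B. \<forall>y\<ge>0. (1 + y) ^ m * exp (- (a * y\<^sup>2)) \<le> (B :: real)"
proof (intro exI allI impI)
  fix y :: real assume y: "y \<ge> 0"
  have "(1 + y) ^ m \<le> exp y ^ m"
    using y by (intro power_mono) auto
  also have "\<dots> = exp (m * y)"
    by (simp add: exp_of_nat_mult)
  finally have "(1 + y) ^ m * exp (- (a * y\<^sup>2)) \<le> exp (m * y - a * y\<^sup>2)"
    by (simp add: exp_diff exp_minus field_simps)
  also have "m * y - a * y\<^sup>2 \<le> m\<^sup>2 / (4 * a)"
  proof -
    have "0 \<le> (2 * a * y - m)\<^sup>2 / (4 * a)"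
      using assms by simp
    also have "\<dots> = a * y\<^sup>2 - m * y + m\<^sup>2 / (4 * a)"
      using assms by (simp add: field_simps power2_eq_square)
    finally show ?thesis by simp
  qed
  finally show "(1 + y) ^ m * exp (- (a * y\<^sup>2)) \<le> exp (m\<^sup>2 / (4 * a))"
    by simp
qed

text \<open>This class contains a Gaussian and its Laplacian and is closed under partial
  derivatives, so all the Schwartz conditions reduce to one growth estimate for its members.\<close>

definition poly_gauss :: "real \<Rightarrow> (real ^ 'n \<Rightarrow> real) \<Rightarrow> real ^ 'n \<Rightarrow> complex" where
  "poly_gauss a p x = complex_of_real (p x * exp (- (a * (x \<bullet> x))))"

lemma partial_deriv_poly_gauss:
  fixes p :: "real ^ 'n \<Rightarrow> real"
  assumes "real_polynomial_function p"
  shows "\<exists>q. real_polynomial_function q \<and> partial_deriv i (poly_gauss a p) = poly_gauss a q"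
    and "poly_gauss a p differentiable at x"
proof -
  obtain p' where p': "real_polynomial_function p'"
    "\<And>x. \<exists>D. (p has_derivative D) (at x) \<and> D (axis i 1) = p' x"
    using real_polynomial_function_dir_deriv[OF assms] by blast
  define q where "q x = p' x + p x * (- 2 * a * (x \<bullet> axis i 1))" for x
  have "real_polynomial_function q"
    unfolding q_def using p'(1) assms
    by (intro real_polynomial_function.intros(2-4) real_polynomial_function.intros(1)[OF bounded_linear_inner_left])
  have deriv: "\<exists>D. (poly_gauss a p has_derivative D) (at x) \<and> D (axis i 1) = poly_gauss a q x" for x
  proof -
    obtain D where D: "(p has_derivative D) (at x)" "D (axis i 1) = p' x"
      using p'(2) by blast
    have e: "((\<lambda>x. exp (- (a * (x \<bullet> x)))) has_derivative
        (\<lambda>h. exp (- (a * (x \<bullet> x))) * (- (a * (x \<bullet> h + h \<bullet> x))))) (at x)"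
      by (auto intro!: derivative_eq_intros)
    have "(poly_gauss a p has_derivative
        (\<lambda>h. complex_of_real (D h * exp (- (a * (x \<bullet> x))) + p x * (exp (- (a * (x \<bullet> x))) * (- (a * (x \<bullet> h + h \<bullet> x))))))) (at x)"
      unfolding poly_gauss_def[abs_def]
      using has_derivative_of_real[OF has_derivative_mult[OF D(1) e]] by (simp add: add.commute)
    then show ?thesis
      by (intro exI conjI, assumption) (simp add: poly_gauss_def D(2) q_def inner_commute algebra_simps)
  qed
  have "partial_deriv i (poly_gauss a p) x = poly_gauss a q x" for x
    using deriv[of x] unfolding partial_deriv_def by (metis frechet_derivative_at)
  then show "\<exists>q. real_polynomial_function q \<and> partial_deriv i (poly_gauss a p) = poly_gauss a q"
    using \<open>real_polynomial_function q\<close> by blast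
  show "poly_gauss a p differentiable at x"
    using deriv[of x] by (auto simp: differentiable_def)
qed

lemma schwartz_poly_gauss:
  fixes p :: "real ^ 'n \<Rightarrow> real"
  assumes "real_polynomial_function p" "a > 0"
  shows "schwartz (poly_gauss a p)"
proof -
  have *: "\<exists>q. real_polynomial_function q \<and> foldr partial_deriv is (poly_gauss a p) = poly_gauss a q" for "is" :: "'n list"
  proof (induction "is")
    case Nil
    show ?case using assms(1) by auto
  next
    case (Cons i "is")
    then show ?case using partial_deriv_poly_gauss(1) by fastforce
  qed
  have "\<exists>B. \<forall>x. (1 + norm x) ^ N * cmod (poly_gauss a q x) \<le> B"
    if q: "real_polynomial_function q" for q :: "real ^ 'n \<Rightarrow> real" and N
  proof -
    obtain C m where Cm: "C \<ge> 0" "\<And>x. \<bar>q x\<bar> \<le> C * (1 + norm x) ^ m"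
      using real_polynomial_function_growth[OF q] by blast
    obtain B where B: "\<And>y. y \<ge> 0 \<Longrightarrow> (1 + y) ^ (N + m) * exp (- (a * y\<^sup>2)) \<le> B"
      using power_gaussian_bounded[OF assms(2)] by blast
    have "(1 + norm x) ^ N * cmod (poly_gauss a q x) \<le> C * B" for x
    proof -
      have "(1 + norm x) ^ N * cmod (poly_gauss a q x) = (1 + norm x) ^ N * (\<bar>q x\<bar> * exp (- (a * (norm x)\<^sup>2)))"
        unfolding poly_gauss_def norm_of_real by (simp add: abs_mult power2_norm_eq_inner)
      also have "\<dots> \<le> (1 + norm x) ^ N * (C * (1 + norm x) ^ m * exp (- (a * (norm x)\<^sup>2)))"
        using Cm by (intro mult_left_mono mult_right_mono) auto
      also have "\<dots> = C * ((1 + norm x) ^ (N + m) * exp (- (a * (norm x)\<^sup>2)))"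
        by (simp add: power_add mult_ac)
      also have "\<dots> \<le> C * B"
        using Cm B by (intro mult_left_mono) auto
      finally show ?thesis .
    qed
    then show ?thesis by blast
  qed
  then show ?thesis
    unfolding schwartz_def using * partial_deriv_poly_gauss(2) by metis
qed

definition gauss :: "real \<Rightarrow> real ^ 'n \<Rightarrow> complex" where
  "gauss a = poly_gauss a (\<lambda>_. 1)"

text \<open>The Laplacian of \<open>gauss a\<close>.\<close>

definition lap_gauss :: "real \<Rightarrow> real ^ 'n \<Rightarrow> complex" where
  "lap_gauss a = poly_gauss a (\<lambda>x. 4 * a\<^sup>2 * (x \<bullet> x) - 2 * a * real CARD('n))"

lemma real_polynomial_function_inner_self: "real_polynomial_function (\<lambda>x :: 'a::euclidean_space. x \<bullet> x)"
proof -
  have "(\<lambda>x::'a. x \<bullet> x) = (\<lambda>x. \<Sum>b\<in>Basis. (x \<bullet> b) * (x \<bullet> b))"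
    by (rule ext) (rule euclidean_inner)
  then show ?thesis
    by (simp only:) (intro real_polynomial_function_sum finite_Basis real_polynomial_function.intros(4)
        real_polynomial_function.intros(1)[OF bounded_linear_inner_left])
qed

lemma
  assumes "a > 0"
  shows schwartz_gauss: "schwartz (gauss a)" and schwartz_lap_gauss: "schwartz (lap_gauss a)"
  unfolding gauss_def lap_gauss_def
  by (intro schwartz_poly_gauss assms real_polynomial_function.intros(2-4) real_polynomial_function_diff
      real_polynomial_function_inner_self)+

text \<open>The rule for the Laplacian comes out of the second moment: the dimension term of
  \<open>osc_gauss_n_moment\<close> cancels the constant in \<open>lap_gauss\<close>. Integration by
  parts in several variables is avoided.\<close>

lemma
  fixes \<xi> :: "real ^ 'n"
  assumes a: "a > 0"
  shows fourier_gauss: "fourier (gauss a) \<xi> = sqrt (pi / a) ^ CARD('n) * exp (- ((\<xi> \<bullet> \<xi>) / (4 * a)))"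
    and fourier_lap_gauss: "fourier (lap_gauss a) \<xi> = - (\<xi> \<bullet> \<xi>) * fourier (gauss a) \<xi>"
proof -
  let ?E = "osc_gauss_n (of_real a) (- \<xi>)"
  have z: "Re (complex_of_real a) > 0" using a by simp
  have eq: "cis (- (x \<bullet> \<xi>)) * poly_gauss a p x = p x * ?E x" for x and p :: "real ^ 'n \<Rightarrow> real"
    by (simp add: poly_gauss_def osc_gauss_n_def cis_conv_exp exp_of_real[symmetric] inner_commute mult_ac flip: exp_add)
  have J: "(\<integral>x. osc_gauss_n (of_real a) (0::real^'n) x \<partial>lborel) = sqrt (pi / a) ^ CARD('n)"
  proof -
    have "osc_gauss_n (of_real a) (0::real^'n) x = complex_of_real (exp (- (a * (x \<bullet> x))))" for x
      by (simp add: osc_gauss_n_def exp_of_real[symmetric])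
    then show ?thesis
      using integral_gaussian_n[OF a, where 'a = "real^'n"] by simp
  qed
  have E: "(\<integral>x. ?E x \<partial>lborel) = sqrt (pi / a) ^ CARD('n) * exp (- ((\<xi> \<bullet> \<xi>) / (4 * a)))"
    by (subst osc_gauss_n_integral[OF z]) (simp add: J exp_of_real[symmetric])
  have 1: "fourier (gauss a) \<xi> = (\<integral>x. ?E x \<partial>lborel)"
    by (simp add: fourier_def gauss_def eq)
  show "fourier (gauss a) \<xi> = sqrt (pi / a) ^ CARD('n) * exp (- ((\<xi> \<bullet> \<xi>) / (4 * a)))"
    using 1 E by simp
  have "fourier (lap_gauss a) \<xi> = (\<integral>x. of_real (4 * a\<^sup>2) * ((x \<bullet> x) * ?E x) - of_real (2 * a * CARD('n)) * ?E x \<partial>lborel)"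
    by (simp add: fourier_def lap_gauss_def eq algebra_simps)
  also have "\<dots> = of_real (4 * a\<^sup>2) * (\<integral>x. (x \<bullet> x) * ?E x \<partial>lborel) - of_real (2 * a * CARD('n)) * (\<integral>x. ?E x \<partial>lborel)"
    using integrable_osc_gauss_n[OF z, of "- \<xi>"] integrable_inner_osc_gauss_n[OF z, of "- \<xi>"]
    by (subst Bochner_Integration.integral_diff) (auto simp only: integrable_mult_right integral_mult_right_zero)
  also have "\<dots> = - (\<xi> \<bullet> \<xi>) * (\<integral>x. ?E x \<partial>lborel)"
    unfolding osc_gauss_n_moment[OF z] using a by (simp add: field_simps power2_eq_square)
  finally show "fourier (lap_gauss a) \<xi> = - (\<xi> \<bullet> \<xi>) * fourier (gauss a) \<xi>"
    unfolding 1 .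
qed

subsection \<open>Evolution of Gaussians\<close>

context
  fixes a :: real
  assumes a: "a > 0"
begin

text \<open>Time enters only by adding \<open>\<i> * t\<close> to the coefficient
  \<open>1 / (4 * a)\<close> in the exponent of the transformed Gaussian.\<close>

lemma evolution_integrand:
  fixes x \<xi> :: "real ^ 'n"
  shows "cis (x \<bullet> \<xi>) * (cis (- t * (norm \<xi>)\<^sup>2) * fourier (gauss a) \<xi>) =
    sqrt (pi / a) ^ CARD('n) * osc_gauss_n (Complex (1 / (4 * a)) t) x \<xi>"
proof -
  have "Complex (1 / (4 * a)) t = 1 / (4 * a) + \<i> * t"
    by (simp add: complex_eq_iff)
  then show ?thesis
    unfolding fourier_gauss[OF a]
    by (simp add: osc_gauss_n_def cis_conv_exp exp_of_real[symmetric] power2_norm_eq_inner algebra_simps mult_exp_exp)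
qed

lemma evolution_lap_integrand:
  fixes x \<xi> :: "real ^ 'n"
  shows "cis (x \<bullet> \<xi>) * (cis (- t * (norm \<xi>)\<^sup>2) * fourier (lap_gauss a) \<xi>) =
    - (sqrt (pi / a) ^ CARD('n) * ((\<xi> \<bullet> \<xi>) * osc_gauss_n (Complex (1 / (4 * a)) t) x \<xi>))"
  using evolution_integrand[of x \<xi> t] unfolding fourier_lap_gauss[OF a] by (simp add: mult_ac)


lemma Re_pos: "Re (Complex (1 / (4 * a)) t) > 0"
  using a by simp

lemma schroedinger_gauss:
  fixes x :: "real ^ 'n"
  shows "schroedinger_schwartz t (gauss a) x = complex_of_real (1 / (2 * pi) ^ CARD('n)) *
    (sqrt (pi / a) ^ CARD('n) * (\<integral>\<xi>. osc_gauss_n (Complex (1 / (4 * a)) t) x \<xi> \<partial>lborel))"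
  unfolding schroedinger_schwartz_def evolution_integrand by simp

text \<open>An explicit factor links the evolved Laplacian to the evolved Gaussian. Its
  measurability, its domination and its value at time 0 are all derived from those of the
  Gaussian.\<close>

lemma schroedinger_lap_gauss:
  fixes x :: "real ^ 'n"
  shows "schroedinger_schwartz t (lap_gauss a) x =
    - (CARD('n) / (2 * Complex (1 / (4 * a)) t) - (x \<bullet> x) / (4 * (Complex (1 / (4 * a)) t)\<^sup>2)) *
      schroedinger_schwartz t (gauss a) x"
  unfolding schroedinger_schwartz_def evolution_lap_integrand evolution_integrand
    Bochner_Integration.integral_minus integral_mult_right_zero osc_gauss_n_moment[OF Re_pos]
  by (simp only: mult_minus_left mult_minus_right mult_ac DIM_cart DIM_real mult_1_left)

lemma sqrt_pi_eq: "sqrt (pi / a) * sqrt (pi / (1 / (4 * a))) = 2 * pi"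
proof -
  have "pi / a * (pi / (1 / (4 * a))) = (2 * pi)\<^sup>2"
    using a by (simp add: power2_eq_square)
  then have "sqrt (pi / a) * sqrt (pi / (1 / (4 * a))) = sqrt ((2 * pi)\<^sup>2)"
    by (metis real_sqrt_mult)
  then show ?thesis by (simp only: real_sqrt_abs) simp
qed

text \<open>The normalisation in Fourier inversion, for the Gaussian alone. It yields the exact
  identity at time 0 and a constant 1 in the bound at later times.\<close>

lemma evolution_constant:
  "1 / (2 * pi) ^ k * (sqrt (pi / a) ^ k * sqrt (pi / (1 / (4 * a))) ^ k) = 1"
proof -
  have "sqrt (pi / a) ^ k * sqrt (pi / (1 / (4 * a))) ^ k = (2 * pi) ^ k"
    by (simp only: power_mult_distrib[symmetric] sqrt_pi_eq)
  then show ?thesis by simp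
qed

lemma schroedinger_gauss_0: "schroedinger_schwartz 0 (gauss a) x = gauss a (x :: real ^ 'n)"
proof -
  let ?z = "complex_of_real (1 / (4 * a))"
  have z: "Complex (1 / (4 * a)) 0 = ?z" "Re ?z > 0"
    using a by (simp_all add: complex_eq_iff)
  have "(\<integral>\<xi>. osc_gauss_n ?z (0::real^'n) \<xi> \<partial>lborel) =
      (\<integral>\<xi>. complex_of_real (exp (- (1 / (4 * a) * (\<xi> \<bullet> \<xi>)))) \<partial>(lborel :: (real^'n) measure))"
    by (simp add: osc_gauss_n_def exp_of_real[symmetric])
  also have "\<dots> = sqrt (pi / (1 / (4 * a))) ^ CARD('n)"
    using integral_gaussian_n[of "1 / (4 * a)", where 'a = "real^'n"] a by simp
  finally have J: "(\<integral>\<xi>. osc_gauss_n ?z (0::real^'n) \<xi> \<partial>lborel) = sqrt (pi / (1 / (4 * a))) ^ CARD('n)" .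
  have c: "complex_of_real (1 / (2 * pi) ^ CARD('n)) * (sqrt (pi / a) ^ CARD('n) * (sqrt (pi / (1 / (4 * a))) ^ CARD('n))) = 1"
    using evolution_constant[of "CARD('n)"] by (metis of_real_1 of_real_mult)
  have e: "exp (- (complex_of_real (x \<bullet> x) / (4 * ?z))) = gauss a x"
    using a by (simp add: gauss_def poly_gauss_def exp_of_real[symmetric] mult.commute)
  have "schroedinger_schwartz 0 (gauss a) x =
     complex_of_real (1 / (2 * pi) ^ CARD('n)) * (sqrt (pi / a) ^ CARD('n) * (gauss a x * sqrt (pi / (1 / (4 * a))) ^ CARD('n)))"
    unfolding schroedinger_gauss z(1) by (subst osc_gauss_n_integral[OF z(2)]) (simp only: J e)
  also have "\<dots> = gauss a x * (complex_of_real (1 / (2 * pi) ^ CARD('n)) * (sqrt (pi / a) ^ CARD('n) * (sqrt (pi / (1 / (4 * a))) ^ CARD('n))))"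
    by (simp only: mult_ac of_real_mult)
  finally show ?thesis
    unfolding c by simp
qed

text \<open>Differentiation under the Fourier integral: the symbol contributes
  \<open>- \<i> * (\<xi> \<bullet> \<xi>)\<close>, which is \<open>\<i>\<close> times the multiplier
  of the Laplacian. The modulus of the differentiated integrand does not depend on \<open>t\<close>,
  so it supplies one dominating function for all times.\<close>

lemma schroedinger_gauss_deriv:
  fixes x :: "real ^ 'n"
  shows "((\<lambda>t. schroedinger_schwartz t (gauss a) x) has_vector_derivative
    \<i> * schroedinger_schwartz t (lap_gauss a) x) (at t)"
proof -
  let ?f = "\<lambda>t \<xi>. cis (x \<bullet> \<xi>) * (cis (- t * (norm \<xi>)\<^sup>2) * fourier (gauss a) \<xi>)"
  let ?f' = "\<lambda>t \<xi>. \<i> * (cis (x \<bullet> \<xi>) * (cis (- t * (norm \<xi>)\<^sup>2) * fourier (lap_gauss a) \<xi>))"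
  let ?c = "complex_of_real (sqrt (pi / a) ^ CARD('n))"
  have "((\<lambda>t. \<integral>\<xi>. ?f t \<xi> \<partial>lborel) has_vector_derivative (\<integral>\<xi>. ?f' t \<xi> \<partial>lborel)) (at t)"
  proof (rule has_vector_derivative_lebesgue_integral)
    show "integrable lborel (?f t)" for t
      unfolding evolution_integrand by (intro integrable_mult_right integrable_osc_gauss_n Re_pos)
    show "((\<lambda>t. ?f t \<xi>) has_vector_derivative ?f' t \<xi>) (at t)" for t \<xi>
    proof -
      have "((\<lambda>w. cis (x \<bullet> \<xi>) * (exp (\<i> * (- w * (norm \<xi>)\<^sup>2)) * fourier (gauss a) \<xi>)) has_field_derivative ?f' t \<xi>) (at (of_real t))"
        unfolding fourier_lap_gauss[OF a]
        by (auto intro!: derivative_eq_intros simp: cis_conv_exp power2_norm_eq_inner mult_ac)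
      from has_vector_derivative_real_field[OF this] show ?thesis
        by (simp add: cis_conv_exp)
    qed
    show "integrable lborel (\<lambda>\<xi>. sqrt (pi / a) ^ CARD('n) * ((\<xi> \<bullet> \<xi>) * exp (- (1 / (4 * a) * (\<xi> \<bullet> \<xi> :: real)))) :: real)"
      using a by (intro integrable_mult_right integrable_inner_gaussian_n) auto
    show "norm (?f' t \<xi>) \<le> sqrt (pi / a) ^ CARD('n) * ((\<xi> \<bullet> \<xi>) * exp (- (1 / (4 * a) * (\<xi> \<bullet> \<xi>))))" for t \<xi>
      unfolding evolution_lap_integrand using a by (simp add: norm_mult norm_osc_gauss_n norm_power)
    show "?f' t \<in> borel_measurable lborel"
      unfolding evolution_lap_integrand by measurable
  qed
  then have "((\<lambda>t. complex_of_real (1 / (2 * pi) ^ CARD('n)) * (\<integral>\<xi>. ?f t \<xi> \<partial>lborel)) has_vector_derivative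
      complex_of_real (1 / (2 * pi) ^ CARD('n)) * (\<integral>\<xi>. ?f' t \<xi> \<partial>lborel)) (at t)"
    by (rule has_vector_derivative_mult_right)
  then show ?thesis
    unfolding schroedinger_schwartz_def by (simp add: mult_ac)
qed

section \<open>Joint measurability and a dominating function for the evolved Gaussian\<close>

lemma measurable_schroedinger_gauss:
  "(\<lambda>(t, x :: real ^ 'n). schroedinger_schwartz t (gauss a) x) \<in> borel_measurable (borel \<Otimes>\<^sub>M borel)"
proof -
  have "(\<lambda>p. osc_gauss_n (Complex (1 / (4 * a)) (fst (fst p))) (snd (fst p) :: real^'n) (snd p)) \<in>
      borel_measurable borel"
    unfolding osc_gauss_n_def Complex_eq by (intro borel_measurable_continuous_onI continuous_intros)
  then have "(\<lambda>(p, \<xi>). osc_gauss_n (Complex (1 / (4 * a)) (fst p)) (snd p :: real^'n) \<xi>) \<in>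
      borel_measurable ((borel \<Otimes>\<^sub>M borel) \<Otimes>\<^sub>M lborel)"
    by (simp add: split_beta borel_prod measurable_cong_sets[OF sets_pair_measure_cong[OF refl sets_lborel] refl])
  then have [measurable]: "(\<lambda>p. \<integral>\<xi>. osc_gauss_n (Complex (1 / (4 * a)) (fst p)) (snd p :: real^'n) \<xi> \<partial>lborel) \<in>
      borel_measurable (borel \<Otimes>\<^sub>M borel)"
    by (rule lborel.borel_measurable_lebesgue_integral)
  show ?thesis
    unfolding schroedinger_gauss split_beta by measurable
qed

lemma measurable_schroedinger_lap_gauss:
  "(\<lambda>(t, x :: real ^ 'n). schroedinger_schwartz t (lap_gauss a) x) \<in> borel_measurable (borel \<Otimes>\<^sub>M borel)"
proof -
  note [measurable] = measurable_schroedinger_gauss[unfolded split_beta]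
  have [measurable]: "Complex (1 / (4 * a)) \<in> borel_measurable borel"
    unfolding Complex_eq by measurable
  show ?thesis
    unfolding schroedinger_lap_gauss split_beta by measurable
qed

text \<open>Evolution spreads a Gaussian: with \<open>z = 1 / (4 * a) + \<i> * t\<close> the modulus
  decays like \<open>exp (- (x \<bullet> x) * Re (1 / (4 * z)))\<close>, and this rate is smallest
  at \<open>t = T\<close>. Integrability of \<open>h\<close> will handle the data and lower powers
  of \<open>u\<close>, boundedness of \<open>h\<close> the highest power.\<close>

lemma schroedinger_gauss_bound:
  "\<exists>h :: real ^ 'n \<Rightarrow> real. integrable lborel h \<and> (\<exists>M. \<forall>x. h x \<le> M) \<and>
    (\<forall>t\<in>{0..T}. \<forall>x. cmod (schroedinger_schwartz t (gauss a) x) \<le> h x \<and>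
      cmod (schroedinger_schwartz t (lap_gauss a) x) \<le> h x)"
proof -
  \<comment> \<open>\<open>b\<close> is \<open>Re (1 / (4 * z))\<close> at the final time
    \<open>T\<close>.\<close>
  define b where "b = (1 / (4 * a)) / (4 * ((1 / (4 * a))\<^sup>2 + T\<^sup>2))"
  \<comment> \<open>The first summand bounds the constant part of the factor in
    \<open>schroedinger_lap_gauss\<close>; the extra 1 makes \<open>h\<close> dominate the evolved
    Gaussian as well.\<close>
  define A where "A = 2 * a * CARD('n) + 1"
  define h :: "real ^ 'n \<Rightarrow> real" where "h x = (A + 4 * a\<^sup>2 * (x \<bullet> x)) * exp (- (b * (x \<bullet> x)))" for x
  have b: "b > 0"
    unfolding b_def using a by (intro divide_pos_pos mult_pos_pos add_pos_nonneg) auto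
  have A: "A \<ge> 1" using a by (simp add: A_def)
  have "integrable lborel h"
    unfolding h_def distrib_right mult.assoc using b
    by (intro Bochner_Integration.integrable_add integrable_mult_right integrable_gaussian_n integrable_inner_gaussian_n)
  moreover have "h x \<le> A + 4 * a\<^sup>2 / b" for x
  proof -
    have "b * (x \<bullet> x) \<le> exp (b * (x \<bullet> x))"
      using exp_ge_add_one_self[of "b * (x \<bullet> x)"] by linarith
    then have "(x \<bullet> x) * exp (- (b * (x \<bullet> x))) \<le> 1 / b"
      using b by (simp add: exp_minus field_simps)
    then have "4 * a\<^sup>2 * ((x \<bullet> x) * exp (- (b * (x \<bullet> x)))) \<le> 4 * a\<^sup>2 * (1 / b)"
      by (intro mult_left_mono) auto
    moreover have "A * exp (- (b * (x \<bullet> x))) \<le> A * 1"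
      using A b by (intro mult_left_mono) auto
    ultimately show ?thesis
      by (simp add: h_def algebra_simps)
  qed
  moreover have "cmod (schroedinger_schwartz t (gauss a) x) \<le> h x \<and>
      cmod (schroedinger_schwartz t (lap_gauss a) x) \<le> h x" if t: "t \<in> {0..T}" for t x
  proof -
    let ?z = "Complex (1 / (4 * a)) t"
    let ?u = "cmod (schroedinger_schwartz t (gauss a) x)"
    have "Re (1 / (4 * ?z)) = (1 / (4 * a)) / (4 * ((1 / (4 * a))\<^sup>2 + t\<^sup>2))"
      by (simp add: Re_divide power2_eq_square field_simps)
    also have "\<dots> \<ge> b"
      unfolding b_def using t a
      by (intro divide_left_mono mult_left_mono add_left_mono power_mono mult_pos_pos add_pos_nonneg) auto
    finally have Re: "Re (1 / (4 * ?z)) \<ge> b" .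
    have "cmod (exp (- (complex_of_real (x \<bullet> x) / (4 * ?z)))) = exp (- ((x \<bullet> x) * Re (1 / (4 * ?z))))"
    proof -
      have "complex_of_real (x \<bullet> x) / (4 * ?z) = (x \<bullet> x) *\<^sub>R (1 / (4 * ?z))"
        by (simp add: scaleR_conv_of_real)
      then show ?thesis
        by (simp only: norm_exp_eq_Re uminus_complex.sel scaleR_complex.sel)
    qed
    also have "\<dots> \<le> exp (- (b * (x \<bullet> x)))"
      using mult_left_mono[OF Re, of "x \<bullet> x"] by (simp add: mult.commute)
    finally have e: "cmod (exp (- (complex_of_real (x \<bullet> x) / (4 * ?z)))) \<le> exp (- (b * (x \<bullet> x)))" .
    have J: "cmod (\<integral>\<xi>. osc_gauss_n ?z (0::real^'n) \<xi> \<partial>lborel) \<le> sqrt (pi / (1 / (4 * a))) ^ CARD('n)"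
      using norm_osc_gauss_n_integral_le[OF Re_pos, of t, where 'a = "real^'n"] by simp
    have "?u = 1 / (2 * pi) ^ CARD('n) * (sqrt (pi / a) ^ CARD('n) * (cmod (exp (- (complex_of_real (x \<bullet> x) / (4 * ?z)))) *
        cmod (\<integral>\<xi>. osc_gauss_n ?z (0::real^'n) \<xi> \<partial>lborel)))"
      unfolding schroedinger_gauss using a
      by (subst osc_gauss_n_integral[OF Re_pos]) (simp only: norm_mult norm_of_real, simp)
    also have "\<dots> \<le> 1 / (2 * pi) ^ CARD('n) * (sqrt (pi / a) ^ CARD('n) * (exp (- (b * (x \<bullet> x))) *
        sqrt (pi / (1 / (4 * a))) ^ CARD('n)))"
      using a by (intro mult_left_mono mult_mono e J) auto
    also have "\<dots> = exp (- (b * (x \<bullet> x))) * (1 / (2 * pi) ^ CARD('n) * (sqrt (pi / a) ^ CARD('n) *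
        sqrt (pi / (1 / (4 * a))) ^ CARD('n)))"
      by (simp only: mult_ac)
    also have "\<dots> = exp (- (b * (x \<bullet> x)))"
      by (simp only: evolution_constant mult_1_right)
    finally have u: "?u \<le> exp (- (b * (x \<bullet> x)))" .
    have z: "1 / (4 * a) \<le> cmod ?z"
      using complex_Re_le_cmod[of ?z] by simp
    have "cmod (- (CARD('n) / (2 * ?z) - (x \<bullet> x) / (4 * ?z\<^sup>2))) \<le> CARD('n) / (2 * cmod ?z) + (x \<bullet> x) / (4 * (cmod ?z)\<^sup>2)"
      using norm_triangle_ineq4[of "CARD('n) / (2 * ?z)" "(x \<bullet> x) / (4 * ?z\<^sup>2)"]
      by (simp add: norm_divide norm_mult norm_power norm_minus_commute)
    also have "\<dots> \<le> CARD('n) / (2 * (1 / (4 * a))) + (x \<bullet> x) / (4 * (1 / (4 * a))\<^sup>2)"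
      using z a by (intro add_mono divide_left_mono mult_left_mono power_mono mult_pos_pos zero_less_power
          less_le_trans[OF _ z]) auto
    also have "\<dots> = 2 * a * CARD('n) + 4 * a\<^sup>2 * (x \<bullet> x)"
      using a by (simp add: field_simps power2_eq_square)
    finally have "cmod (schroedinger_schwartz t (lap_gauss a) x) \<le> (2 * a * CARD('n) + 4 * a\<^sup>2 * (x \<bullet> x)) * exp (- (b * (x \<bullet> x)))"
      unfolding schroedinger_lap_gauss norm_mult using u a by (intro mult_mono) auto
    also have "\<dots> \<le> h x"
      unfolding h_def A_def by (intro mult_right_mono) auto
    finally have "cmod (schroedinger_schwartz t (lap_gauss a) x) \<le> h x" .
    moreover have "?u \<le> h x"
    proof -
      have "1 * exp (- (b * (x \<bullet> x))) \<le> h x"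
        unfolding h_def using A by (intro mult_right_mono add_increasing2) auto
      with u show ?thesis by simp
    qed
    ultimately show ?thesis by blast
  qed
  ultimately show ?thesis by blast
qed

end

subsection \<open>From the Duhamel formula to the weak form\<close>

lemma fubini_lborel:
  fixes f :: "'a::euclidean_space \<Rightarrow> 'b::euclidean_space \<Rightarrow> 'c::{banach, second_countable_topology}"
  assumes "integrable lborel (\<lambda>p. f (fst p) (snd p))"
  shows "(\<integral>p. f (fst p) (snd p) \<partial>lborel) = (\<integral>x. \<integral>y. f x y \<partial>lborel \<partial>lborel)"
    and "(\<integral>p. f (fst p) (snd p) \<partial>lborel) = (\<integral>y. \<integral>x. f x y \<partial>lborel \<partial>lborel)"
    and "AE x in lborel. integrable lborel (f x)"
    and "integrable lborel (\<lambda>x. \<integral>y. f x y \<partial>lborel)"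
proof -
  have *: "integrable (lborel \<Otimes>\<^sub>M lborel) (\<lambda>p. f (fst p) (snd p))"
    using assms by (simp add: lborel_prod)
  show 1: "(\<integral>p. f (fst p) (snd p) \<partial>lborel) = (\<integral>x. \<integral>y. f x y \<partial>lborel \<partial>lborel)"
    using lborel_pair.integral_fst'[OF *] by (simp add: lborel_prod)
  show "(\<integral>p. f (fst p) (snd p) \<partial>lborel) = (\<integral>y. \<integral>x. f x y \<partial>lborel \<partial>lborel)"
    using lborel_pair.Fubini_integral[of f] * unfolding 1 by (simp add: split_def)
  show "AE x in lborel. integrable lborel (f x)"
    using lborel_pair.AE_integrable_fst'[OF *] by simp
  show "integrable lborel (\<lambda>x. \<integral>y. f x y \<partial>lborel)"
    using lborel_pair.integrable_fst'[OF *] by simp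
qed

lemma integrable_fst_times:
  fixes f :: "'a::euclidean_space \<Rightarrow> real" and g :: "'b::euclidean_space \<Rightarrow> real"
  assumes "integrable lborel f" "integrable lborel g"
  shows "integrable lborel (\<lambda>p. f (fst p) * g (snd p))"
proof -
  have [measurable]: "f \<in> borel_measurable borel" "g \<in> borel_measurable borel"
    using assms[THEN borel_measurable_integrable] by simp_all
  have "integrable (lborel \<Otimes>\<^sub>M lborel) (\<lambda>p. f (fst p) * g (snd p))"
  proof (rule lborel_pair.Fubini_integrable)
    show "(\<lambda>p. f (fst p) * g (snd p)) \<in> borel_measurable (lborel \<Otimes>\<^sub>M lborel)"
      by measurable
    show "integrable lborel (\<lambda>x. \<integral>y. norm (f (fst (x, y)) * g (snd (x, y))) \<partial>lborel)"
      using assms by (simp add: abs_mult)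
    show "AE x in lborel. integrable lborel (\<lambda>y. f (fst (x, y)) * g (snd (x, y)))"
      using assms by simp
  qed
  then show ?thesis by (simp add: lborel_prod)
qed

text \<open>
  The roles are \<open>V t = U(t)\<phi>\<close>, \<open>W t = U(t)\<Delta>\<phi>\<close> and \<open>N = |u|\<^sup>p\<close>.
\<close>

lemma duhamel_weak_form:
  fixes u N V W :: "real \<Rightarrow> 'a::euclidean_space \<Rightarrow> complex" and g :: "'a \<Rightarrow> complex"
    and h :: "'a \<Rightarrow> real" and \<eta> \<eta>' :: "real \<Rightarrow> real" and \<tau> E :: real and lam :: complex
  assumes \<tau>: "0 \<le> \<tau>"
    and mu [measurable]: "(\<lambda>p. u (fst p) (snd p)) \<in> borel_measurable borel"
    and mN [measurable]: "(\<lambda>p. N (fst p) (snd p)) \<in> borel_measurable borel"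
    and mV: "(\<lambda>p. V (fst p) (snd p)) \<in> borel_measurable borel"
    and mW: "(\<lambda>p. W (fst p) (snd p)) \<in> borel_measurable borel"
    and mg [measurable]: "g \<in> borel_measurable borel"
    and m\<eta> [measurable]: "\<eta> \<in> borel_measurable borel" "\<eta>' \<in> borel_measurable borel"
    and ih: "integrable lborel h"
    and iu: "integrable lborel (\<lambda>p. indicator {0..\<tau>} (fst p) * (cmod (u (fst p) (snd p)) * h (snd p)))"
    and iN: "integrable lborel (\<lambda>p. indicator {0..\<tau>} (fst p) * (cmod (N (fst p) (snd p)) * h (snd p)))"
    and ig: "integrable lborel (\<lambda>x. cmod (g x) * h x)"
    and Vh: "\<And>t x. t \<in> {0..\<tau>} \<Longrightarrow> cmod (V t x) \<le> h x"
    and Wh: "\<And>t x. t \<in> {0..\<tau>} \<Longrightarrow> cmod (W t x) \<le> h x"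
    and V': "\<And>t x. ((\<lambda>t. V t x) has_vector_derivative \<i> * W t x) (at t)"
    and \<eta>': "\<And>t. t \<in> {0..\<tau>} \<Longrightarrow> (\<eta> has_real_derivative \<eta>' t) (at t)"
    and \<eta>\<tau>: "\<eta> \<tau> = 0"
    and E: "\<And>t. t \<in> {0..\<tau>} \<Longrightarrow> \<bar>\<eta> t\<bar> \<le> E" "\<And>t. t \<in> {0..\<tau>} \<Longrightarrow> \<bar>\<eta>' t\<bar> \<le> E"
    and duhV: "\<And>t. t \<in> {0..\<tau>} \<Longrightarrow> (\<integral>x. u t x * V 0 x \<partial>lborel) = (\<integral>x. g x * V t x \<partial>lborel) -
        \<i> * lam * (LBINT s:{0..t}. \<integral>x. N s x * V (t - s) x \<partial>lborel)"
    and duhW: "\<And>t. t \<in> {0..\<tau>} \<Longrightarrow> (\<integral>x. u t x * W 0 x \<partial>lborel) = (\<integral>x. g x * W t x \<partial>lborel) -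
        \<i> * lam * (LBINT s:{0..t}. \<integral>x. N s x * W (t - s) x \<partial>lborel)"
  shows "(\<integral>p. indicator {0..\<tau>} (fst p) *\<^sub>R (u (fst p) (snd p) *
            (\<eta>' (fst p) * V 0 (snd p) + \<i> * \<eta> (fst p) * W 0 (snd p))) \<partial>lborel) =
    - \<eta> 0 * (\<integral>x. g x * V 0 x \<partial>lborel) +
    \<i> * lam * (\<integral>p. indicator {0..\<tau>} (fst p) *\<^sub>R (\<eta> (fst p) * (N (fst p) (snd p) * V 0 (snd p))) \<partial>lborel)" (is ?th1)
    and "integrable lborel (\<lambda>p. indicator {0..\<tau>} (fst p) *\<^sub>R (u (fst p) (snd p) *
            (\<eta>' (fst p) * V 0 (snd p) + \<i> * \<eta> (fst p) * W 0 (snd p))))" (is ?th2)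
    and "integrable lborel (\<lambda>p. indicator {0..\<tau>} (fst p) *\<^sub>R (\<eta> (fst p) * (N (fst p) (snd p) * V 0 (snd p))))" (is ?th3)
proof -
  \<comment> \<open>\<open>K t s x\<close> is the \<open>t\<close>-derivative of \<open>\<eta> t * V (t - s) x\<close>, so one application of Fubini removes both time integrals.\<close>
  define K where "K t s x = \<eta>' t * V (t - s) x + \<i> * \<eta> t * W (t - s) x" for t s x
  have mh [measurable]: "h \<in> borel_measurable borel"
    using borel_measurable_integrable[OF ih] by simp
  have h0: "h x \<ge> 0" for x
    using Vh[of 0 x] \<tau> norm_ge_zero[of "V 0 x"] by (simp del: norm_ge_zero)
  have E0: "E \<ge> 0" using E(1)[of 0] \<tau> by simp
  have mVt [measurable]: "V t \<in> borel_measurable borel" "W t \<in> borel_measurable borel" for t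
    using measurable_compose[OF borel_measurable_continuous_onI mV, of "\<lambda>x. (t, x)"]
      measurable_compose[OF borel_measurable_continuous_onI mW, of "\<lambda>x. (t, x)"]
    by (simp_all add: continuous_intros)
  have mVs [measurable]: "(\<lambda>p. V (t - fst p) (snd p)) \<in> borel_measurable borel"
    "(\<lambda>p. W (t - fst p) (snd p)) \<in> borel_measurable borel" for t
    using measurable_compose[OF borel_measurable_continuous_onI mV, of "\<lambda>p. (t - fst p, snd p)"]
      measurable_compose[OF borel_measurable_continuous_onI mW, of "\<lambda>p. (t - fst p, snd p)"]
    by (simp_all add: continuous_intros)
  have mVx [measurable]: "(\<lambda>t. V (t - s) x) \<in> borel_measurable borel"
    "(\<lambda>t. W (t - s) x) \<in> borel_measurable borel" for s x
    using measurable_compose[OF borel_measurable_continuous_onI mV, of "\<lambda>t. (t - s, x)"]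
      measurable_compose[OF borel_measurable_continuous_onI mW, of "\<lambda>t. (t - s, x)"]
    by (simp_all add: continuous_intros)
  have mV3 [measurable]: "(\<lambda>q :: real \<times> real \<times> 'a. V (fst q - fst (snd q)) (snd (snd q))) \<in> borel_measurable borel"
    "(\<lambda>q :: real \<times> real \<times> 'a. W (fst q - fst (snd q)) (snd (snd q))) \<in> borel_measurable borel"
    using measurable_compose[OF borel_measurable_continuous_onI mV, of "\<lambda>q :: real \<times> real \<times> 'a. (fst q - fst (snd q), snd (snd q))"]
      measurable_compose[OF borel_measurable_continuous_onI mW, of "\<lambda>q :: real \<times> real \<times> 'a. (fst q - fst (snd q), snd (snd q))"]
    by (simp_all add: continuous_intros)
  have mN3 [measurable]: "(\<lambda>q :: real \<times> real \<times> 'a. N (fst (snd q)) (snd (snd q))) \<in> borel_measurable borel"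
    using measurable_compose[OF borel_measurable_continuous_onI mN, of "\<lambda>q :: real \<times> real \<times> 'a. (fst (snd q), snd (snd q))"]
    by (simp add: continuous_intros)
  have mV2 [measurable]: "(\<lambda>p. V (fst p) (snd p)) \<in> borel_measurable borel" "(\<lambda>p. W (fst p) (snd p)) \<in> borel_measurable borel"
    by fact+
  have mfs [measurable]: "(fst :: real \<times> 'c::euclidean_space \<Rightarrow> real) \<in> borel_measurable borel"
    "(snd :: real \<times> 'c::euclidean_space \<Rightarrow> 'c) \<in> borel_measurable borel"
    by (intro borel_measurable_continuous_onI continuous_intros)+
  have mfs3 [measurable]: "(\<lambda>q :: real \<times> real \<times> 'a. fst (snd q)) \<in> borel_measurable borel"
    by (intro borel_measurable_continuous_onI continuous_intros)
  have K_bound: "cmod (K t s x) \<le> 2 * E * h x" if "0 \<le> s" "s \<le> t" "t \<le> \<tau>" for t s x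
  proof -
    have "cmod (K t s x) \<le> \<bar>\<eta>' t\<bar> * cmod (V (t - s) x) + \<bar>\<eta> t\<bar> * cmod (W (t - s) x)"
      unfolding K_def by (rule order_trans[OF norm_triangle_ineq]) (simp add: norm_mult)
    also have "\<dots> \<le> E * h x + E * h x"
      using that E0 by (intro add_mono mult_mono E Vh Wh) auto
    finally show ?thesis by simp
  qed
  \<comment> \<open>The boundary term at \<open>\<tau>\<close> vanishes with
    \<open>\<eta> \<tau>\<close>, and only the one at \<open>t = s\<close> is left. The case
    \<open>s = 0\<close> produces the data term, general \<open>s\<close> the nonlinear
    term.\<close>
  have K_int: "(\<integral>t. indicator {s..\<tau>} t *\<^sub>R K t s x \<partial>lborel) = - (\<eta> s * V 0 x)" if s: "0 \<le> s" "s \<le> \<tau>" for s x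
  proof -
    have "((\<lambda>t. K t s x) has_integral (of_real (\<eta> \<tau>) * V (\<tau> - s) x - of_real (\<eta> s) * V (s - s) x)) {s..\<tau>}"
    proof (rule fundamental_theorem_of_calculus)
      fix t assume t: "t \<in> {s..\<tau>}"
      have "((\<lambda>t. V (t - s) x) has_vector_derivative 1 *\<^sub>R (\<i> * W (t - s) x)) (at t)"
      proof -
        have "((\<lambda>t. t - s) has_vector_derivative 1) (at t)"
          by (auto intro!: derivative_eq_intros)
        from vector_diff_chain_at[OF this V'] show ?thesis
          by (simp add: comp_def)
      qed
      moreover have "((\<lambda>t. complex_of_real (\<eta> t)) has_vector_derivative complex_of_real (\<eta>' t)) (at t)"
        using \<eta>'[of t] t s by (intro has_vector_derivative_of_real) auto
      ultimately have "((\<lambda>t. complex_of_real (\<eta> t) * V (t - s) x) has_vector_derivative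
          complex_of_real (\<eta> t) * (1 *\<^sub>R (\<i> * W (t - s) x)) + complex_of_real (\<eta>' t) * V (t - s) x) (at t)"
        by (rule has_vector_derivative_mult[rotated])
      also have "complex_of_real (\<eta> t) * (1 *\<^sub>R (\<i> * W (t - s) x)) + complex_of_real (\<eta>' t) * V (t - s) x = K t s x"
        by (simp add: K_def)
      finally show "((\<lambda>t. complex_of_real (\<eta> t) * V (t - s) x) has_vector_derivative K t s x) (at t within {s..\<tau>})"
        by (rule has_vector_derivative_at_within)
    qed (use s in auto)
    then have 1: "integral {s..\<tau>} (\<lambda>t. K t s x) = - (\<eta> s * V 0 x)"
      using \<eta>\<tau> by (simp add: integral_unique)
    have "set_integrable lborel {s..\<tau>} (\<lambda>t. K t s x)"
      unfolding set_integrable_def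
    proof (rule Bochner_Integration.integrable_bound)
      show "integrable lborel (\<lambda>t. indicator {s..\<tau>} t * (2 * E * h x))"
        by (intro integrable_mult_left integrable_real_indicator) (auto simp: emeasure_lborel_Icc_eq)
      show "(\<lambda>t. indicator {s..\<tau>} t *\<^sub>R K t s x) \<in> borel_measurable lborel"
        unfolding K_def by measurable
      show "AE t in lborel. norm (indicator {s..\<tau>} t *\<^sub>R K t s x) \<le> norm (indicator {s..\<tau>} t * (2 * E * h x))"
        using K_bound[of s _ x] s h0 E0 by (intro AE_I2) (auto simp: indicator_def abs_mult)
    qed
    then show ?thesis
      using set_borel_integral_eq_integral(2)[of "{s..\<tau>}" "\<lambda>t. K t s x"] 1
      by (simp add: set_lebesgue_integral_def)
  qed
  let ?I = "indicator {0..\<tau>} :: real \<Rightarrow> real"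
  have iI: "integrable lborel ?I"
    by (intro integrable_real_indicator) (auto simp: emeasure_lborel_Icc_eq)
  define F1 where "F1 t x = ?I t *\<^sub>R (g x * K t 0 x)" for t x
  have F1: "integrable lborel (\<lambda>p. F1 (fst p) (snd p))"
  proof (rule Bochner_Integration.integrable_bound[OF integrable_fst_times[OF iI integrable_mult_right[OF ig, of "2 * E"]]])
    show "(\<lambda>p. F1 (fst p) (snd p)) \<in> borel_measurable lborel"
      unfolding F1_def K_def by simp
    show "AE p in lborel. norm (F1 (fst p) (snd p)) \<le> norm (?I (fst p) * (2 * E * (cmod (g (snd p)) * h (snd p))))"
    proof (intro AE_I2)
      fix p :: "real \<times> 'a"
      show "norm (F1 (fst p) (snd p)) \<le> norm (?I (fst p) * (2 * E * (cmod (g (snd p)) * h (snd p))))"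
        using mult_left_mono[OF K_bound[of 0 "fst p" "snd p"], of "cmod (g (snd p))"] E0 h0
        by (auto simp: F1_def indicator_def norm_mult abs_mult mult_ac)
    qed
  qed
  have F1_int: "(\<integral>p. F1 (fst p) (snd p) \<partial>lborel) = - \<eta> 0 * (\<integral>x. g x * V 0 x \<partial>lborel)"
  proof -
    have "(\<integral>t. F1 t x \<partial>lborel) = - \<eta> 0 * (g x * V 0 x)" for x
    proof -
      have "(\<integral>t. F1 t x \<partial>lborel) = (\<integral>t. g x * (?I t *\<^sub>R K t 0 x) \<partial>lborel)"
        by (simp add: F1_def)
      also have "\<dots> = g x * - (\<eta> 0 * V 0 x)"
        using K_int[of 0 x] \<tau> by (simp only: integral_mult_right_zero order_refl simp_thms)
      finally show ?thesis by simp
    qed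
    then show ?thesis
      by (simp add: fubini_lborel(2)[OF F1])
  qed
  \<comment> \<open>The indicators cut out the triangle
    \<open>0 \<le> s \<le> t \<le> \<tau>\<close> of the Duhamel integral, with
    \<open>p = (s, x)\<close>. Keeping \<open>t\<close> as a separate first variable allows it to be
    integrated first, by \<open>K_int\<close>.\<close>
  define F2 where "F2 t p = (indicator {0..\<tau>} (fst p) * indicator {fst p..\<tau>} t :: real) *\<^sub>R
      (N (fst p) (snd p) * K t (fst p) (snd p))" for t p
  have F2: "integrable lborel (\<lambda>q. F2 (fst q) (snd q))"
  proof (rule Bochner_Integration.integrable_bound[OF integrable_fst_times[OF iI integrable_mult_right[OF iN, of "2 * E"]]])
    have "(\<lambda>q :: real \<times> real \<times> 'a. indicator {0..\<tau>} (fst (snd q)) * indicator {fst (snd q)..\<tau>} (fst q) :: real) =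
       (\<lambda>q. if 0 \<le> fst (snd q) \<and> fst (snd q) \<le> fst q \<and> fst q \<le> \<tau> then 1 else 0)"
      by (auto simp: indicator_def)
    then have "(\<lambda>q :: real \<times> real \<times> 'a. indicator {0..\<tau>} (fst (snd q)) * indicator {fst (snd q)..\<tau>} (fst q) :: real) \<in> borel_measurable borel"
      by simp
    then show "(\<lambda>q. F2 (fst q) (snd q)) \<in> borel_measurable lborel"
      unfolding F2_def K_def by simp
    show "AE q in lborel. norm (F2 (fst q) (snd q)) \<le> norm (?I (fst q) *
        (2 * E * (?I (fst (snd q)) * (cmod (N (fst (snd q)) (snd (snd q))) * h (snd (snd q))))))"
    proof (intro AE_I2)
      fix q :: "real \<times> real \<times> 'a"
      show "norm (F2 (fst q) (snd q)) \<le> norm (?I (fst q) *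
        (2 * E * (?I (fst (snd q)) * (cmod (N (fst (snd q)) (snd (snd q))) * h (snd (snd q))))))"
        using mult_left_mono[OF K_bound[of "fst (snd q)" "fst q" "snd (snd q)"], of "cmod (N (fst (snd q)) (snd (snd q)))"] E0 h0
        by (auto simp: F2_def indicator_def norm_mult abs_mult mult_ac)
    qed
  qed
  have F2_int: "(\<integral>q. F2 (fst q) (snd q) \<partial>lborel) =
      - (\<integral>p. ?I (fst p) *\<^sub>R (\<eta> (fst p) * (N (fst p) (snd p) * V 0 (snd p))) \<partial>lborel)"
  proof -
    have "(\<integral>t. F2 t p \<partial>lborel) = - (?I (fst p) *\<^sub>R (\<eta> (fst p) * (N (fst p) (snd p) * V 0 (snd p))))" for p
    proof (cases "fst p \<in> {0..\<tau>}")
      case True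
      have "(\<integral>t. F2 t p \<partial>lborel) = (\<integral>t. N (fst p) (snd p) * (indicator {fst p..\<tau>} t *\<^sub>R K t (fst p) (snd p)) \<partial>lborel)"
        using True by (simp add: F2_def)
      also have "\<dots> = N (fst p) (snd p) * - (\<eta> (fst p) * V 0 (snd p))"
        using K_int[of "fst p" "snd p"] True by (simp only: integral_mult_right_zero atLeastAtMost_iff)
      finally show ?thesis using True by simp
    qed (simp add: F2_def)
    then show ?thesis
      by (simp add: fubini_lborel(2)[OF F2])
  qed
  define L where "L t x = u t x * (\<eta>' t * V 0 x + \<i> * \<eta> t * W 0 x)" for t x
  have L: "integrable lborel (\<lambda>p. ?I (fst p) *\<^sub>R L (fst p) (snd p))"
  proof (rule Bochner_Integration.integrable_bound[OF integrable_mult_right[OF iu, of "2 * E"]])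
    show "(\<lambda>p. ?I (fst p) *\<^sub>R L (fst p) (snd p)) \<in> borel_measurable lborel"
      unfolding L_def by simp
    show "AE p in lborel. norm (?I (fst p) *\<^sub>R L (fst p) (snd p)) \<le>
        norm (2 * E * (?I (fst p) * (cmod (u (fst p) (snd p)) * h (snd p))))"
    proof (intro AE_I2)
      fix p :: "real \<times> 'a"
      have "cmod (\<eta>' (fst p) * V 0 (snd p) + \<i> * \<eta> (fst p) * W 0 (snd p)) \<le> 2 * E * h (snd p)"
        if "fst p \<in> {0..\<tau>}"
      proof -
        have "cmod (\<eta>' (fst p) * V 0 (snd p) + \<i> * \<eta> (fst p) * W 0 (snd p)) \<le>
            \<bar>\<eta>' (fst p)\<bar> * cmod (V 0 (snd p)) + \<bar>\<eta> (fst p)\<bar> * cmod (W 0 (snd p))"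
          by (rule order_trans[OF norm_triangle_ineq]) (simp add: norm_mult)
        also have "\<dots> \<le> E * h (snd p) + E * h (snd p)"
          using that E0 \<tau> by (intro add_mono mult_mono E Vh Wh) auto
        finally show ?thesis by simp
      qed
      from mult_left_mono[OF this, of "cmod (u (fst p) (snd p))"]
      show "norm (?I (fst p) *\<^sub>R L (fst p) (snd p)) \<le>
        norm (2 * E * (?I (fst p) * (cmod (u (fst p) (snd p)) * h (snd p))))"
        using E0 h0 by (auto simp: L_def indicator_def norm_mult abs_mult mult_ac)
    qed
  qed
  have iuc: "integrable lborel (\<lambda>p. ?I (fst p) *\<^sub>R (u (fst p) (snd p) * complex_of_real (h (snd p))))"
    by (rule Bochner_Integration.integrable_bound[OF iu]) (auto simp: norm_mult h0 abs_mult intro!: AE_I2)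
  \<comment> \<open>\<open>\<eta>' t\<close> times the formula for \<open>V\<close> plus
    \<open>\<i> * \<eta> t\<close> times the one for \<open>W\<close> assembles \<open>K\<close> on
    the right. The premise stays explicit because Fubini provides integrability of
    \<open>u t\<close> against \<open>h\<close> for almost every \<open>t\<close> only.\<close>
  have L_eq: "(\<integral>x. ?I t *\<^sub>R L t x \<partial>lborel) = (\<integral>x. F1 t x \<partial>lborel) - \<i> * lam * (\<integral>p. F2 t p \<partial>lborel)"
    if int: "integrable lborel (\<lambda>x. ?I t *\<^sub>R (u t x * complex_of_real (h x)))" for t
  proof (cases "t \<in> {0..\<tau>}")
    case False
    then have "F2 t p = 0" for p
      by (auto simp: F2_def indicator_def)
    with False show ?thesis
      by (simp add: F1_def)
  next
    case t: True
    have mut: "u t \<in> borel_measurable borel"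
      using measurable_compose[OF borel_measurable_continuous_onI mu, of "\<lambda>x. (t, x)"] by (simp add: continuous_intros)
    have iut: "integrable lborel (\<lambda>x. u t x * V 0 x)" "integrable lborel (\<lambda>x. u t x * W 0 x)"
      using t \<tau> int Vh[of 0] Wh[of 0] h0 mut
      by (auto intro!: Bochner_Integration.integrable_bound[of lborel "\<lambda>x. u t x * complex_of_real (h x)"] mult_left_mono AE_I2 simp: norm_mult)
    have igt: "integrable lborel (\<lambda>x. g x * V t x)" "integrable lborel (\<lambda>x. g x * W t x)"
      using t Vh[of t] Wh[of t] h0
      by (auto intro!: Bochner_Integration.integrable_bound[OF ig] mult_left_mono AE_I2 simp: norm_mult)
    have N_bound: "integrable lborel (\<lambda>p. indicator {0..t} (fst p) *\<^sub>R (N (fst p) (snd p) * Z (t - fst p) (snd p)))"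
      if "(\<lambda>p. Z (t - fst p) (snd p)) \<in> borel_measurable borel" "\<And>t x. t \<in> {0..\<tau>} \<Longrightarrow> cmod (Z t x) \<le> h x"
      for Z :: "real \<Rightarrow> 'a \<Rightarrow> complex"
    proof (rule Bochner_Integration.integrable_bound[OF iN])
      show "(\<lambda>p. indicator {0..t} (fst p) *\<^sub>R (N (fst p) (snd p) * Z (t - fst p) (snd p))) \<in> borel_measurable lborel"
        using that(1) by simp
      show "AE p in lborel. norm (indicator {0..t} (fst p) *\<^sub>R (N (fst p) (snd p) * Z (t - fst p) (snd p)))
          \<le> norm (?I (fst p) * (cmod (N (fst p) (snd p)) * h (snd p)))"
        using that(2) t h0 by (intro AE_I2) (auto simp: indicator_def norm_mult abs_mult intro!: mult_left_mono)
    qed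
    have iNt: "integrable lborel (\<lambda>p. indicator {0..t} (fst p) *\<^sub>R (N (fst p) (snd p) * V (t - fst p) (snd p)))"
      "integrable lborel (\<lambda>p. indicator {0..t} (fst p) *\<^sub>R (N (fst p) (snd p) * W (t - fst p) (snd p)))"
      by (rule N_bound mVs Vh Wh, assumption?)+
    have N_eq: "(LBINT s:{0..t}. \<integral>x. N s x * Z (t - s) x \<partial>lborel) =
        (\<integral>p. indicator {0..t} (fst p) *\<^sub>R (N (fst p) (snd p) * Z (t - fst p) (snd p)) \<partial>lborel)"
      if "integrable lborel (\<lambda>p. indicator {0..t} (fst p) *\<^sub>R (N (fst p) (snd p) * Z (t - fst p) (snd p)))"
      for Z :: "real \<Rightarrow> 'a \<Rightarrow> complex"
      using fubini_lborel(1)[OF that] by (simp add: set_lebesgue_integral_def)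
    have duhV': "(\<integral>x. u t x * V 0 x \<partial>lborel) = (\<integral>x. g x * V t x \<partial>lborel) - \<i> * lam *
        (\<integral>p. indicator {0..t} (fst p) *\<^sub>R (N (fst p) (snd p) * V (t - fst p) (snd p)) \<partial>lborel)"
      by (rule duhV[OF t, unfolded N_eq[of V, OF iNt(1)]])
    have duhW': "(\<integral>x. u t x * W 0 x \<partial>lborel) = (\<integral>x. g x * W t x \<partial>lborel) - \<i> * lam *
        (\<integral>p. indicator {0..t} (fst p) *\<^sub>R (N (fst p) (snd p) * W (t - fst p) (snd p)) \<partial>lborel)"
      by (rule duhW[OF t, unfolded N_eq[of W, OF iNt(2)]])
    have "(\<integral>x. ?I t *\<^sub>R L t x \<partial>lborel) = (\<integral>x. \<eta>' t * (u t x * V 0 x) + \<i> * \<eta> t * (u t x * W 0 x) \<partial>lborel)"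
      using t by (simp add: L_def algebra_simps)
    also have "\<dots> = \<eta>' t * (\<integral>x. u t x * V 0 x \<partial>lborel) + \<i> * \<eta> t * (\<integral>x. u t x * W 0 x \<partial>lborel)"
      by (subst Bochner_Integration.integral_add) (auto intro!: iut simp only: integrable_mult_right integral_mult_right_zero)
    also have "\<dots> = (\<eta>' t * (\<integral>x. g x * V t x \<partial>lborel) + \<i> * \<eta> t * (\<integral>x. g x * W t x \<partial>lborel)) -
        \<i> * lam * (\<eta>' t * (\<integral>p. indicator {0..t} (fst p) *\<^sub>R (N (fst p) (snd p) * V (t - fst p) (snd p)) \<partial>lborel) +
          \<i> * \<eta> t * (\<integral>p. indicator {0..t} (fst p) *\<^sub>R (N (fst p) (snd p) * W (t - fst p) (snd p)) \<partial>lborel))"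
      unfolding duhV' duhW' by (simp only: algebra_simps)
    also have "\<eta>' t * (\<integral>x. g x * V t x \<partial>lborel) + \<i> * \<eta> t * (\<integral>x. g x * W t x \<partial>lborel) =
        (\<integral>x. \<eta>' t * (g x * V t x) + \<i> * \<eta> t * (g x * W t x) \<partial>lborel)"
      by (subst Bochner_Integration.integral_add) (auto intro!: igt simp only: integrable_mult_right integral_mult_right_zero)
    also have "\<dots> = (\<integral>x. F1 t x \<partial>lborel)"
      using t by (intro Bochner_Integration.integral_cong) (auto simp: F1_def K_def algebra_simps)
    also have "\<eta>' t * (\<integral>p. indicator {0..t} (fst p) *\<^sub>R (N (fst p) (snd p) * V (t - fst p) (snd p)) \<partial>lborel) +
          \<i> * \<eta> t * (\<integral>p. indicator {0..t} (fst p) *\<^sub>R (N (fst p) (snd p) * W (t - fst p) (snd p)) \<partial>lborel) =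
        (\<integral>p. \<eta>' t * (indicator {0..t} (fst p) *\<^sub>R (N (fst p) (snd p) * V (t - fst p) (snd p))) +
          \<i> * \<eta> t * (indicator {0..t} (fst p) *\<^sub>R (N (fst p) (snd p) * W (t - fst p) (snd p))) \<partial>lborel)"
      by (subst Bochner_Integration.integral_add) (auto intro!: iNt simp only: integrable_mult_right integral_mult_right_zero)
    also have "\<dots> = (\<integral>p. F2 t p \<partial>lborel)"
      using t by (intro Bochner_Integration.integral_cong) (auto simp: F2_def K_def indicator_def algebra_simps)
    finally show ?thesis .
  qed
  have "(\<integral>p. ?I (fst p) *\<^sub>R L (fst p) (snd p) \<partial>lborel) = (\<integral>t. \<integral>x. ?I t *\<^sub>R L t x \<partial>lborel \<partial>lborel)"
    by (rule fubini_lborel(1)[OF L])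
  also have "\<dots> = (\<integral>t. (\<integral>x. F1 t x \<partial>lborel) - \<i> * lam * (\<integral>p. F2 t p \<partial>lborel) \<partial>lborel)"
  proof (rule integral_cong_AE)
    show "(\<lambda>t. \<integral>x. ?I t *\<^sub>R L t x \<partial>lborel) \<in> borel_measurable lborel"
      by (rule borel_measurable_integrable[OF fubini_lborel(4)[OF L]])
    show "(\<lambda>t. (\<integral>x. F1 t x \<partial>lborel) - \<i> * lam * (\<integral>p. F2 t p \<partial>lborel)) \<in> borel_measurable lborel"
      using borel_measurable_integrable[OF fubini_lborel(4)[OF F1]]
        borel_measurable_integrable[OF fubini_lborel(4)[OF F2]] by measurable
    show "AE t in lborel. (\<integral>x. ?I t *\<^sub>R L t x \<partial>lborel) = (\<integral>x. F1 t x \<partial>lborel) - \<i> * lam * (\<integral>p. F2 t p \<partial>lborel)"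
      using fubini_lborel(3)[OF iuc] by eventually_elim (rule L_eq)
  qed
  also have "\<dots> = (\<integral>t. \<integral>x. F1 t x \<partial>lborel \<partial>lborel) - \<i> * lam * (\<integral>t. \<integral>p. F2 t p \<partial>lborel \<partial>lborel)"
    using fubini_lborel(4)[OF F1] fubini_lborel(4)[OF F2] by simp
  also have "\<dots> = (\<integral>p. F1 (fst p) (snd p) \<partial>lborel) - \<i> * lam * (\<integral>q. F2 (fst q) (snd q) \<partial>lborel)"
    unfolding fubini_lborel(1)[OF F1] fubini_lborel(1)[OF F2] ..
  finally show ?th1
    unfolding F1_int F2_int L_def by simp
  show ?th2
    using L unfolding L_def .
  show ?th3
  proof (rule Bochner_Integration.integrable_bound[OF integrable_mult_right[OF iN, of E]])
    show "(\<lambda>p. ?I (fst p) *\<^sub>R (\<eta> (fst p) * (N (fst p) (snd p) * V 0 (snd p)))) \<in> borel_measurable lborel"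
      by simp
    show "AE p in lborel. norm (?I (fst p) *\<^sub>R (\<eta> (fst p) * (N (fst p) (snd p) * V 0 (snd p)))) \<le>
        norm (E * (?I (fst p) * (cmod (N (fst p) (snd p)) * h (snd p))))"
    proof (intro AE_I2)
      fix p :: "real \<times> 'a"
      have "\<bar>\<eta> (fst p)\<bar> * (cmod (N (fst p) (snd p)) * cmod (V 0 (snd p))) \<le> E * (cmod (N (fst p) (snd p)) * h (snd p))"
        if "fst p \<in> {0..\<tau>}"
        using that E0 h0 \<tau> by (intro mult_mono mult_left_mono E Vh) auto
      then show "norm (?I (fst p) *\<^sub>R (\<eta> (fst p) * (N (fst p) (snd p) * V 0 (snd p)))) \<le>
        norm (E * (?I (fst p) * (cmod (N (fst p) (snd p)) * h (snd p))))"
        using E0 h0 by (auto simp: indicator_def norm_mult abs_mult)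
    qed
  qed
qed

subsection \<open>The weak form for solutions and Gaussians\<close>

text \<open>The exponent equals \<open>4 * (p + 1) / (n * (p - 1))\<close>, and subcriticality is
  \<open>n * (p - 1) < 2\<close>. Since the time exponent is at least the space exponent, the mixed
  norm on a bounded interval controls the plain space-time norm of order
  \<open>p + 1\<close>.\<close>

lemma adm_exponent_ge:
  assumes "1 < p" "p < 1 + 2 / real n" "n > 0"
  shows "p + 1 \<le> adm_exponent n (p + 1)"
proof -
  have n: "real n * (p - 1) < 2"
    using assms by (simp add: field_simps)
  have "real n / 2 - real n / (p + 1) = real n * (p - 1) / (2 * (p + 1))"
    using assms by (simp add: field_simps)
  then have eq: "adm_exponent n (p + 1) = 4 * (p + 1) / (real n * (p - 1))"
    by (simp add: adm_exponent_def)
  have "(p + 1) * (real n * (p - 1)) \<le> (p + 1) * 4"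
    using n assms by (intro mult_left_mono) auto
  then show ?thesis
    unfolding eq using assms by (simp add: le_divide_eq mult.commute)
qed

text \<open>Stands in for Hoelder's inequality: once in time, to lower the admissible exponent to
  \<open>p + 1\<close>, and once on the space-time strip, to lower \<open>p + 1\<close> to
  \<open>p\<close> and to 1.\<close>

lemma powr_le_one_plus_powr:
  fixes y :: real
  assumes "0 \<le> y" "0 \<le> q" "q \<le> r"
  shows "y powr q \<le> 1 + y powr r"
proof (cases "y \<le> 1")
  case True
  then have "y powr q \<le> 1 powr q"
    using assms by (intro powr_mono2) auto
  then show ?thesis
    by (simp add: add_increasing2)
next
  case False
  then have "y powr q \<le> y powr r"
    using assms by (intro powr_mono) auto
  then show ?thesis by simp
qed

section \<open>Integrability of a solution on a bounded time strip\<close>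

lemma Lp_norm_powr: "q > 0 \<Longrightarrow> Lp_norm q g powr q = (\<integral>x. cmod (g x) powr q \<partial>lborel)"
  by (simp add: Lp_norm_def powr_powr)

text \<open>A solution is Borel only on \<open>time_ivl T \<times> UNIV\<close>. Cutting at
  \<open>\<tau>\<close> gives a function that is Borel on the whole space-time and unchanged at the
  times where the Duhamel formula is used.\<close>

definition strip_cut :: "real \<Rightarrow> (real \<Rightarrow> 'a \<Rightarrow> complex) \<Rightarrow> real \<Rightarrow> 'a \<Rightarrow> complex" where
  "strip_cut \<tau> u t x = indicator {0..\<tau>} t *\<^sub>R u t x"

lemma strip_cut_eq: "t \<in> {0..\<tau>} \<Longrightarrow> strip_cut \<tau> u t x = u t x"
  by (simp add: strip_cut_def)

lemma
  fixes u :: "real \<Rightarrow> real ^ 'n \<Rightarrow> complex"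
  assumes u: "in_LrLq r \<rho> T u" and \<rho>: "0 < \<rho>" "\<rho> \<le> r" and \<tau>: "ennreal \<tau> < T"
  shows measurable_strip_cut: "(\<lambda>p. strip_cut \<tau> u (fst p) (snd p)) \<in> borel_measurable borel"
    and integrable_strip_cut: "integrable lborel (\<lambda>p. cmod (strip_cut \<tau> u (fst p) (snd p)) powr \<rho>)"
proof -
  have sub: "{0..\<tau>} \<subseteq> time_ivl T"
    using \<tau> by (auto simp: time_ivl_def intro: le_less_trans[OF ennreal_leI])
  have mfst [measurable]: "(fst :: real \<times> (real ^ 'n) \<Rightarrow> real) \<in> borel_measurable borel"
    by (intro borel_measurable_continuous_onI continuous_intros)
  have "(\<lambda>p. indicator (time_ivl T \<times> UNIV) p *\<^sub>R (case p of (t, x) \<Rightarrow> u t x)) \<in> borel_measurable borel"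
    using u unfolding in_LrLq_def set_borel_measurable_def by blast
  then have "(\<lambda>p. indicator {0..\<tau>} (fst p) *\<^sub>R (indicator (time_ivl T \<times> UNIV) p *\<^sub>R (case p of (t, x) \<Rightarrow> u t x)))
      \<in> borel_measurable borel"
    by measurable
  also have "(\<lambda>p. indicator {0..\<tau>} (fst p) *\<^sub>R (indicator (time_ivl T \<times> UNIV) p *\<^sub>R (case p of (t, x) \<Rightarrow> u t x))) =
      (\<lambda>p. strip_cut \<tau> u (fst p) (snd p))"
    using sub by (auto simp: fun_eq_iff strip_cut_def indicator_def)
  finally show m: "(\<lambda>p. strip_cut \<tau> u (fst p) (snd p)) \<in> borel_measurable borel" .
  let ?f = "\<lambda>p. cmod (strip_cut \<tau> u (fst p) (snd p)) powr \<rho>"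
  have mf: "?f \<in> borel_measurable (lborel \<Otimes>\<^sub>M lborel)"
    using m by (simp add: lborel_prod)
  have eq: "(\<integral>x. ?f (t, x) \<partial>lborel) = indicator {0..\<tau>} t * Lp_norm \<rho> (u t) powr \<rho>" for t
    using \<rho> by (cases "t \<in> {0..\<tau>}") (auto simp: strip_cut_def Lp_norm_powr)
  have AE_in: "AE t in lborel. t \<in> {0..\<tau>} \<longrightarrow> in_Lp \<rho> (u t)"
  proof -
    have "AE t in lborel. t \<in> time_ivl T \<longrightarrow> in_Lp \<rho> (u t)"
      using u unfolding in_LrLq_def by blast
    then show ?thesis
      by eventually_elim (use sub in blast)
  qed
  have "integrable (lborel \<Otimes>\<^sub>M lborel) ?f"
  proof (rule lborel_pair.Fubini_integrable[OF mf])
    have "set_integrable lborel (time_ivl T) (\<lambda>t. Lp_norm \<rho> (u t) powr r)"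
      using u unfolding in_LrLq_def by blast
    then have "set_integrable lborel {0..\<tau>} (\<lambda>t. Lp_norm \<rho> (u t) powr r)"
      by (rule set_integrable_subset[OF _ _ sub]) simp
    moreover have "set_integrable lborel {0..\<tau>} (\<lambda>t. 1 :: real)"
      unfolding set_integrable_def by (simp add: integrable_real_indicator emeasure_lborel_Icc_eq)
    ultimately have int: "integrable lborel (\<lambda>t. indicator {0..\<tau>} t *\<^sub>R (1 + Lp_norm \<rho> (u t) powr r))"
      by (intro set_integral_add(1)[unfolded set_integrable_def]) (simp_all add: set_integrable_def)
    show "integrable lborel (\<lambda>t. \<integral>x. norm (?f (t, x)) \<partial>lborel)"
    proof (rule Bochner_Integration.integrable_bound[OF int])
      show "(\<lambda>t. \<integral>x. norm (?f (t, x)) \<partial>lborel) \<in> borel_measurable lborel"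
        using mf by (intro lborel.borel_measurable_lebesgue_integral) (simp add: split_beta)
      show "AE t in lborel. norm (\<integral>x. norm (?f (t, x)) \<partial>lborel) \<le> norm (indicator {0..\<tau>} t *\<^sub>R (1 + Lp_norm \<rho> (u t) powr r))"
        using powr_le_one_plus_powr[of "Lp_norm \<rho> (u _)" \<rho> r] \<rho>
        by (intro AE_I2) (auto simp: eq[simplified] indicator_def Lp_norm_def)
    qed
    show "AE t in lborel. integrable lborel (\<lambda>x. ?f (t, x))"
      using AE_in
    proof eventually_elim
      case (elim t)
      then show ?case
        by (cases "t \<in> {0..\<tau>}") (auto simp: strip_cut_def in_Lp_def)
    qed
  qed
  then show "integrable lborel ?f"
    by (simp add: lborel_prod)
qed

text \<open>\<open>|v|\<close> to the power \<open>q\<close> is at most 1 plus its power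
  \<open>\<rho>\<close>. The 1 is paid for by the integrability of \<open>h\<close> and the finite
  length of the strip, the other term by the bound \<open>M\<close> on \<open>h\<close>.\<close>

lemma integrable_strip_weighted:
  fixes v :: "real \<times> 'a::euclidean_space \<Rightarrow> complex" and h :: "'a \<Rightarrow> real"
  assumes mv: "v \<in> borel_measurable borel" and iv: "integrable lborel (\<lambda>p. cmod (v p) powr \<rho>)"
    and q: "0 \<le> q" "q \<le> \<rho>" and h: "integrable lborel h" "\<And>x. 0 \<le> h x" "\<And>x. h x \<le> M"
  shows "integrable lborel (\<lambda>p. indicator {0..\<tau>} (fst p) * (cmod (v p) powr q * h (snd p)))"
proof (rule Bochner_Integration.integrable_bound)
  have I: "integrable lborel (indicator {0..\<tau>} :: real \<Rightarrow> real)"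
    by (intro integrable_real_indicator) (auto simp: emeasure_lborel_Icc_eq)
  show "integrable lborel (\<lambda>p. indicator {0..\<tau>} (fst p) * h (snd p) + M * cmod (v p) powr \<rho>)"
    by (intro Bochner_Integration.integrable_add integrable_fst_times I h integrable_mult_right iv)
  have [measurable]: "h \<in> borel_measurable borel"
    using borel_measurable_integrable[OF h(1)] by simp
  have mfs [measurable]: "(fst :: real \<times> 'a \<Rightarrow> real) \<in> borel_measurable borel"
    "(snd :: real \<times> 'a \<Rightarrow> 'a) \<in> borel_measurable borel"
    by (intro borel_measurable_continuous_onI continuous_intros)+
  show "(\<lambda>p. indicator {0..\<tau>} (fst p) * (cmod (v p) powr q * h (snd p))) \<in> borel_measurable lborel"
    using mv by simp
  show "AE p in lborel. norm (indicator {0..\<tau>} (fst p) * (cmod (v p) powr q * h (snd p))) \<le>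
      norm (indicator {0..\<tau>} (fst p) * h (snd p) + M * cmod (v p) powr \<rho>)"
  proof (intro AE_I2)
    fix p :: "real \<times> 'a"
    have M: "0 \<le> M" using order_trans[OF h(2,3)] .
    have "cmod (v p) powr q * h (snd p) \<le> (1 + cmod (v p) powr \<rho>) * h (snd p)"
      using q h(2) by (intro mult_right_mono powr_le_one_plus_powr) auto
    also have "\<dots> \<le> h (snd p) + M * cmod (v p) powr \<rho>"
      using mult_left_mono[OF h(3)[of "snd p"], of "cmod (v p) powr \<rho>"] by (simp add: algebra_simps)
    finally show "norm (indicator {0..\<tau>} (fst p) * (cmod (v p) powr q * h (snd p))) \<le>
      norm (indicator {0..\<tau>} (fst p) * h (snd p) + M * cmod (v p) powr \<rho>)"
      using h(2) M by (auto simp: indicator_def)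
  qed
qed

lemma measurable_poly_gauss: "real_polynomial_function p \<Longrightarrow> poly_gauss a p \<in> borel_measurable borel"
  unfolding poly_gauss_def[abs_def]
  by (intro borel_measurable_continuous_onI continuous_intros)
    (auto simp: real_polynomial_function_eq intro: continuous_on_polymonial_function)

lemma duhamel_weak_form_gauss:
  fixes u :: "real \<Rightarrow> real ^ 'n \<Rightarrow> complex" and g :: "real ^ 'n \<Rightarrow> complex"
    and \<eta> \<eta>' :: "real \<Rightarrow> real" and p a \<tau> E :: real and lam :: complex
  assumes p: "1 < p" "p < 1 + 2 / real CARD('n)" and a: "a > 0"
    and \<tau>: "0 \<le> \<tau>" "ennreal \<tau> < T" and sol: "L2_solution p lam g T u" and g: "in_Lp 2 g"
    and m\<eta>: "\<eta> \<in> borel_measurable borel" "\<eta>' \<in> borel_measurable borel"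
    and \<eta>': "\<And>t. t \<in> {0..\<tau>} \<Longrightarrow> (\<eta> has_real_derivative \<eta>' t) (at t)"
    and \<eta>\<tau>: "\<eta> \<tau> = 0"
    and E: "\<And>t. t \<in> {0..\<tau>} \<Longrightarrow> \<bar>\<eta> t\<bar> \<le> E" "\<And>t. t \<in> {0..\<tau>} \<Longrightarrow> \<bar>\<eta>' t\<bar> \<le> E"
  shows "(\<integral>q. indicator {0..\<tau>} (fst q) *\<^sub>R (strip_cut \<tau> u (fst q) (snd q) *
            (\<eta>' (fst q) * gauss a (snd q) + \<i> * \<eta> (fst q) * lap_gauss a (snd q))) \<partial>lborel) =
    - \<eta> 0 * (\<integral>x. g x * gauss a x \<partial>lborel) +
    \<i> * lam * (\<integral>q. indicator {0..\<tau>} (fst q) *\<^sub>R (\<eta> (fst q) *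
      (of_real (cmod (strip_cut \<tau> u (fst q) (snd q)) powr p) * gauss a (snd q))) \<partial>lborel)" (is ?th1)
    and "integrable lborel (\<lambda>q. indicator {0..\<tau>} (fst q) *\<^sub>R (strip_cut \<tau> u (fst q) (snd q) *
            (\<eta>' (fst q) * gauss a (snd q) + \<i> * \<eta> (fst q) * lap_gauss a (snd q))))" (is ?th2)
    and "integrable lborel (\<lambda>q. indicator {0..\<tau>} (fst q) *\<^sub>R (\<eta> (fst q) *
      (of_real (cmod (strip_cut \<tau> u (fst q) (snd q)) powr p) * gauss a (snd q))))" (is ?th3)
    and "integrable lborel (\<lambda>x. g x * gauss a x)" (is ?th4)
proof -
  define V where "V t x = schroedinger_schwartz t (gauss a) x" for t and x :: "real ^ 'n"
  define W where "W t x = schroedinger_schwartz t (lap_gauss a) x" for t and x :: "real ^ 'n"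
  define N where "N t x = complex_of_real (cmod (strip_cut \<tau> u t x) powr p)" for t x
  obtain h M where h: "integrable lborel h" "\<And>x. h x \<le> M"
    and VW: "\<And>t x. t \<in> {0..\<tau>} \<Longrightarrow> cmod (V t x) \<le> h x" "\<And>t x. t \<in> {0..\<tau>} \<Longrightarrow> cmod (W t x) \<le> h x"
    using schroedinger_gauss_bound[OF a, of \<tau>, where 'n='n] unfolding V_def W_def by blast
  have h0: "0 \<le> h x" for x
    using order_trans[OF norm_ge_zero VW(1)[of 0 x]] \<tau> by simp
  have V0: "V 0 x = gauss a x" for x
    unfolding V_def by (rule schroedinger_gauss_0[OF a])
  have W0: "W 0 x = lap_gauss a x" for x
  proof -
    have z: "Complex (1 / (4 * a)) 0 = complex_of_real (1 / (4 * a))"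
      by (simp add: complex_eq_iff)
    show ?thesis
      unfolding W_def schroedinger_lap_gauss[OF a] schroedinger_gauss_0[OF a] z
      using a by (simp add: gauss_def lap_gauss_def poly_gauss_def field_simps power2_eq_square)
  qed
  have lrlq: "in_LrLq (adm_exponent CARD('n) (p + 1)) (p + 1) T u"
    using sol by (simp add: L2_solution_def)
  have ge: "p + 1 \<le> adm_exponent CARD('n) (p + 1)"
    using p by (intro adm_exponent_ge) auto
  have mu: "(\<lambda>q. strip_cut \<tau> u (fst q) (snd q)) \<in> borel_measurable borel"
    using p ge \<tau> by (intro measurable_strip_cut[OF lrlq]) auto
  have iu: "integrable lborel (\<lambda>q. cmod (strip_cut \<tau> u (fst q) (snd q)) powr (p + 1))"
    using p ge \<tau> by (intro integrable_strip_cut[OF lrlq]) auto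
  have mg: "g \<in> borel_measurable borel" and g2: "integrable lborel (\<lambda>x. cmod (g x) powr 2)"
    using g by (simp_all add: in_Lp_def)
  have mh: "h \<in> borel_measurable borel"
    using borel_measurable_integrable[OF h(1)] by simp
  \<comment> \<open>\<open>h\<close> is bounded and integrable, hence square integrable, and
    \<open>g\<close> is in \<open>L\<^sup>2\<close>; the product is estimated by the elementary
    inequality \<open>2 * a * b \<le> a\<^sup>2 + b\<^sup>2\<close>.\<close>
  have ig: "integrable lborel (\<lambda>x. cmod (g x) * h x)"
  proof (rule Bochner_Integration.integrable_bound)
    show "integrable lborel (\<lambda>x. cmod (g x) powr 2 + M * h x)"
      using g2 h(1) by simp
    show "(\<lambda>x. cmod (g x) * h x) \<in> borel_measurable lborel"
      using mg mh by simp
    show "AE x in lborel. norm (cmod (g x) * h x) \<le> norm (cmod (g x) powr 2 + M * h x)"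
    proof (intro AE_I2)
      fix x
      have "2 * (cmod (g x) * h x) \<le> (cmod (g x))\<^sup>2 + (h x)\<^sup>2"
        using sum_squares_bound[of "cmod (g x)" "h x"] by (simp add: mult_ac)
      moreover have "(h x)\<^sup>2 \<le> M * h x"
        using h0 h(2) by (simp add: power2_eq_square mult_right_mono)
      moreover have "0 \<le> M * h x"
        using h0 order_trans[OF h0 h(2)] by simp
      moreover have "0 \<le> cmod (g x) * h x"
        using h0 by simp
      ultimately show "norm (cmod (g x) * h x) \<le> norm (cmod (g x) powr 2 + M * h x)"
        by (simp add: abs_of_nonneg)
    qed
  qed
  have duh: "(\<integral>x. strip_cut \<tau> u t x * \<phi> x \<partial>lborel) = (\<integral>x. g x * schroedinger_schwartz t \<phi> x \<partial>lborel) -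
        \<i> * lam * (LBINT s:{0..t}. \<integral>x. N s x * schroedinger_schwartz (t - s) \<phi> x \<partial>lborel)"
    if t: "t \<in> {0..\<tau>}" and \<phi>: "schwartz \<phi>" for t \<phi>
  proof -
    have "t \<in> time_ivl T"
      using t \<tau> by (auto simp: time_ivl_def intro: le_less_trans[OF ennreal_leI])
    then have "distr_of (u t) \<phi> = schroedinger t (distr_of g) \<phi> - \<i> * lam *
            (LBINT s:{0..t}. schroedinger (t - s) (distr_of (\<lambda>x. complex_of_real (cmod (u s x) powr p))) \<phi>)"
      using sol \<phi> unfolding L2_solution_def duhamel_eq_def by blast
    moreover have "(LBINT s:{0..t}. schroedinger (t - s) (distr_of (\<lambda>x. complex_of_real (cmod (u s x) powr p))) \<phi>) =
        (LBINT s:{0..t}. \<integral>x. N s x * schroedinger_schwartz (t - s) \<phi> x \<partial>lborel)"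
      using t by (intro set_lebesgue_integral_cong) (auto simp: N_def strip_cut_eq schroedinger_def distr_of_def)
    ultimately show ?thesis
      using t by (simp add: strip_cut_eq schroedinger_def distr_of_def)
  qed
  have mN: "(\<lambda>q. N (fst q) (snd q)) \<in> borel_measurable borel"
    unfolding N_def using mu by measurable
  have iu1: "integrable lborel (\<lambda>q. indicator {0..\<tau>} (fst q) * (cmod (strip_cut \<tau> u (fst q) (snd q)) * h (snd q)))"
    using integrable_strip_weighted[OF mu iu, of 1 h M \<tau>] p h h0 by simp
  have iN: "integrable lborel (\<lambda>q. indicator {0..\<tau>} (fst q) * (cmod (N (fst q) (snd q)) * h (snd q)))"
    using integrable_strip_weighted[OF mu iu, of p h M \<tau>] p h h0 by (simp add: N_def)
  have mV: "(\<lambda>q. V (fst q) (snd q)) \<in> borel_measurable borel"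
    using measurable_schroedinger_gauss[OF a, where 'n='n] by (simp add: V_def split_def borel_prod)
  have mW: "(\<lambda>q. W (fst q) (snd q)) \<in> borel_measurable borel"
    using measurable_schroedinger_lap_gauss[OF a, where 'n='n] by (simp add: W_def split_def borel_prod)
  have dV: "((\<lambda>t. V t x) has_vector_derivative \<i> * W t x) (at t)" for t x
    unfolding V_def W_def by (rule schroedinger_gauss_deriv[OF a])
  have duhV: "(\<integral>x. strip_cut \<tau> u t x * V 0 x \<partial>lborel) = (\<integral>x. g x * V t x \<partial>lborel) -
        \<i> * lam * (LBINT s:{0..t}. \<integral>x. N s x * V (t - s) x \<partial>lborel)" if "t \<in> {0..\<tau>}" for t
    using duh[OF that schwartz_gauss[OF a]] by (simp add: V0) (simp add: V_def)
  have duhW: "(\<integral>x. strip_cut \<tau> u t x * W 0 x \<partial>lborel) = (\<integral>x. g x * W t x \<partial>lborel) -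
        \<i> * lam * (LBINT s:{0..t}. \<integral>x. N s x * W (t - s) x \<partial>lborel)" if "t \<in> {0..\<tau>}" for t
    using duh[OF that schwartz_lap_gauss[OF a]] by (simp add: W0) (simp add: W_def)
  note weak = duhamel_weak_form[where u = "strip_cut \<tau> u" and N = N and V = V and W = W and g = g and h = h
      and \<eta> = \<eta> and \<eta>' = \<eta>' and E = E and lam = lam and \<tau> = \<tau>,
      OF \<tau>(1) mu mN mV mW mg m\<eta> h(1) iu1 iN ig _ _ dV _ \<eta>\<tau>]
  show ?th1 using weak(1) VW \<eta>' E duhV duhW unfolding V0 W0 N_def by blast
  show ?th2 using weak(2) VW \<eta>' E duhV duhW unfolding V0 W0 N_def by blast
  show ?th3 using weak(3) VW \<eta>' E duhV duhW unfolding V0 W0 N_def by blast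
  show ?th4
  proof (rule Bochner_Integration.integrable_bound[OF ig])
    show "(\<lambda>x. g x * gauss a x) \<in> borel_measurable lborel"
      using borel_measurable_times[OF mg measurable_poly_gauss[OF real_polynomial_function.intros(2)], of a 1]
      by (simp add: gauss_def)
    show "AE x in lborel. norm (g x * gauss a x) \<le> norm (cmod (g x) * h x)"
      using VW(1)[of 0] \<tau> h0 by (auto simp: V0 norm_mult abs_mult intro!: AE_I2 mult_left_mono)
  qed
qed

subsection \<open>The test function\<close>

text \<open>Coefficients expanding \<open>s (1 - s)\<^sup>m\<close> in powers of \<open>s\<close>.\<close>

definition tcoeff :: "nat \<Rightarrow> nat \<Rightarrow> real" where
  "tcoeff m j = (- 1) ^ j * real (m choose j)"

lemma tcoeff_sum: "(\<Sum>j\<le>m. tcoeff m j * s ^ (j + 1)) = s * (1 - s) ^ m"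
proof -
  have "(1 - s) ^ m = (- s + 1) ^ m" by simp
  also have "\<dots> = (\<Sum>j\<le>m. real (m choose j) * (- s) ^ j * 1 ^ (m - j))"
    by (rule binomial_ring)
  also have "\<dots> = (\<Sum>j\<le>m. tcoeff m j * s ^ j)"
    by (intro sum.cong refl) (simp add: tcoeff_def power_minus[of s])
  finally show ?thesis
    by (simp add: sum_distrib_left mult_ac)
qed

section \<open>The operator \<open>s * d/ds\<close> applied to the test polynomial\<close>

lemma DERIV_cmult_power:
  "((\<lambda>s. c * s ^ (j + 1)) has_real_derivative c * (real j + 1) * s ^ j) (at s)"
  using DERIV_cmult[OF DERIV_pow[of "j + 1" s], of c] by (simp add: mult.assoc add.commute)

text \<open>\<open>s * d/ds\<close> multiplies \<open>s ^ (j + 1)\<close> by \<open>j + 1\<close>;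
  this is its effect on \<open>tcoeff_sum\<close>, and \<open>tcoeff_sum2\<close> is its second
  application. Both weights are wanted because the Laplacian of a Gaussian of rate
  \<open>(j + 1) / \<tau>\<close> is quadratic in \<open>j + 1\<close>.\<close>

lemma tcoeff_sum1:
  assumes "m \<ge> 2"
  shows "(\<Sum>j\<le>m. tcoeff m j * (real j + 1) * s ^ (j + 1)) = s * (1 - s) ^ m - m * s\<^sup>2 * (1 - s) ^ (m - 1)"
proof -
  have "((\<lambda>s. \<Sum>j\<le>m. tcoeff m j * s ^ (j + 1)) has_real_derivative (\<Sum>j\<le>m. tcoeff m j * (real j + 1) * s ^ j)) (at s)"
    by (intro DERIV_sum DERIV_cmult_power)
  moreover have "((\<lambda>s. \<Sum>j\<le>m. tcoeff m j * s ^ (j + 1)) has_real_derivative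
      (1 - s) ^ m - m * s * (1 - s) ^ (m - 1)) (at s)"
    unfolding tcoeff_sum by (auto intro!: derivative_eq_intros)
  ultimately have "(\<Sum>j\<le>m. tcoeff m j * (real j + 1) * s ^ j) = (1 - s) ^ m - m * s * (1 - s) ^ (m - 1)"
    by (rule DERIV_unique)
  from arg_cong[OF this, of "\<lambda>x. s * x"] show ?thesis
    by (simp add: sum_distrib_left algebra_simps power2_eq_square)
qed

lemma tcoeff_sum2:
  assumes "m \<ge> 2"
  shows "(\<Sum>j\<le>m. tcoeff m j * (real j + 1)\<^sup>2 * s ^ (j + 1)) =
    s * (1 - s) ^ m - 3 * m * s\<^sup>2 * (1 - s) ^ (m - 1) + real m * (real m - 1) * s ^ 3 * (1 - s) ^ (m - 2)"
proof -
  have "((\<lambda>s. \<Sum>j\<le>m. tcoeff m j * (real j + 1) * s ^ (j + 1)) has_real_derivative (\<Sum>j\<le>m. tcoeff m j * (real j + 1)\<^sup>2 * s ^ j)) (at s)"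
    unfolding power2_eq_square mult.assoc[symmetric] by (intro DERIV_sum DERIV_cmult_power)
  moreover have "((\<lambda>s. \<Sum>j\<le>m. tcoeff m j * (real j + 1) * s ^ (j + 1)) has_real_derivative
      (1 - s) ^ m - 3 * m * s * (1 - s) ^ (m - 1) + m * (m - 1) * s\<^sup>2 * (1 - s) ^ (m - 2)) (at s)"
    unfolding tcoeff_sum1[OF assms] using assms
    by (auto intro!: derivative_eq_intros simp: algebra_simps of_nat_diff numeral_2_eq_2)
  ultimately have "(\<Sum>j\<le>m. tcoeff m j * (real j + 1)\<^sup>2 * s ^ j) =
      (1 - s) ^ m - 3 * m * s * (1 - s) ^ (m - 1) + m * (m - 1) * s\<^sup>2 * (1 - s) ^ (m - 2)"
    by (rule DERIV_unique)
  from arg_cong[OF this, of "\<lambda>x. s * x"] show ?thesis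
    by (simp add: sum_distrib_left algebra_simps power2_eq_square power3_eq_cube)
qed

text \<open>Each application of \<open>s * d/ds\<close> costs one order of vanishing at
  \<open>s = 1\<close>, which is the origin of space, so \<open>(1 - s) ^ (m - 2)\<close> remains as
  a common factor of all terms.\<close>

lemma
  fixes s :: real
  assumes m: "m \<ge> 2" and s: "0 \<le> s" "s \<le> 1"
  shows tcoeff_sum1_bound: "\<bar>\<Sum>j\<le>m. tcoeff m j * (real j + 1) * s ^ (j + 1)\<bar> \<le> (1 + real m) * (s * (1 - s) ^ (m - 2))"
    and tcoeff_sum2_bound: "\<bar>\<Sum>j\<le>m. tcoeff m j * (real j + 1)\<^sup>2 * s ^ (j + 1)\<bar> \<le> (1 + 3 * real m + real m * (real m - 1)) * (s * (1 - s) ^ (m - 2))"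
proof -
  let ?b = "s * (1 - s) ^ (m - 2)"
  have d: "(1 - s) ^ m \<le> (1 - s) ^ (m - 2)" "(1 - s) ^ (m - 1) \<le> (1 - s) ^ (m - 2)"
    using m s by (auto intro!: power_decreasing)
  have 1: "s * (1 - s) ^ m \<le> ?b"
    using d s by (intro mult_left_mono) auto
  have 2: "s\<^sup>2 * (1 - s) ^ (m - 1) \<le> ?b"
    using d s by (intro mult_mono) (auto simp: power2_eq_square mult_left_le)
  have 3: "s ^ 3 * (1 - s) ^ (m - 2) \<le> ?b"
    using d s power_decreasing[of 1 3 s] by (intro mult_mono) auto
  have "\<bar>s * (1 - s) ^ m - m * s\<^sup>2 * (1 - s) ^ (m - 1)\<bar> \<le> s * (1 - s) ^ m + m * (s\<^sup>2 * (1 - s) ^ (m - 1))"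
    using s by (intro order_trans[OF abs_triangle_ineq4]) (simp add: abs_mult)
  also have "\<dots> \<le> ?b + m * ?b"
    by (intro add_mono[OF 1 mult_left_mono[OF 2]]) auto
  finally show "\<bar>\<Sum>j\<le>m. tcoeff m j * (real j + 1) * s ^ (j + 1)\<bar> \<le> (1 + real m) * ?b"
    unfolding tcoeff_sum1[OF m] by (simp add: algebra_simps)
  have "\<bar>s * (1 - s) ^ m - 3 * m * s\<^sup>2 * (1 - s) ^ (m - 1) + real m * (real m - 1) * s ^ 3 * (1 - s) ^ (m - 2)\<bar> \<le>
      s * (1 - s) ^ m + (3 * m) * (s\<^sup>2 * (1 - s) ^ (m - 1)) + real m * (real m - 1) * (s ^ 3 * (1 - s) ^ (m - 2))"
    using s m by (intro order_trans[OF abs_triangle_ineq] add_mono order_trans[OF abs_triangle_ineq4])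
      (simp_all add: abs_mult mult_ac)
  also have "\<dots> \<le> ?b + (3 * m) * ?b + real m * (real m - 1) * ?b"
    using m by (intro add_mono[OF add_mono[OF 1 mult_left_mono[OF 2]] mult_left_mono[OF 3]]) auto
  finally show "\<bar>\<Sum>j\<le>m. tcoeff m j * (real j + 1)\<^sup>2 * s ^ (j + 1)\<bar> \<le> (1 + 3 * real m + real m * (real m - 1)) * ?b"
    unfolding tcoeff_sum2[OF m] by (simp add: algebra_simps)
qed

text \<open>The two terms on the right balance where
  \<open>B = v powr (p - 1) * \<bar>\<mu>\<bar> * y\<^sup>2\<close>. On one side of this threshold
  the first term alone dominates, on the other the second, so the coefficient of the first is
  exactly \<open>\<mu>\<^sup>2\<close> and it can be absorbed completely. Zero values of
  \<open>y\<close>, \<open>B\<close> and \<open>v\<close> are split off before negative powers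
  appear.\<close>

lemma weighted_young:
  fixes p \<mu> B y v :: real
  assumes p: "p > 1" and \<mu>: "\<mu> \<noteq> 0" and B: "B \<ge> 0" and y: "0 \<le> y" "y \<le> 1" and v: "v \<ge> 0"
    and m: "real m \<ge> 2 * (p / (p - 1))"
  shows "\<bar>\<mu>\<bar> * (v * (B * y ^ (m - 2))) \<le> \<mu>\<^sup>2 * (v powr p * y ^ m) + \<bar>\<mu>\<bar> powr (1 - 1 / (p - 1)) * B powr (p / (p - 1))"
proof -
  have p': "p / (p - 1) = 1 + 1 / (p - 1)" using p by (simp add: field_simps)
  have "2 < 2 * (p / (p - 1))" unfolding p' using p by simp
  then have m2: "real m > 2" using m by (rule less_le_trans)
  then have m2': "m > 2" by linarith
  let ?R = "\<bar>\<mu>\<bar> powr (1 - 1 / (p - 1)) * B powr (p / (p - 1))"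
  consider "y = 0 \<or> B = 0 \<or> v = 0" | "y > 0" "B > 0" "v > 0" "B \<le> v powr (p - 1) * \<bar>\<mu>\<bar> * y\<^sup>2"
    | "y > 0" "B > 0" "v > 0" "v powr (p - 1) * \<bar>\<mu>\<bar> * y\<^sup>2 < B"
    using y B v by fastforce
  then show ?thesis
  proof cases
    case 1
    then have "v * (B * y ^ (m - 2)) = 0" using m2' by auto
    then show ?thesis using y by (simp only: mult_zero_right) auto
  next
    case 2
    have "\<bar>\<mu>\<bar> * (v * (B * y ^ (m - 2))) \<le> \<bar>\<mu>\<bar> * (v * ((v powr (p - 1) * \<bar>\<mu>\<bar> * y\<^sup>2) * y ^ (m - 2)))"
      using 2 by (intro mult_left_mono mult_right_mono) auto
    also have "\<dots> = \<mu>\<^sup>2 * ((v * v powr (p - 1)) * (y\<^sup>2 * y ^ (m - 2)))"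
      by (simp add: power2_eq_square mult_ac flip: abs_mult)
    also have "v * v powr (p - 1) = v powr p"
      using 2 by (simp add: powr_mult_base)
    also have "y\<^sup>2 * y ^ (m - 2) = y ^ m"
    proof -
      have e: "2 + (m - 2) = m" using m2' by simp
      show ?thesis unfolding power_add[symmetric] e ..
    qed
    finally show ?thesis by (rule order_trans) simp
  next
    case 3
    let ?\<theta> = "1 / (p - 1)"
    have "v = (v powr (p - 1)) powr ?\<theta>"
      using 3 p by (simp add: powr_powr)
    also have "\<dots> \<le> (B / (\<bar>\<mu>\<bar> * y\<^sup>2)) powr ?\<theta>"
      using 3 p \<mu> by (intro powr_mono2) (auto simp: pos_le_divide_eq mult.assoc)
    also have "\<dots> = B powr ?\<theta> * \<bar>\<mu>\<bar> powr (- ?\<theta>) * y powr (- 2 * ?\<theta>)"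
    proof -
      have "y powr - 2 = inverse (y\<^sup>2)" "\<bar>\<mu>\<bar> powr - 1 = inverse \<bar>\<mu>\<bar>"
        using 3 \<mu> powr_realpow[of y 2] powr_minus[of y 2] powr_minus[of "\<bar>\<mu>\<bar>" 1] by simp_all
      then have "B / (\<bar>\<mu>\<bar> * y\<^sup>2) = B * \<bar>\<mu>\<bar> powr - 1 * y powr - 2"
        by (simp only:) (simp add: divide_inverse)
      also have "(B * \<bar>\<mu>\<bar> powr - 1 * y powr - 2) powr ?\<theta> =
          B powr ?\<theta> * (\<bar>\<mu>\<bar> powr - 1) powr ?\<theta> * (y powr - 2) powr ?\<theta>"
        using 3 by (simp only: powr_mult powr_ge_zero mult_nonneg_nonneg less_imp_le)
      finally show ?thesis
        by (simp only: powr_powr mult_minus_left mult_1)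
    qed
    finally have v: "v \<le> B powr ?\<theta> * \<bar>\<mu>\<bar> powr (- ?\<theta>) * y powr (- 2 * ?\<theta>)" .
    have "\<bar>\<mu>\<bar> * (v * (B * y ^ (m - 2))) \<le>
        \<bar>\<mu>\<bar> * ((B powr ?\<theta> * \<bar>\<mu>\<bar> powr (- ?\<theta>) * y powr (- 2 * ?\<theta>)) * (B * y ^ (m - 2)))"
      using 3 v by (intro mult_left_mono mult_right_mono) auto
    also have "\<dots> = (\<bar>\<mu>\<bar> * \<bar>\<mu>\<bar> powr (- ?\<theta>)) * (B * B powr ?\<theta>) * (y powr (- 2 * ?\<theta>) * y ^ (m - 2))"
      by (simp only: mult_ac)
    also have "\<bar>\<mu>\<bar> * \<bar>\<mu>\<bar> powr (- ?\<theta>) = \<bar>\<mu>\<bar> powr (1 - ?\<theta>)"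
      using \<mu> by (simp add: powr_mult_base)
    also have "B * B powr ?\<theta> = B powr (p / (p - 1))"
      using 3 by (simp add: powr_mult_base p')
    also have "y powr (- 2 * ?\<theta>) * y ^ (m - 2) = y powr (- 2 * ?\<theta> + (real m - 2))"
    proof -
      have "y ^ (m - 2) = y powr (real m - 2)"
        using 3 m2' powr_realpow[of y "m - 2"] by (simp add: of_nat_diff)
      then show ?thesis by (simp only: powr_add)
    qed
    \<comment> \<open>The exponent of \<open>y\<close> is \<open>m - 2 * (p / (p - 1))\<close>,
      which is nonnegative by \<open>m\<close>; hence this power of \<open>y\<close> is at most
      1.\<close>
    also have "\<bar>\<mu>\<bar> powr (1 - ?\<theta>) * B powr (p / (p - 1)) * y powr (- 2 * ?\<theta> + (real m - 2)) \<le> ?R * 1"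
      using 3 y m by (intro mult_left_mono powr_le1) (auto simp: p' algebra_simps)
    finally show ?thesis
      using y by (intro add_increasing) auto
  qed
qed

text \<open>Half of the exponential decay pays for the polynomial factor: raise
  \<open>1 + q \<le> 2 * r * exp (q / (2 * r))\<close> to the power \<open>r\<close>.\<close>

lemma polynomial_exp_bound:
  fixes r q :: real
  assumes "r \<ge> 1" "q \<ge> 0"
  shows "(1 + q) powr r * exp (- q) \<le> (2 * r) powr r * exp (- (q / 2))"
proof -
  have "1 + q \<le> (2 * r) * (1 + q / (2 * r))"
    using assms by (simp add: field_simps)
  also have "\<dots> \<le> (2 * r) * exp (q / (2 * r))"
    using assms exp_ge_add_one_self[of "q / (2 * r)"] by (intro mult_left_mono) (auto simp del: exp_ge_add_one_self)
  finally have "(1 + q) powr r \<le> ((2 * r) * exp (q / (2 * r))) powr r"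
    using assms by (intro powr_mono2) auto
  also have "\<dots> = (2 * r) powr r * exp (q / 2)"
    using assms by (simp add: powr_mult exp_powr_real field_simps)
  finally have "(1 + q) powr r * exp (- q) \<le> (2 * r) powr r * exp (q / 2) * exp (- q)"
    by (intro mult_right_mono) auto
  also have "\<dots> = (2 * r) powr r * exp (- (q / 2))"
    by (simp add: mult.assoc mult_exp_exp)
  finally show ?thesis .
qed

section \<open>The spatial test function and its Laplacian\<close>

definition test_fun :: "nat \<Rightarrow> real \<Rightarrow> 'a::real_inner \<Rightarrow> real" where
  "test_fun m \<tau> x = exp (- ((x \<bullet> x) / \<tau>)) * (1 - exp (- ((x \<bullet> x) / \<tau>))) ^ m"

text \<open>
  The Laplacian of \<open>test_fun m \<tau>\<close>, as the combination of Laplacians of Gaussians.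
\<close>

definition test_lap :: "nat \<Rightarrow> real \<Rightarrow> real ^ 'n \<Rightarrow> real" where
  "test_lap m \<tau> x = (\<Sum>j\<le>m. tcoeff m j * ((4 * ((real j + 1) / \<tau>)\<^sup>2 * (x \<bullet> x) - 2 * ((real j + 1) / \<tau>) * real CARD('n)) *
     exp (- ((x \<bullet> x) / \<tau>)) ^ (j + 1)))"

lemma test_fun_gauss:
  fixes x :: "real ^ 'n"
  shows "complex_of_real (test_fun m \<tau> x) = (\<Sum>j\<le>m. tcoeff m j * gauss ((real j + 1) / \<tau>) x)"
proof -
  have "gauss ((real j + 1) / \<tau>) x = of_real (exp (- ((x \<bullet> x) / \<tau>)) ^ (j + 1))" for j :: nat
    by (simp only: gauss_def poly_gauss_def exp_of_nat_mult[symmetric]) (simp add: field_simps)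
  then show ?thesis
    unfolding test_fun_def tcoeff_sum[symmetric] by simp
qed

lemma test_lap_gauss:
  fixes x :: "real ^ 'n"
  shows "complex_of_real (test_lap m \<tau> x) = (\<Sum>j\<le>m. tcoeff m j * lap_gauss ((real j + 1) / \<tau>) x)"
proof -
  have "lap_gauss ((real j + 1) / \<tau>) x = of_real ((4 * ((real j + 1) / \<tau>)\<^sup>2 * (x \<bullet> x) - 2 * ((real j + 1) / \<tau>) * real CARD('n)) *
     exp (- ((x \<bullet> x) / \<tau>)) ^ (j + 1))" for j :: nat
    by (simp only: lap_gauss_def poly_gauss_def exp_of_nat_mult[symmetric]) (simp add: field_simps)
  then show ?thesis
    unfolding test_lap_def by simp
qed

text \<open>The term of index \<open>j\<close> belongs to a Gaussian of rate
  \<open>(j + 1) / \<tau>\<close>. The parts quadratic in \<open>j + 1\<close> collect into the sum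
  of \<open>tcoeff_sum2\<close>, the linear parts into that of \<open>tcoeff_sum1\<close>.\<close>

lemma test_lap_bound:
  fixes x :: "real ^ 'n"
  assumes m: "m \<ge> 2" and \<tau>: "\<tau> > 0"
  defines "s \<equiv> exp (- ((x \<bullet> x) / \<tau>))"
  shows "\<bar>test_lap m \<tau> x\<bar> \<le> (4 * (1 + 3 * real m + real m * (real m - 1)) * ((x \<bullet> x) / \<tau>) + 2 * real CARD('n) * (1 + real m)) / \<tau> *
    (s * (1 - s) ^ (m - 2))"
proof -
  let ?q = "(x \<bullet> x) / \<tau>" and ?b = "s * (1 - s) ^ (m - 2)"
  have s: "0 \<le> s" "s \<le> 1" unfolding s_def using \<tau> by auto
  have "test_lap m \<tau> x = 4 * ?q / \<tau> * (\<Sum>j\<le>m. tcoeff m j * (real j + 1)\<^sup>2 * s ^ (j + 1)) -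
      2 * real CARD('n) / \<tau> * (\<Sum>j\<le>m. tcoeff m j * (real j + 1) * s ^ (j + 1))"
    unfolding test_lap_def s_def[symmetric] sum_distrib_left sum_subtractf[symmetric]
    by (intro sum.cong refl) (simp add: field_simps power2_eq_square)
  then have "\<bar>test_lap m \<tau> x\<bar> \<le> 4 * ?q / \<tau> * \<bar>\<Sum>j\<le>m. tcoeff m j * (real j + 1)\<^sup>2 * s ^ (j + 1)\<bar> +
      2 * real CARD('n) / \<tau> * \<bar>\<Sum>j\<le>m. tcoeff m j * (real j + 1) * s ^ (j + 1)\<bar>"
    using \<tau> by (simp only:) (intro order_trans[OF abs_triangle_ineq4], simp add: abs_mult)
  also have "\<dots> \<le> 4 * ?q / \<tau> * ((1 + 3 * real m + real m * (real m - 1)) * ?b) + 2 * real CARD('n) / \<tau> * ((1 + real m) * ?b)"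
    using \<tau> by (intro add_mono mult_left_mono[OF tcoeff_sum1_bound[OF m s]] mult_left_mono[OF tcoeff_sum2_bound[OF m s]]) auto
  also have "\<dots> = (4 * (1 + 3 * real m + real m * (real m - 1)) * ?q + 2 * real CARD('n) * (1 + real m)) / \<tau> * ?b"
    using \<tau> by (simp add: divide_inverse algebra_simps)
  finally show ?thesis .
qed

subsection \<open>The test function estimate\<close>

lemma test_fun_nonneg: "\<tau> > 0 \<Longrightarrow> 0 \<le> test_fun m \<tau> x"
  by (simp add: test_fun_def)

text \<open>The weak form is linear in the spatial test function, so its instances for Gaussians of
  rate \<open>(j + 1) / \<tau>\<close> are summed with the weights
  \<open>tcoeff m j\<close>.\<close>

lemma weak_form_test:
  fixes u :: "real \<Rightarrow> real ^ 'n \<Rightarrow> complex" and g :: "real ^ 'n \<Rightarrow> complex"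
    and p \<tau> :: real and lam :: complex and m :: nat
  defines "\<eta> \<equiv> \<lambda>t. (1 - t / \<tau>) ^ m" and "\<eta>' \<equiv> \<lambda>t. - (m / \<tau>) * (1 - t / \<tau>) ^ (m - 1)"
  defines "L \<equiv> \<lambda>q. indicator {0..\<tau>} (fst q) *\<^sub>R (strip_cut \<tau> u (fst q) (snd q) *
      (complex_of_real (\<eta>' (fst q)) * complex_of_real (test_fun m \<tau> (snd q)) +
       \<i> * complex_of_real (\<eta> (fst q)) * complex_of_real (test_lap m \<tau> (snd q))))"
  defines "X \<equiv> \<lambda>q. indicator {0..\<tau>} (fst q) * (\<eta> (fst q) * (cmod (strip_cut \<tau> u (fst q) (snd q)) powr p * test_fun m \<tau> (snd q)))"
  assumes p: "1 < p" "p < 1 + 2 / real CARD('n)"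
    and \<tau>: "0 < \<tau>" "ennreal \<tau> < T" and sol: "L2_solution p lam g T u" and g: "in_Lp 2 g" and m: "m \<ge> 2"
  shows "integrable lborel L" and "integrable lborel X"
    and "integrable lborel (\<lambda>x. g x * complex_of_real (test_fun m \<tau> x))"
    and "(\<integral>x. g x * complex_of_real (test_fun m \<tau> x) \<partial>lborel) =
      \<i> * lam * complex_of_real (\<integral>q. X q \<partial>lborel) - (\<integral>q. L q \<partial>lborel)"
proof -
  define a where "a j = (real j + 1) / \<tau>" for j :: nat
  have a: "a j > 0" for j using \<tau> by (simp add: a_def)
  define c where "c j = complex_of_real (tcoeff m j)" for j
  define E where "E = 1 + m / \<tau>"
  have m\<eta>: "\<eta> \<in> borel_measurable borel" "\<eta>' \<in> borel_measurable borel"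
    unfolding \<eta>_def \<eta>'_def by measurable
  have d\<eta>: "(\<eta> has_real_derivative \<eta>' t) (at t)" for t
    unfolding \<eta>_def \<eta>'_def using \<tau> by (auto intro!: derivative_eq_intros)
  have \<eta>\<tau>: "\<eta> \<tau> = 0" "\<eta> 0 = 1" using \<tau> m by (auto simp: \<eta>_def)
  have E: "\<bar>\<eta> t\<bar> \<le> E" "\<bar>\<eta>' t\<bar> \<le> E" if "t \<in> {0..\<tau>}" for t
  proof -
    have 1: "0 \<le> 1 - t / \<tau>" "1 - t / \<tau> \<le> 1" using that \<tau> by auto
    have "\<bar>\<eta> t\<bar> \<le> 1" unfolding \<eta>_def using 1 by (simp add: power_le_one)
    then show "\<bar>\<eta> t\<bar> \<le> E" unfolding E_def using \<tau> by (simp add: add_increasing2)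
    have "\<bar>\<eta>' t\<bar> = m / \<tau> * (1 - t / \<tau>) ^ (m - 1)"
      unfolding \<eta>'_def using 1 \<tau> by (simp add: abs_mult)
    also have "\<dots> \<le> m / \<tau> * 1"
      using 1 \<tau> by (intro mult_left_mono power_le_one) auto
    finally show "\<bar>\<eta>' t\<bar> \<le> E" by (simp add: E_def)
  qed
  note weak = duhamel_weak_form_gauss[OF p a less_imp_le[OF \<tau>(1)] \<tau>(2) sol g m\<eta> d\<eta> \<eta>\<tau>(1) E]
  define Lj where "Lj j q = indicator {0..\<tau>} (fst q) *\<^sub>R (strip_cut \<tau> u (fst q) (snd q) *
            (complex_of_real (\<eta>' (fst q)) * gauss (a j) (snd q) + \<i> * complex_of_real (\<eta> (fst q)) * lap_gauss (a j) (snd q)))" for j q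
  define Xj where "Xj j q = indicator {0..\<tau>} (fst q) *\<^sub>R (complex_of_real (\<eta> (fst q)) *
      (of_real (cmod (strip_cut \<tau> u (fst q) (snd q)) powr p) * gauss (a j) (snd q)))" for j q
  have Lj: "integrable lborel (Lj j)" for j
    unfolding Lj_def by (rule weak(2)) auto
  have Xj: "integrable lborel (Xj j)" for j
    unfolding Xj_def by (rule weak(3)) auto
  have gj: "integrable lborel (\<lambda>x. g x * gauss (a j) x)" for j
    by (rule weak(4)) auto
  have eq: "(\<integral>q. Lj j q \<partial>lborel) = - (\<integral>x. g x * gauss (a j) x \<partial>lborel) + \<i> * lam * (\<integral>q. Xj j q \<partial>lborel)" for j
    using weak(1)[of j] unfolding Lj_def Xj_def \<eta>\<tau>(2) by simp
  have tf: "complex_of_real (test_fun m \<tau> x) = (\<Sum>j\<le>m. c j * gauss (a j) x)" for x :: "real ^ 'n"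
    unfolding c_def a_def by (rule test_fun_gauss)
  have tl: "complex_of_real (test_lap m \<tau> x) = (\<Sum>j\<le>m. c j * lap_gauss (a j) x)" for x :: "real ^ 'n"
    unfolding c_def a_def by (rule test_lap_gauss)
  have L_eq: "L q = (\<Sum>j\<le>m. c j * Lj j q)" for q
    unfolding L_def Lj_def tf tl
    by (simp add: scaleR_conv_of_real sum_distrib_left sum.distrib[symmetric] distrib_left mult_ac)
  have X_eq: "complex_of_real (X q) = (\<Sum>j\<le>m. c j * Xj j q)" for q
  proof -
    have "complex_of_real (X q) = indicator {0..\<tau>} (fst q) *\<^sub>R (complex_of_real (\<eta> (fst q)) *
      (of_real (cmod (strip_cut \<tau> u (fst q) (snd q)) powr p) * complex_of_real (test_fun m \<tau> (snd q))))"
      by (simp add: X_def scaleR_conv_of_real)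
    then show ?thesis
      unfolding Xj_def tf by (simp add: scaleR_conv_of_real sum_distrib_left mult_ac)
  qed
  have g_eq: "g x * complex_of_real (test_fun m \<tau> x) = (\<Sum>j\<le>m. c j * (g x * gauss (a j) x))" for x
    unfolding tf by (simp add: sum_distrib_left mult_ac)
  show "integrable lborel L"
    unfolding L_eq[abs_def] by (intro Bochner_Integration.integrable_sum integrable_mult_right Lj)
  have iX: "integrable lborel (\<lambda>q. complex_of_real (X q))"
    unfolding X_eq by (intro Bochner_Integration.integrable_sum integrable_mult_right Xj)
  then show "integrable lborel X"
    by (simp only: complex_of_real_integrable_eq)
  show "integrable lborel (\<lambda>x. g x * complex_of_real (test_fun m \<tau> x))"
    unfolding g_eq by (intro Bochner_Integration.integrable_sum integrable_mult_right gj)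
  have "complex_of_real (\<integral>q. X q \<partial>lborel) = (\<integral>q. complex_of_real (X q) \<partial>lborel)"
    by simp
  also have "\<dots> = (\<Sum>j\<le>m. c j * (\<integral>q. Xj j q \<partial>lborel))"
    unfolding X_eq by (subst Bochner_Integration.integral_sum) (auto intro!: integrable_mult_right Xj)
  finally have iX: "complex_of_real (\<integral>q. X q \<partial>lborel) = (\<Sum>j\<le>m. c j * (\<integral>q. Xj j q \<partial>lborel))" .
  have iL: "(\<integral>q. L q \<partial>lborel) = (\<Sum>j\<le>m. c j * (\<integral>q. Lj j q \<partial>lborel))"
    unfolding L_eq by (subst Bochner_Integration.integral_sum) (auto intro!: integrable_mult_right Lj)
  have ig: "(\<integral>x. g x * complex_of_real (test_fun m \<tau> x) \<partial>lborel) = (\<Sum>j\<le>m. c j * (\<integral>x. g x * gauss (a j) x \<partial>lborel))"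
    unfolding g_eq by (subst Bochner_Integration.integral_sum) (auto intro!: integrable_mult_right gj)
  show "(\<integral>x. g x * complex_of_real (test_fun m \<tau> x) \<partial>lborel) =
      \<i> * lam * complex_of_real (\<integral>q. X q \<partial>lborel) - (\<integral>q. L q \<partial>lborel)"
    unfolding ig iX iL eq
    by (simp add: sum_distrib_left sum_subtractf[symmetric] algebra_simps sum.distrib sum_negf)
qed

text \<open>\<open>A\<close> adds up the coefficients in the bounds on \<open>\<eta>'\<close> and on
  the Laplacian; it depends on \<open>m\<close> and the dimension only. The right-hand side thus
  carries no trace of \<open>f\<close>, \<open>u\<close> or \<open>\<epsilon>\<close>, which is what
  makes the final constant uniform in \<open>f\<close>.\<close>

lemma test_function_estimate:
  fixes u :: "real \<Rightarrow> real ^ 'n \<Rightarrow> complex" and f :: "real ^ 'n \<Rightarrow> complex" and F :: "real ^ 'n \<Rightarrow> real"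
    and p \<tau> \<epsilon> \<mu> :: real and lam :: complex and m :: nat
  defines "A \<equiv> m + 2 * real CARD('n) * (1 + real m) + 4 * (1 + 3 * real m + real m * (real m - 1))"
  assumes p: "1 < p" "p < 1 + 2 / real CARD('n)"
    and \<tau>: "0 < \<tau>" "ennreal \<tau> < T" and sol: "L2_solution p lam (\<lambda>x. complex_of_real \<epsilon> * f x) T u"
    and f: "in_Lp 2 f" and m: "real m \<ge> 2 * (p / (p - 1))" and \<epsilon>: "\<epsilon> > 0" and \<mu>: "\<mu> \<noteq> 0"
    and F: "(F = (\<lambda>x. Re (f x)) \<and> \<mu> = Im lam) \<or> (F = (\<lambda>x. Im (f x)) \<and> \<mu> = - Re lam)"
  shows "\<epsilon> * (\<integral>x. \<mu> * F x * test_fun m \<tau> x \<partial>lborel) \<le>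
    \<bar>\<mu>\<bar> powr (1 - 1 / (p - 1)) * A powr (p / (p - 1)) * (2 * (p / (p - 1))) powr (p / (p - 1)) *
      \<tau> powr (1 - p / (p - 1)) * sqrt (2 * pi * \<tau>) ^ CARD('n)"
    and "integrable lborel (\<lambda>x. F x * test_fun m \<tau> x)"
proof -
  let ?p' = "p / (p - 1)"
  have p': "?p' \<ge> 1" using p by simp
  have m2: "m \<ge> 2" using m p' by linarith
  have A: "A \<ge> 0" unfolding A_def using m2 by simp
  define K where "K = \<bar>\<mu>\<bar> powr (1 - 1 / (p - 1)) * (A / \<tau>) powr ?p' * (2 * ?p') powr ?p'"
  define g where "g x = complex_of_real \<epsilon> * f x" for x
  have g: "in_Lp 2 g"
    using f unfolding in_Lp_def g_def[abs_def] by (auto simp: norm_mult powr_mult)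
  define \<eta> where "\<eta> t = (1 - t / \<tau>) ^ m" for t
  define \<eta>' where "\<eta>' t = - (m / \<tau>) * (1 - t / \<tau>) ^ (m - 1)" for t
  define L where "L q = indicator {0..\<tau>} (fst q) *\<^sub>R (strip_cut \<tau> u (fst q) (snd q) *
      (complex_of_real (\<eta>' (fst q)) * complex_of_real (test_fun m \<tau> (snd q)) +
       \<i> * complex_of_real (\<eta> (fst q)) * complex_of_real (test_lap m \<tau> (snd q))))" for q
  define X where "X q = indicator {0..\<tau>} (fst q) * (\<eta> (fst q) * (cmod (strip_cut \<tau> u (fst q) (snd q)) powr p * test_fun m \<tau> (snd q)))" for q
  \<comment> \<open>\<open>G\<close> is what Young's inequality leaves over once
    \<open>polynomial_exp_bound\<close> has removed the polynomial factor. It is a Gaussian on the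
    strip, so its integral is explicit and becomes the right-hand side.\<close>
  define G where "G q = indicator {0..\<tau>} (fst q) * (K * exp (- (1 / (2 * \<tau>) * (snd q \<bullet> snd q))))" for q :: "real \<times> (real ^ 'n)"
  note weak = weak_form_test[OF p \<tau> sol[folded g_def] g m2, folded \<eta>_def \<eta>'_def, folded L_def X_def]
  have I: "integrable lborel (indicator {0..\<tau>} :: real \<Rightarrow> real)"
    by (intro integrable_real_indicator) (auto simp: emeasure_lborel_Icc_eq)
  have iexp: "integrable lborel (\<lambda>x :: real ^ 'n. exp (- (1 / (2 * \<tau>) * (x \<bullet> x))))"
    using \<tau> by (intro integrable_gaussian_n) auto
  have G: "integrable lborel G"
    unfolding G_def[abs_def] by (intro integrable_fst_times I integrable_mult_right iexp)
  have G_int: "(\<integral>q. G q \<partial>lborel) = \<tau> * (K * sqrt (2 * pi * \<tau>) ^ CARD('n))"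
  proof -
    have "(\<integral>x. exp (- (1 / (2 * \<tau>) * (x \<bullet> x))) \<partial>(lborel :: (real ^ 'n) measure)) = sqrt (2 * pi * \<tau>) ^ CARD('n)"
      using integral_gaussian_n[of "1 / (2 * \<tau>)", where 'a = "real ^ 'n"] \<tau> by (simp add: mult_ac)
    moreover have "(\<integral>q. G q \<partial>lborel) =
        (\<integral>t. \<integral>x. indicator {0..\<tau>} t * (K * exp (- (1 / (2 * \<tau>) * (x \<bullet> x)))) \<partial>(lborel :: (real ^ 'n) measure) \<partial>lborel)"
      using G unfolding G_def[abs_def] by (rule fubini_lborel(1))
    ultimately show ?thesis
      using \<tau> by (simp only: integral_mult_right_zero integral_mult_left_zero) simp
  qed
  have pointwise: "\<bar>\<mu>\<bar> * cmod (L q) \<le> \<mu>\<^sup>2 * X q + G q" for q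
  proof (cases "fst q \<in> {0..\<tau>}")
    case False
    then show ?thesis by (simp add: L_def X_def G_def)
  next
    case True
    define v where "v = cmod (strip_cut \<tau> u (fst q) (snd q))"
    define Q where "Q = (snd q \<bullet> snd q) / \<tau>"
    define s where "s = exp (- Q)"
    define \<sigma> where "\<sigma> = 1 - fst q / \<tau>"
    \<comment> \<open>\<open>B * ?y ^ (m - 2) * s\<close> bounds both derivative terms. Merging the
      temporal and the spatial cutoff into the single variable
      \<open>?y = \<sigma> * (1 - s)\<close> allows one application of Young's inequality, with
      \<open>s\<close> carried along as a weight.\<close>
    define B where "B = A * (1 + Q) / \<tau>"
    let ?y = "\<sigma> * (1 - s)"
    have Q: "Q \<ge> 0" using \<tau> by (simp add: Q_def)
    have s: "0 < s" "s \<le> 1" using Q by (auto simp: s_def)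
    have \<sigma>: "0 \<le> \<sigma>" "\<sigma> \<le> 1" using True \<tau> by (auto simp: \<sigma>_def)
    have y: "0 \<le> ?y" "?y \<le> 1" using s \<sigma> by (auto intro: mult_le_one)
    have B: "B \<ge> 0" unfolding B_def using A Q \<tau> by simp
    have tf: "test_fun m \<tau> (snd q) = s * (1 - s) ^ m"
      by (simp add: test_fun_def s_def Q_def)
    have d: "\<sigma> ^ m \<le> \<sigma> ^ (m - 2)" "\<sigma> ^ (m - 1) \<le> \<sigma> ^ (m - 2)" "(1 - s) ^ m \<le> (1 - s) ^ (m - 2)"
      using m2 s \<sigma> by (auto intro!: power_decreasing)
    have w: "\<bar>\<eta>' (fst q)\<bar> * test_fun m \<tau> (snd q) + \<eta> (fst q) * \<bar>test_lap m \<tau> (snd q)\<bar> \<le> B * ?y ^ (m - 2) * s"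
    proof -
      let ?c1 = "4 * (1 + 3 * real m + real m * (real m - 1))" and ?c2 = "2 * real CARD('n) * (1 + real m)"
      have c: "?c1 \<ge> 0" "?c2 \<ge> 0" using m2 by auto
      have "\<bar>\<eta>' (fst q)\<bar> = m / \<tau> * \<sigma> ^ (m - 1)"
        using \<sigma> \<tau> by (simp add: \<eta>'_def \<sigma>_def[symmetric] abs_mult)
      then have "\<bar>\<eta>' (fst q)\<bar> * test_fun m \<tau> (snd q) = m / \<tau> * (\<sigma> ^ (m - 1) * (s * (1 - s) ^ m))"
        by (simp add: tf)
      also have "\<dots> \<le> m / \<tau> * (\<sigma> ^ (m - 2) * (s * (1 - s) ^ (m - 2)))"
        using s \<sigma> \<tau> by (intro mult_left_mono mult_mono[OF d(2) mult_left_mono[OF d(3)]]) auto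
      finally have 1: "\<bar>\<eta>' (fst q)\<bar> * test_fun m \<tau> (snd q) \<le> m / \<tau> * (\<sigma> ^ (m - 2) * (s * (1 - s) ^ (m - 2)))" .
      have "\<eta> (fst q) * \<bar>test_lap m \<tau> (snd q)\<bar> \<le> \<sigma> ^ (m - 2) * ((?c1 * Q + ?c2) / \<tau> * (s * (1 - s) ^ (m - 2)))"
        using test_lap_bound[OF m2 \<tau>(1), of "snd q"] d(1) \<sigma> unfolding \<eta>_def \<sigma>_def[symmetric] Q_def[symmetric] s_def[symmetric]
        by (intro mult_mono) auto
      with 1 have "\<bar>\<eta>' (fst q)\<bar> * test_fun m \<tau> (snd q) + \<eta> (fst q) * \<bar>test_lap m \<tau> (snd q)\<bar> \<le>
          (m + ?c2 + ?c1 * Q) / \<tau> * (\<sigma> ^ (m - 2) * (s * (1 - s) ^ (m - 2)))"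
        by (simp add: add_divide_distrib algebra_simps)
      also have "\<dots> \<le> B * (\<sigma> ^ (m - 2) * (s * (1 - s) ^ (m - 2)))"
      proof (rule mult_right_mono)
        have "m + ?c2 + ?c1 * Q \<le> A * (1 + Q)"
        proof -
          have "0 \<le> (m + ?c2) * Q + ?c1" using c Q m2 by (intro add_nonneg_nonneg mult_nonneg_nonneg) auto
          moreover have "A * (1 + Q) = (m + ?c2 + ?c1 * Q) + ((m + ?c2) * Q + ?c1)"
            unfolding A_def by (simp only: algebra_simps)
          ultimately show ?thesis by linarith
        qed
        then show "(m + ?c2 + ?c1 * Q) / \<tau> \<le> B"
          unfolding B_def using \<tau> by (intro divide_right_mono) auto
        show "0 \<le> \<sigma> ^ (m - 2) * (s * (1 - s) ^ (m - 2))" using s \<sigma> by simp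
      qed
      finally show ?thesis by (simp add: power_mult_distrib mult_ac)
    qed
    have "cmod (L q) = v * cmod (complex_of_real (\<eta>' (fst q)) * complex_of_real (test_fun m \<tau> (snd q)) +
       \<i> * complex_of_real (\<eta> (fst q)) * complex_of_real (test_lap m \<tau> (snd q)))"
      using True by (simp add: L_def v_def norm_mult)
    also have "\<dots> \<le> v * (\<bar>\<eta>' (fst q)\<bar> * test_fun m \<tau> (snd q) + \<eta> (fst q) * \<bar>test_lap m \<tau> (snd q)\<bar>)"
    proof (intro mult_left_mono)
      show "cmod (complex_of_real (\<eta>' (fst q)) * complex_of_real (test_fun m \<tau> (snd q)) +
         \<i> * complex_of_real (\<eta> (fst q)) * complex_of_real (test_lap m \<tau> (snd q))) \<le>
         \<bar>\<eta>' (fst q)\<bar> * test_fun m \<tau> (snd q) + \<eta> (fst q) * \<bar>test_lap m \<tau> (snd q)\<bar>"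
        using test_fun_nonneg[OF \<tau>(1), of m "snd q"] \<sigma>
        by (intro order_trans[OF norm_triangle_ineq]) (simp add: norm_mult norm_power \<eta>_def \<sigma>_def[symmetric])
    qed (simp add: v_def)
    also have "\<dots> \<le> v * (B * ?y ^ (m - 2) * s)"
      using w by (intro mult_left_mono) (auto simp: v_def)
    finally have "\<bar>\<mu>\<bar> * cmod (L q) \<le> \<bar>\<mu>\<bar> * (v * (B * ?y ^ (m - 2) * s))"
      by (rule mult_left_mono) simp
    also have "\<dots> = (\<bar>\<mu>\<bar> * (v * (B * ?y ^ (m - 2)))) * s"
      by (simp only: mult_ac)
    also have "\<dots> \<le> (\<mu>\<^sup>2 * (v powr p * ?y ^ m) + \<bar>\<mu>\<bar> powr (1 - 1 / (p - 1)) * B powr ?p') * s"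
      using s by (intro mult_right_mono weighted_young p \<mu> B y m) (auto simp: v_def)
    also have "\<dots> = \<mu>\<^sup>2 * X q + \<bar>\<mu>\<bar> powr (1 - 1 / (p - 1)) * (A / \<tau>) powr ?p' * ((1 + Q) powr ?p' * exp (- Q))"
    proof -
      have "B powr ?p' = (A / \<tau>) powr ?p' * (1 + Q) powr ?p'"
        unfolding B_def using A Q \<tau> by (simp add: powr_mult[symmetric])
      moreover have "X q = v powr p * ?y ^ m * s"
        using True by (simp add: X_def tf v_def \<eta>_def \<sigma>_def[symmetric] power_mult_distrib mult_ac)
      ultimately show ?thesis
        by (simp add: s_def algebra_simps)
    qed
    also have "\<dots> \<le> \<mu>\<^sup>2 * X q + \<bar>\<mu>\<bar> powr (1 - 1 / (p - 1)) * (A / \<tau>) powr ?p' * ((2 * ?p') powr ?p' * exp (- (Q / 2)))"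
      using polynomial_exp_bound[OF p' Q] by (intro add_left_mono mult_left_mono) auto
    also have "\<dots> = \<mu>\<^sup>2 * X q + G q"
      using True by (simp add: G_def K_def Q_def mult.assoc)
    finally show ?thesis .
  qed
  let ?X = "\<integral>q. X q \<partial>lborel" and ?L = "\<integral>q. L q \<partial>lborel"
  have "\<bar>\<mu>\<bar> * cmod ?L \<le> \<bar>\<mu>\<bar> * (\<integral>q. cmod (L q) \<partial>lborel)"
    by (intro mult_left_mono integral_norm_bound) auto
  also have "\<dots> = (\<integral>q. \<bar>\<mu>\<bar> * cmod (L q) \<partial>lborel)"
    by simp
  also have "\<dots> \<le> (\<integral>q. \<mu>\<^sup>2 * X q + G q \<partial>lborel)"
    using weak(1,2) G pointwise by (intro integral_mono) auto
  also have "\<dots> = \<mu>\<^sup>2 * ?X + \<tau> * (K * sqrt (2 * pi * \<tau>) ^ CARD('n))"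
    using weak(2) G by (simp add: G_int)
  finally have err: "\<bar>\<mu>\<bar> * cmod ?L \<le> \<mu>\<^sup>2 * ?X + \<tau> * (K * sqrt (2 * pi * \<tau>) ^ CARD('n))" .
  have igf: "integrable lborel (\<lambda>x. complex_of_real \<epsilon> * (f x * complex_of_real (test_fun m \<tau> x)))"
    using weak(3) by (simp add: g_def mult.assoc)
  have "inverse (complex_of_real \<epsilon>) * (complex_of_real \<epsilon> * w) = w" for w
    using \<epsilon> by simp
  with integrable_mult_right[OF igf, of "inverse (complex_of_real \<epsilon>)"]
  have iff: "integrable lborel (\<lambda>x. f x * complex_of_real (test_fun m \<tau> x))"
    by (simp only:)
  have gf: "complex_of_real \<epsilon> * (\<integral>x. f x * complex_of_real (test_fun m \<tau> x) \<partial>lborel) = \<i> * lam * complex_of_real ?X - ?L"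
    using weak(4) by (simp add: g_def mult.assoc)
  have iRe: "integrable lborel (\<lambda>x. Re (f x) * test_fun m \<tau> x)" "integrable lborel (\<lambda>x. Im (f x) * test_fun m \<tau> x)"
    using integrable_Re[OF iff] integrable_Im[OF iff] by simp_all
  show "integrable lborel (\<lambda>x. F x * test_fun m \<tau> x)"
    using F iRe by auto
  \<comment> \<open>The real part of \<open>\<i> * lam * X\<close> is \<open>- Im lam * X\<close>
    and its imaginary part is \<open>Re lam * X\<close>. Both are \<open>- \<mu> * X\<close>, which
    explains the sign in \<open>\<mu> = - Re lam\<close>.\<close>
  have "\<epsilon> * (\<mu> * (\<integral>x. F x * test_fun m \<tau> x \<partial>lborel)) \<le> - (\<mu>\<^sup>2 * ?X) + \<bar>\<mu>\<bar> * cmod ?L"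
    using F
  proof (elim disjE conjE)
    assume *: "F = (\<lambda>x. Re (f x))" "\<mu> = Im lam"
    have "\<epsilon> * (\<integral>x. F x * test_fun m \<tau> x \<partial>lborel) = Re (complex_of_real \<epsilon> * (\<integral>x. f x * complex_of_real (test_fun m \<tau> x) \<partial>lborel))"
      using integral_Re[OF iff] by (simp add: *)
    also have "\<dots> = - \<mu> * ?X - Re ?L"
      unfolding gf by (simp add: *)
    finally have "\<mu> * (\<epsilon> * (\<integral>x. F x * test_fun m \<tau> x \<partial>lborel)) = \<mu> * (- \<mu> * ?X - Re ?L)"
      by (rule arg_cong)
    then have "\<epsilon> * (\<mu> * (\<integral>x. F x * test_fun m \<tau> x \<partial>lborel)) = - (\<mu>\<^sup>2 * ?X) - \<mu> * Re ?L"
      by (simp only: mult.left_commute[of \<mu> \<epsilon>] power2_eq_square right_diff_distrib mult_minus_left mult_minus_right mult.assoc)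
    moreover have "\<bar>\<mu> * Re ?L\<bar> \<le> \<bar>\<mu>\<bar> * cmod ?L"
      unfolding abs_mult by (intro mult_left_mono abs_Re_le_cmod) auto
    ultimately show ?thesis by linarith
  next
    assume *: "F = (\<lambda>x. Im (f x))" "\<mu> = - Re lam"
    have "\<epsilon> * (\<integral>x. F x * test_fun m \<tau> x \<partial>lborel) = Im (complex_of_real \<epsilon> * (\<integral>x. f x * complex_of_real (test_fun m \<tau> x) \<partial>lborel))"
      using integral_Im[OF iff] by (simp add: *)
    also have "\<dots> = - \<mu> * ?X - Im ?L"
      unfolding gf by (simp add: *)
    finally have "\<mu> * (\<epsilon> * (\<integral>x. F x * test_fun m \<tau> x \<partial>lborel)) = \<mu> * (- \<mu> * ?X - Im ?L)"
      by (rule arg_cong)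
    then have "\<epsilon> * (\<mu> * (\<integral>x. F x * test_fun m \<tau> x \<partial>lborel)) = - (\<mu>\<^sup>2 * ?X) - \<mu> * Im ?L"
      by (simp only: mult.left_commute[of \<mu> \<epsilon>] power2_eq_square right_diff_distrib mult_minus_left mult_minus_right mult.assoc)
    moreover have "\<bar>\<mu> * Im ?L\<bar> \<le> \<bar>\<mu>\<bar> * cmod ?L"
      unfolding abs_mult by (intro mult_left_mono abs_Im_le_cmod) auto
    ultimately show ?thesis by linarith
  qed
  with err have "\<epsilon> * (\<mu> * (\<integral>x. F x * test_fun m \<tau> x \<partial>lborel)) \<le> \<tau> * (K * sqrt (2 * pi * \<tau>) ^ CARD('n))"
    by linarith
  also have "\<tau> * (K * sqrt (2 * pi * \<tau>) ^ CARD('n)) = \<bar>\<mu>\<bar> powr (1 - 1 / (p - 1)) * A powr ?p' * (2 * ?p') powr ?p' *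
      \<tau> powr (1 - ?p') * sqrt (2 * pi * \<tau>) ^ CARD('n)"
  proof -
    have 1: "\<tau> * (A / \<tau>) powr ?p' = A powr ?p' * \<tau> powr (1 - ?p')"
      using A \<tau> by (simp add: powr_divide powr_diff)
    have "\<tau> * (K * sqrt (2 * pi * \<tau>) ^ CARD('n)) = \<bar>\<mu>\<bar> powr (1 - 1 / (p - 1)) * (2 * ?p') powr ?p' *
        sqrt (2 * pi * \<tau>) ^ CARD('n) * (\<tau> * (A / \<tau>) powr ?p')"
      unfolding K_def by (simp only: mult_ac)
    then show ?thesis
      unfolding 1 by (simp only: mult_ac)
  qed
  finally show "\<epsilon> * (\<integral>x. \<mu> * F x * test_fun m \<tau> x \<partial>lborel) \<le>
    \<bar>\<mu>\<bar> powr (1 - 1 / (p - 1)) * A powr (p / (p - 1)) * (2 * (p / (p - 1))) powr (p / (p - 1)) *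
      \<tau> powr (1 - p / (p - 1)) * sqrt (2 * pi * \<tau>) ^ CARD('n)"
    by (simp add: mult.assoc)
qed

subsection \<open>The lifespan bound\<close>

text \<open>With \<open>R = sqrt \<tau>\<close>, only a ball inside the shell
  \<open>R < norm x < 2 * R\<close> is kept. There \<open>(x \<bullet> x) / \<tau>\<close> lies
  between 1 and 4, so the test function is bounded below, and \<open>R powr (- k)\<close> times the
  volume of order \<open>R ^ CARD('n)\<close> gives the power of \<open>\<tau>\<close>. The rest of
  the exterior contributes nonnegatively; on the unit ball the test function is at most
  \<open>(1 / \<tau>) ^ m\<close>.\<close>

lemma test_fun_integral_lower:
  fixes F :: "real ^ 'n \<Rightarrow> real" and \<mu> k \<tau> :: real
  assumes F: "integrable lborel F" and iF: "integrable lborel (\<lambda>x. F x * test_fun m \<tau> x)"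
    and low: "AE x in lborel. norm x > 1 \<longrightarrow> \<mu> * F x \<ge> norm x powr (- k)"
    and \<tau>: "\<tau> \<ge> 1" and k: "k > 0"
  shows "exp (- 4) * (1 - exp (- 1)) ^ m * 2 powr (- k) * unit_ball_vol CARD('n) * (1 / 2) ^ CARD('n) *
      \<tau> powr ((real CARD('n) - k) / 2) - \<bar>\<mu>\<bar> * (\<integral>x. \<bar>F x\<bar> \<partial>lborel) * (1 / \<tau>) ^ m
    \<le> (\<integral>x. \<mu> * F x * test_fun m \<tau> x \<partial>lborel)"
proof -
  define R where "R = sqrt \<tau>"
  have R: "R \<ge> 1" "R\<^sup>2 = \<tau>" using \<tau> by (simp_all add: R_def)
  \<comment> \<open>A ball of radius \<open>R / 2\<close> about a point at distance
    \<open>3 / 2 * R\<close> fits into the shell and has an explicit volume in every dimension. Any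
    coordinate direction serves, so the index is \<open>undefined\<close>.\<close>
  define c :: "real ^ 'n" where "c = (3 / 2 * R) *\<^sub>R axis undefined 1"
  define S where "S = ball c (R / 2)"
  define D where "D = (2 * R) powr (- k) * (exp (- 4) * (1 - exp (- 1)) ^ m)"
  have normc: "norm c = 3 / 2 * R" using R by (simp add: c_def norm_axis_1)
  have S: "R < norm x" "norm x < 2 * R" if "x \<in> S" for x
  proof -
    have "norm (c - x) < R / 2" using that by (simp add: S_def dist_norm)
    then show "R < norm x" "norm x < 2 * R"
      using norm_triangle_ineq2[of c x] norm_triangle_ineq3[of c x] normc by linarith+
  qed
  have meas_S: "measure lborel S = unit_ball_vol CARD('n) * (R / 2) ^ CARD('n)"
    using content_ball[of "R / 2" c] R by (simp add: S_def)
  have fin_S: "emeasure lborel S < \<infinity>"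
    unfolding S_def by (rule emeasure_bounded_finite[OF bounded_ball])
  have iS: "integrable lborel (\<lambda>x. D * indicator S x :: real)"
    using fin_S by (intro integrable_mult_right integrable_real_indicator) (auto simp: S_def)
  have "AE x in lborel. D * indicator S x - \<bar>\<mu>\<bar> * \<bar>F x\<bar> * (1 / \<tau>) ^ m \<le> \<mu> * F x * test_fun m \<tau> x"
    using low
  proof eventually_elim
    case (elim x)
    have t0: "0 \<le> test_fun m \<tau> x" using \<tau> by (intro test_fun_nonneg) auto
    show ?case
    proof (cases "norm x > 1")
      case False
      then have "x \<notin> S" using S(1)[of x] R by auto
      have "x \<bullet> x \<le> 1"
        using False power_le_one[of "norm x" 2] by (simp add: power2_norm_eq_inner)
      then have q: "0 \<le> (x \<bullet> x) / \<tau>" "(x \<bullet> x) / \<tau> \<le> 1 / \<tau>"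
        using \<tau> by (auto intro: divide_right_mono)
      have "1 - exp (- ((x \<bullet> x) / \<tau>)) \<le> (x \<bullet> x) / \<tau>"
        using exp_ge_add_one_self[of "- ((x \<bullet> x) / \<tau>)"] by linarith
      then have "(1 - exp (- ((x \<bullet> x) / \<tau>))) ^ m \<le> (1 / \<tau>) ^ m"
        using q by (intro power_mono) auto
      then have "test_fun m \<tau> x \<le> 1 * (1 / \<tau>) ^ m"
        unfolding test_fun_def using q by (intro mult_mono) auto
      then have "\<bar>\<mu> * F x\<bar> * test_fun m \<tau> x \<le> \<bar>\<mu> * F x\<bar> * (1 / \<tau>) ^ m"
        by (intro mult_left_mono) auto
      moreover have "\<bar>\<mu> * F x * test_fun m \<tau> x\<bar> = \<bar>\<mu> * F x\<bar> * test_fun m \<tau> x"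
        using t0 by (simp add: abs_mult)
      ultimately have "- (\<bar>\<mu> * F x\<bar> * (1 / \<tau>) ^ m) \<le> \<mu> * F x * test_fun m \<tau> x"
        by linarith
      then show ?thesis
        using \<open>x \<notin> S\<close> by (simp add: abs_mult)
    next
      case True
      with elim have low: "norm x powr (- k) \<le> \<mu> * F x" by simp
      have "D * indicator S x \<le> \<mu> * F x * test_fun m \<tau> x"
      proof (cases "x \<in> S")
        case False
        have "0 \<le> \<mu> * F x" using low powr_ge_zero[of "norm x" "- k"] by linarith
        then show ?thesis using False t0 by simp
      next
        case True
        have q: "(x \<bullet> x) / \<tau> = (norm x / R)\<^sup>2"
          using R by (simp add: power2_norm_eq_inner power_divide)
        have "1 \<le> norm x / R" "norm x / R \<le> 2"
          using S[OF True] R by (auto simp: field_simps)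
        then have "1 \<le> (norm x / R)\<^sup>2" "(norm x / R)\<^sup>2 \<le> 2\<^sup>2"
          using power_mono[of "norm x / R" 2 2] by (auto intro: one_le_power)
        then have q': "1 \<le> (x \<bullet> x) / \<tau>" "(x \<bullet> x) / \<tau> \<le> 4"
          unfolding q by simp_all
        have 1: "exp (- 4) * (1 - exp (- 1)) ^ m \<le> test_fun m \<tau> x"
          unfolding test_fun_def using q' by (intro mult_mono power_mono) auto
        have "(2 * R) powr (- k) \<le> norm x powr (- k)"
          using S[OF True] R k by (intro powr_mono2') auto
        then have "D \<le> \<mu> * F x * test_fun m \<tau> x"
          unfolding D_def using 1 low by (intro mult_mono) (auto intro: order_trans[OF powr_ge_zero])
        then show ?thesis using True by simp
      qed
      moreover have "0 \<le> \<bar>\<mu>\<bar> * \<bar>F x\<bar> * (1 / \<tau>) ^ m" using \<tau> by simp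
      ultimately show ?thesis by linarith
    qed
  qed
  then have "(\<integral>x. D * indicator S x - \<bar>\<mu>\<bar> * \<bar>F x\<bar> * (1 / \<tau>) ^ m \<partial>lborel) \<le> (\<integral>x. \<mu> * F x * test_fun m \<tau> x \<partial>lborel)"
    using iS F iF by (intro integral_mono_AE) (auto simp: mult.assoc)
  also have "(\<integral>x. D * indicator S x - \<bar>\<mu>\<bar> * \<bar>F x\<bar> * (1 / \<tau>) ^ m \<partial>lborel) =
      (\<integral>x. D * indicator S x \<partial>lborel) - (\<integral>x. \<bar>\<mu>\<bar> * \<bar>F x\<bar> * (1 / \<tau>) ^ m \<partial>lborel)"
    using iS F by (intro Bochner_Integration.integral_diff) auto
  also have "(\<integral>x. D * indicator S x \<partial>lborel) = D * (unit_ball_vol CARD('n) * (R / 2) ^ CARD('n))"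
    by (simp add: meas_S)
  also have "(\<integral>x. \<bar>\<mu>\<bar> * \<bar>F x\<bar> * (1 / \<tau>) ^ m \<partial>lborel) = \<bar>\<mu>\<bar> * (\<integral>x. \<bar>F x\<bar> \<partial>lborel) * (1 / \<tau>) ^ m"
    by (simp only: mult.assoc integral_mult_right_zero integral_mult_left_zero)
  also have "D * (unit_ball_vol CARD('n) * (R / 2) ^ CARD('n)) =
      exp (- 4) * (1 - exp (- 1)) ^ m * 2 powr (- k) * unit_ball_vol CARD('n) * (1 / 2) ^ CARD('n) *
      \<tau> powr ((real CARD('n) - k) / 2)"
  proof -
    have "\<tau> powr ((real CARD('n) - k) / 2) = R powr (real CARD('n) - k)"
      using R \<tau> by (simp add: R_def powr_half_sqrt[symmetric] powr_powr)
    also have "\<dots> = R ^ CARD('n) * R powr (- k)"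
      using R powr_realpow[of R "CARD('n)"] powr_add[of R "real CARD('n)" "- k"] by simp
    finally show ?thesis
      using R unfolding D_def by (simp add: powr_mult power_divide mult_ac)
  qed
  finally show ?thesis .
qed

text \<open>\<open>C\<close> is quantified before \<open>f\<close> and \<open>F\<close>, as the
  constant may depend only on the exponents, the dimension and \<open>\<mu>\<close>. The size of
  \<open>f\<close> is allowed to enter through \<open>\<epsilon>0\<close>.\<close>

lemma lifespan_bound:
  fixes p k \<mu> :: real and lam :: complex
  assumes p: "1 < p" "p < 1 + 2 / real CARD('n::finite)"
    and k: "real CARD('n) < k" "k < 2 / (p - 1)" and \<mu>: "\<mu> \<noteq> 0"
  shows "\<exists>C>0. \<forall>(f :: real ^ 'n \<Rightarrow> complex) F. in_Lp 2 f \<longrightarrow>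
    (F = (\<lambda>x. Re (f x)) \<and> \<mu> = Im lam) \<or> (F = (\<lambda>x. Im (f x)) \<and> \<mu> = - Re lam) \<longrightarrow>
    integrable lborel F \<longrightarrow> (AE x in lborel. norm x > 1 \<longrightarrow> \<mu> * F x \<ge> norm x powr (- k)) \<longrightarrow>
    (\<exists>\<epsilon>0>0. \<forall>\<epsilon>. 0 < \<epsilon> \<and> \<epsilon> < \<epsilon>0 \<longrightarrow>
       lifespan p lam (\<lambda>x. complex_of_real \<epsilon> * f x)
         \<le> ennreal (C * \<epsilon> powr (1 / (k / 2 - 1 / (p - 1)))))"
proof -
  define \<kappa> where "\<kappa> = k / 2 - 1 / (p - 1)"
  have \<kappa>: "\<kappa> < 0" using k(2) p by (simp add: \<kappa>_def field_simps)
  have k0: "k > 0" using k(1) by (rule le_less_trans[rotated]) simp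
  \<comment> \<open>The first lower bound is the one for Young's inequality;
    \<open>m \<ge> k\<close> makes the contribution of the unit ball negligible against the
    tail.\<close>
  obtain m :: nat where m: "real m \<ge> max (2 * (p / (p - 1))) k"
    using real_arch_simple by blast
  then have m1: "real m \<ge> 2 * (p / (p - 1))" and mk: "real m \<ge> k" by simp_all
  define c1 where "c1 = exp (- 4) * (1 - exp (- 1)) ^ m * 2 powr (- k) * unit_ball_vol CARD('n) * (1 / 2 :: real) ^ CARD('n)"
  have c1: "c1 > 0" unfolding c1_def by (intro mult_pos_pos zero_less_power) auto
  define A where "A = m + 2 * real CARD('n) * (1 + real m) + 4 * (1 + 3 * real m + real m * (real m - 1))"
  define C2 where "C2 = \<bar>\<mu>\<bar> powr (1 - 1 / (p - 1)) * A powr (p / (p - 1)) * (2 * (p / (p - 1))) powr (p / (p - 1)) *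
    sqrt (2 * pi) ^ CARD('n)"
  define C3 where "C3 = 2 * C2 / c1"
  \<comment> \<open>The first summand comes from solving
    \<open>\<epsilon> \<le> C3 * \<tau> powr \<kappa>\<close> for \<open>\<tau>\<close>. The
    additional 1 ensures that a time beyond \<open>C * \<epsilon> powr (1 / \<kappa>)\<close> also
    exceeds \<open>\<tau>0\<close>.\<close>
  define C where "C = C3 powr (- 1 / \<kappa>) + 1"
  have C2: "C2 \<ge> 0" by (simp add: C2_def)
  have C3: "C3 \<ge> 0" using C2 c1 by (simp add: C3_def)
  have C: "C \<ge> 1" by (simp add: C_def)
  have "\<exists>\<epsilon>0>0. \<forall>\<epsilon>. 0 < \<epsilon> \<and> \<epsilon> < \<epsilon>0 \<longrightarrow>
       lifespan p lam (\<lambda>x. complex_of_real \<epsilon> * f x) \<le> ennreal (C * \<epsilon> powr (1 / \<kappa>))"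
    if f: "in_Lp 2 f" and F: "(F = (\<lambda>x. Re (f x)) \<and> \<mu> = Im lam) \<or> (F = (\<lambda>x. Im (f x)) \<and> \<mu> = - Re lam)"
      and iF: "integrable lborel F" and low: "AE x in lborel. norm x > 1 \<longrightarrow> \<mu> * F x \<ge> norm x powr (- k)"
    for f :: "real ^ 'n \<Rightarrow> complex" and F
  proof -
    define N where "N = \<bar>\<mu>\<bar> * (\<integral>x. \<bar>F x\<bar> \<partial>lborel)"
    \<comment> \<open>From \<open>\<tau>0\<close> on, the loss \<open>N * (1 / \<tau>) ^ m\<close>
      on the unit ball is at most half of the tail term.\<close>
    define \<tau>0 where "\<tau>0 = max 1 (2 * N / c1)"
    have \<tau>0: "\<tau>0 \<ge> 1" by (simp add: \<tau>0_def)
    have bound: "\<tau> \<le> C3 powr (- 1 / \<kappa>) * \<epsilon> powr (1 / \<kappa>)"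
      if \<epsilon>: "0 < \<epsilon>" and \<tau>: "\<tau> \<ge> \<tau>0" "ennreal \<tau> < T" and sol: "L2_solution p lam (\<lambda>x. complex_of_real \<epsilon> * f x) T u"
      for \<epsilon> \<tau> T u
    proof -
      have \<tau>1: "\<tau> \<ge> 1" "\<tau> > 0" using \<tau> \<tau>0 by auto
      note est = test_function_estimate[OF p \<tau>1(2) \<tau>(2) sol f m1 \<epsilon> \<mu> F, folded A_def]
      have lower: "c1 * \<tau> powr ((real CARD('n) - k) / 2) - N * (1 / \<tau>) ^ m \<le> (\<integral>x. \<mu> * F x * test_fun m \<tau> x \<partial>lborel)"
        using test_fun_integral_lower[OF iF est(2) low \<tau>1(1) k0] by (simp only: c1_def N_def)
      have "N * (1 / \<tau>) ^ m \<le> c1 / 2 * \<tau> powr ((real CARD('n) - k) / 2)"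
      proof -
        have "N \<le> c1 / 2 * \<tau>" using \<tau>(1) c1 by (simp add: \<tau>0_def field_simps)
        also have "\<dots> \<le> c1 / 2 * \<tau> powr ((real CARD('n) - k) / 2 + real m)"
        proof (intro mult_left_mono)
          \<comment> \<open>By \<open>m \<ge> k\<close> the exponent is at least half of the
            dimension plus \<open>k\<close>, and both of these are at least 1.\<close>
          have "1 \<le> real CARD('n)" by (simp add: Suc_le_eq)
          moreover have "1 \<le> (N - k) / 2 + real m" if "1 \<le> N" "N < k" for N :: real
            using that mk by (simp add: field_simps)
          ultimately have "1 \<le> (real CARD('n) - k) / 2 + real m" using k(1) by blast
          then have "\<tau> powr 1 \<le> \<tau> powr ((real CARD('n) - k) / 2 + real m)"
            using \<tau>1 by (intro powr_mono) auto
          then show "\<tau> \<le> \<tau> powr ((real CARD('n) - k) / 2 + real m)" using \<tau>1 by simp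
        qed (use c1 in auto)
        also have "\<dots> = c1 / 2 * \<tau> powr ((real CARD('n) - k) / 2) * \<tau> ^ m"
          using \<tau>1 by (simp add: powr_add powr_realpow)
        finally show ?thesis using \<tau>1 by (simp add: power_one_over field_simps)
      qed
      with lower have "c1 / 2 * \<tau> powr ((real CARD('n) - k) / 2) \<le> (\<integral>x. \<mu> * F x * test_fun m \<tau> x \<partial>lborel)"
        by linarith
      then have "\<epsilon> * (c1 / 2 * \<tau> powr ((real CARD('n) - k) / 2)) \<le> \<epsilon> * (\<integral>x. \<mu> * F x * test_fun m \<tau> x \<partial>lborel)"
        using \<epsilon> by (intro mult_left_mono) auto
      also have "\<dots> \<le> C2 * (\<tau> powr (1 - p / (p - 1)) * \<tau> powr (real CARD('n) / 2))"
      proof -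
        have "sqrt (2 * pi * \<tau>) ^ CARD('n) = sqrt (2 * pi) ^ CARD('n) * \<tau> powr (real CARD('n) / 2)"
          using \<tau>1 by (simp add: real_sqrt_mult power_mult_distrib powr_half_sqrt[symmetric] powr_power)
        then show ?thesis
          using est(1) by (simp add: C2_def mult_ac)
      qed
      \<comment> \<open>Here \<open>\<kappa>\<close> arises: \<open>1 - p / (p - 1)\<close> is
        \<open>- 1 / (p - 1)\<close>, and once the power of the tail is split off, it cancels from
        both sides.\<close>
      also have "\<dots> = C2 * \<tau> powr \<kappa> * \<tau> powr ((real CARD('n) - k) / 2)"
      proof -
        have "1 - p / (p - 1) + real CARD('n) / 2 = \<kappa> + (real CARD('n) - k) / 2"
          using p by (simp add: \<kappa>_def field_simps)
        then show ?thesis by (simp add: powr_add[symmetric] mult.assoc)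
      qed
      finally have "\<epsilon> * (c1 / 2) * \<tau> powr ((real CARD('n) - k) / 2) \<le> C2 * \<tau> powr \<kappa> * \<tau> powr ((real CARD('n) - k) / 2)"
        by (simp add: mult.assoc)
      then have "\<epsilon> * (c1 / 2) \<le> C2 * \<tau> powr \<kappa>"
        using \<tau>1 by simp
      then have "\<epsilon> \<le> C3 * \<tau> powr \<kappa>"
        using c1 by (simp add: C3_def field_simps)
      then have "\<tau> powr (- \<kappa>) \<le> C3 / \<epsilon>"
        using \<epsilon> \<tau>1 by (simp add: powr_minus field_simps)
      then have "(\<tau> powr (- \<kappa>)) powr (- 1 / \<kappa>) \<le> (C3 / \<epsilon>) powr (- 1 / \<kappa>)"
        using \<kappa> by (intro powr_mono2) (auto simp: divide_nonpos_neg)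
      moreover have "(\<tau> powr (- \<kappa>)) powr (- 1 / \<kappa>) = \<tau>"
        using \<kappa> \<tau>1 by (simp add: powr_powr)
      moreover have "(C3 / \<epsilon>) powr (- 1 / \<kappa>) = C3 powr (- 1 / \<kappa>) * \<epsilon> powr (1 / \<kappa>)"
      proof -
        have "\<epsilon> powr (- 1 / \<kappa>) = inverse (\<epsilon> powr (1 / \<kappa>))"
          using powr_minus[of \<epsilon> "1 / \<kappa>"] by simp
        moreover have "(C3 / \<epsilon>) powr (- 1 / \<kappa>) = C3 powr (- 1 / \<kappa>) / \<epsilon> powr (- 1 / \<kappa>)"
          by (rule powr_divide)
        ultimately show ?thesis
          by (simp only: divide_inverse[of "C3 powr _"] inverse_inverse_eq)
      qed
      ultimately show ?thesis by simp
    qed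
    show ?thesis
    \<comment> \<open>As \<open>\<kappa>\<close> is negative,
      \<open>\<epsilon> < \<tau>0 powr \<kappa>\<close> means that
      \<open>\<epsilon> powr (1 / \<kappa>)\<close> is at least \<open>\<tau>0\<close>.\<close>
    proof (intro exI[of _ "\<tau>0 powr \<kappa>"] conjI allI impI)
      show "\<tau>0 powr \<kappa> > 0" using \<tau>0 by simp
      fix \<epsilon> assume "0 < \<epsilon> \<and> \<epsilon> < \<tau>0 powr \<kappa>"
      then have \<epsilon>: "0 < \<epsilon>" "\<epsilon> \<le> \<tau>0 powr \<kappa>" by auto
      have "(\<tau>0 powr \<kappa>) powr (1 / \<kappa>) \<le> \<epsilon> powr (1 / \<kappa>)"
        using \<epsilon> \<kappa> by (intro powr_mono2') auto
      then have \<tau>0_le: "\<tau>0 \<le> \<epsilon> powr (1 / \<kappa>)"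
        using \<tau>0 \<kappa> by (simp add: powr_powr)
      show "lifespan p lam (\<lambda>x. complex_of_real \<epsilon> * f x) \<le> ennreal (C * \<epsilon> powr (1 / \<kappa>))"
        unfolding lifespan_def
      proof (rule Sup_least, rule ccontr)
        fix T assume "T \<in> {T. 0 < T \<and> unique_L2_solution p lam (\<lambda>x. complex_of_real \<epsilon> * f x) T}"
        then obtain u where u: "L2_solution p lam (\<lambda>x. complex_of_real \<epsilon> * f x) T u"
          unfolding unique_L2_solution_def by blast
        assume "\<not> T \<le> ennreal (C * \<epsilon> powr (1 / \<kappa>))"
        then have "ennreal (C * \<epsilon> powr (1 / \<kappa>)) < T" by simp
        \<comment> \<open>The estimate wants a finite time strictly below \<open>T\<close>, and
          \<open>T\<close> may be infinite; density of the order provides one that still exceeds the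
          claimed bound.\<close>
        then obtain y where y: "ennreal (C * \<epsilon> powr (1 / \<kappa>)) < y" "y < T"
          using dense by blast
        then obtain \<tau> where \<tau>: "y = ennreal \<tau>" "0 \<le> \<tau>"
          by (cases y) (auto simp: top_unique)
        have "C * \<epsilon> powr (1 / \<kappa>) < \<tau>"
          using y(1) \<tau> C by (simp add: ennreal_less_iff)
        moreover have "C * \<epsilon> powr (1 / \<kappa>) = C3 powr (- 1 / \<kappa>) * \<epsilon> powr (1 / \<kappa>) + \<epsilon> powr (1 / \<kappa>)"
          by (simp add: C_def algebra_simps)
        moreover have "0 \<le> C3 powr (- 1 / \<kappa>) * \<epsilon> powr (1 / \<kappa>)" by simp
        ultimately have "\<tau> \<ge> \<tau>0" "\<tau> > C3 powr (- 1 / \<kappa>) * \<epsilon> powr (1 / \<kappa>)"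
          using \<tau>0_le \<epsilon> powr_ge_zero[of \<epsilon> "1 / \<kappa>"] by linarith+
        with bound[OF \<epsilon>(1) _ _ u, of \<tau>] y(2) \<tau> show False by auto
      qed
    qed
  qed
  then show ?thesis
    using C unfolding \<kappa>_def by (intro exI[of _ C]) auto
qed

text \<open>From \<open>lam \<noteq> 0\<close> alone one of the two parts of \<open>lam\<close> may
  vanish; this shows that the corresponding condition is then void. With \<open>m = 0\<close> and
  \<open>\<tau> = 1\<close> the lower bound for the tail is positive, while \<open>\<mu> = 0\<close>
  would make the integral above it zero.\<close>

lemma AE_lower_bound_imp_nonzero:
  fixes F :: "real ^ 'n \<Rightarrow> real"
  assumes F: "integrable lborel F" and low: "AE x in lborel. norm x > 1 \<longrightarrow> \<mu> * F x \<ge> norm x powr (- k)" and k: "k > 0"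
  shows "\<mu> \<noteq> 0"
proof
  assume "\<mu> = 0"
  moreover have "integrable lborel (\<lambda>x. F x * test_fun 0 1 x)"
  proof (rule Bochner_Integration.integrable_bound[OF F])
    have "(\<lambda>x::real^'n. test_fun 0 1 x) \<in> borel_measurable borel"
      unfolding test_fun_def by (intro borel_measurable_continuous_onI continuous_intros) auto
    then show "(\<lambda>x. F x * test_fun 0 1 x) \<in> borel_measurable lborel"
      using borel_measurable_integrable[OF F] by simp
    show "AE x in lborel. norm (F x * test_fun 0 1 x) \<le> norm (F x)"
      by (intro AE_I2) (auto simp: test_fun_def abs_mult mult_left_le)
  qed
  ultimately have "exp (- 4) * (1 - exp (- 1)) ^ 0 * 2 powr (- k) * unit_ball_vol CARD('n) * (1 / 2 :: real) ^ CARD('n) \<le> 0"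
    using test_fun_integral_lower[OF F _ low _ k, of 0 1] by simp
  moreover have "exp (- 4) * (1 - exp (- 1)) ^ 0 * 2 powr (- k) * unit_ball_vol CARD('n) * (1 / 2 :: real) ^ CARD('n) > 0"
    by (intro mult_pos_pos zero_less_power) auto
  ultimately show False by linarith
qed

theorem theorem2p4:
  fixes p k :: real and lam :: complex
  assumes "1 < p" and "p < 1 + 2 / real CARD('n::finite)"
    and "lam \<noteq> 0"
    and "real CARD('n) < k" and "k < 2 / (p - 1)"
  shows "\<exists>C>0. \<forall>f :: real ^ 'n \<Rightarrow> complex.
    in_Lp 2 f \<longrightarrow>
    (integrable lborel (\<lambda>x. Re (f x)) \<and>
       (AE x in lborel. norm x > 1 \<longrightarrow> Im lam * Re (f x) \<ge> norm x powr (- k))) \<or>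
    (integrable lborel (\<lambda>x. Im (f x)) \<and>
       (AE x in lborel. norm x > 1 \<longrightarrow> - Re lam * Im (f x) \<ge> norm x powr (- k))) \<longrightarrow>
    (\<exists>\<epsilon>0>0. \<forall>\<epsilon>. 0 < \<epsilon> \<and> \<epsilon> < \<epsilon>0 \<longrightarrow>
       lifespan p lam (\<lambda>x. complex_of_real \<epsilon> * f x)
         \<le> ennreal (C * \<epsilon> powr (1 / (k / 2 - 1 / (p - 1)))))"
proof -
  have k0: "k > 0" using assms(4) by (rule le_less_trans[rotated]) simp
  let ?e = "1 / (k / 2 - 1 / (p - 1))"
  define P where "P \<mu> C \<longleftrightarrow> (\<forall>(f :: real ^ 'n \<Rightarrow> complex) F. in_Lp 2 f \<longrightarrow>
    (F = (\<lambda>x. Re (f x)) \<and> \<mu> = Im lam) \<or> (F = (\<lambda>x. Im (f x)) \<and> \<mu> = - Re lam) \<longrightarrow>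
    integrable lborel F \<longrightarrow> (AE x in lborel. norm x > 1 \<longrightarrow> \<mu> * F x \<ge> norm x powr (- k)) \<longrightarrow>
    (\<exists>\<epsilon>0>0. \<forall>\<epsilon>. 0 < \<epsilon> \<and> \<epsilon> < \<epsilon>0 \<longrightarrow>
       lifespan p lam (\<lambda>x. complex_of_real \<epsilon> * f x) \<le> ennreal (C * \<epsilon> powr ?e)))" for \<mu> C
  \<comment> \<open>For \<open>\<mu> = 0\<close> no \<open>f\<close> meets the condition, so any
    positive constant serves.\<close>
  have ex: "\<exists>C>0. P \<mu> C" for \<mu>
  proof (cases "\<mu> = 0")
    case True
    then have "P \<mu> 1"
      unfolding P_def using AE_lower_bound_imp_nonzero[OF _ _ k0, of _ \<mu>] by blast
    then show ?thesis by (intro exI[of _ 1]) simp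
  next
    case False
    show ?thesis
      unfolding P_def by (rule lifespan_bound[OF assms(1,2,4,5) False])
  qed
  obtain C1 where C1: "C1 > 0" "P (Im lam) C1" using ex by blast
  obtain C2 where C2: "C2 > 0" "P (- Re lam) C2" using ex by blast
  have mono: "ennreal (C1 * \<epsilon> powr ?e) \<le> ennreal ((C1 + C2) * \<epsilon> powr ?e)"
    "ennreal (C2 * \<epsilon> powr ?e) \<le> ennreal ((C1 + C2) * \<epsilon> powr ?e)" for \<epsilon>
    using C1(1) C2(1) by (auto intro!: ennreal_leI mult_right_mono)
  show ?thesis
  \<comment> \<open>The constant is fixed before it is known which of the two conditions
    \<open>f\<close> satisfies; the sum covers both.\<close>
  proof (rule exI[of _ "C1 + C2"], intro conjI allI impI)
    show "C1 + C2 > 0" using C1(1) C2(1) by simp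
    fix f :: "real ^ 'n \<Rightarrow> complex"
    assume f: "in_Lp 2 f"
    assume "(integrable lborel (\<lambda>x. Re (f x)) \<and>
       (AE x in lborel. norm x > 1 \<longrightarrow> Im lam * Re (f x) \<ge> norm x powr (- k))) \<or>
      (integrable lborel (\<lambda>x. Im (f x)) \<and>
       (AE x in lborel. norm x > 1 \<longrightarrow> - Re lam * Im (f x) \<ge> norm x powr (- k)))"
    then show "\<exists>\<epsilon>0>0. \<forall>\<epsilon>. 0 < \<epsilon> \<and> \<epsilon> < \<epsilon>0 \<longrightarrow>
       lifespan p lam (\<lambda>x. complex_of_real \<epsilon> * f x) \<le> ennreal ((C1 + C2) * \<epsilon> powr ?e)"
    proof (elim disjE conjE)
      assume "integrable lborel (\<lambda>x. Re (f x))" "AE x in lborel. norm x > 1 \<longrightarrow> Im lam * Re (f x) \<ge> norm x powr (- k)"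
      then show ?thesis
        using C1(2)[unfolded P_def, rule_format, of f "\<lambda>x. Re (f x)"] f order_trans[OF _ mono(1)] by simp blast
    next
      assume "integrable lborel (\<lambda>x. Im (f x))" "AE x in lborel. norm x > 1 \<longrightarrow> - Re lam * Im (f x) \<ge> norm x powr (- k)"
      then show ?thesis
        using C2(2)[unfolded P_def, rule_format, of f "\<lambda>x. Im (f x)"] f order_trans[OF _ mono(2)] by simp blast
    qed
  qed
qed

end
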